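(* Let $(\Sigma,D,T)$ be an affine surface equipped with a parallel (nonzero) nilpotent $(1,1)$-tensor field $T$ and let $\Phi$ be a symmetric $(0,2)$-tensor field on $\Sigma$. Let $h\in\mathcal{C}^\infty(\Sigma)$ be a smooth function. Then $(T^*\Sigma,g_{D,\Phi,T},f=h\circ\pi)$ is a Bach-flat gradient Ricci soliton if and only if $dh(\ker T)=0$ and $$\widehat{\Phi}=-\operatorname{Hes}^D_h-2\rho^D_{sym}.$$ Moreover, the soliton is steady and isotropic.
   Context: An affine surface $(\Sigma,D)$ is a smooth surface $\Sigma$ with a torsion free affine connection $D$, with Christoffel symbols ${}^D\Gamma_{ij}{}^k$. Its Ricci tensor is $\rho^D(X,Y)=\operatorname{tr}\{Z\mapsto R^D(Z,X)Y\}$ with $R^D(X,Y)=[D_X,D_Y]-D_{[X,Y]}$, and $\rho^D_{sym}$ is its symmetric part. $\operatorname{Hes}^D_h=D\,dh$. $T$ parallel means $DT=0$; nilpotent means $T^2=0$. For a symmetric $(0,2)$-tensor field $\Phi$ set $\widehat\Phi(X,Y)=\Phi(TX,TY)$. Let $\pi\colon T^*\Sigma\to\Sigma$ be the cotangent bundle. Local coordinates $(x^i)$ on $\Sigma$ induce coordinates $(x^i,x_{i'})$ on $T^*\Sigma$ by writing a covector as $\omega=\sum x_{i'}dx^i$. For a vector field $X$ on $\Sigma$, $\iota X(p,\omega)=\omega(X_p)$, and the complete lift $X^C$ is determined by $X^C(\iota Z)=\iota[X,Z]$ for all $Z$; $\iota T$ is the one-form with $\iota T(X^C)=\iota(TX)$;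 $g_D$ is the metric with $g_D(X^C,Y^C)=-\iota(D_XY+D_YX)$. Then $g_{D,\Phi,T}=\iota T\circ\iota T+g_D+\pi^*\Phi$, where $\omega_1\circ\omega_2=\frac12(\omega_1\otimes\omega_2+\omega_2\otimes\omega_1)$; it has neutral signature. In induced coordinates, with $T\partial_i=T_i^k\partial_k$, $$g_{D,\Phi,T}=2\,dx^i\circ dx_{i'}+\{\tfrac12x_{r'}x_{s'}(T_i^rT_j^s+T_j^rT_i^s)-2x_{k'}{}^D\Gamma_{ij}{}^k+\Phi_{ij}\}\,dx^i\circ dx^j .$$ A triple $(M,g,f)$ with $f\in\mathcal{C}^\infty(M)$ is a gradient Ricci soliton if $\operatorname{Hes}_f+\rho=\lambda g$ for some $\lambda\in\mathbb{R}$, where $\operatorname{Hes}_f=\nabla df$ and $\rho$ is the Ricci tensor of $g$; it is steady if $\lambda=0$. It is isotropic if $\|\nabla f\|^2=0$ but $\nabla f\neq0$. It is Bach-flat if the Bach tensor $\mathfrak{B}_{ij}=\nabla^k\nabla^\ell W_{kij\ell}+\frac12\rho^{k\ell}W_{kij\ell}$ of $g$ vanishes, $W$ being the Weyl tensor.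
   Formalization: "Isotropic" is claimed only when dh is not identically zero (for constant h, ∇f = 0); ‖∇f‖² = 0 always, and ∇f ≠ 0 over each noncritical point of h. Σ need not be connected; T is assumed nonzero on each connected component. *)

theory Defs
  imports "HOL-Analysis.Analysis"
begin

text \<open>
  A manifold is given by an indexed atlas; tensor fields and connections are given by their
  component functions in every chart of the atlas, subject to the usual transformation laws.
  Component functions live on the coordinate side, i.e. on the image of the chart.
\<close>

section \<open>Smooth functions on open subsets of a Euclidean space\<close>

primrec Ck_on :: "nat \<Rightarrow> ('v::real_normed_vector \<Rightarrow> 'w::real_normed_vector) \<Rightarrow> 'v set \<Rightarrow> bool" where
  "Ck_on 0 f S = continuous_on S f"
| "Ck_on (Suc k) f S \<longleftrightarrow>
     (\<forall>x\<in>S. f differentiable (at x)) \<and> (\<forall>v. Ck_on k (\<lambda>x. frechet_derivative f (at x) v) S)"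

definition smooth_on :: "('v::real_normed_vector \<Rightarrow> 'w::real_normed_vector) \<Rightarrow> 'v set \<Rightarrow> bool" where
  "smooth_on f S \<longleftrightarrow> (\<forall>k. Ck_on k f S)"

definition partial :: "'n::finite \<Rightarrow> (real^'n \<Rightarrow> real) \<Rightarrow> real^'n \<Rightarrow> real" where
  "partial a F x = frechet_derivative F (at x) (axis a 1)"

section \<open>Smooth manifolds\<close>

record ('i, 'a, 'n) atlas =
  charts :: "'i set"
  cdom :: "'i \<Rightarrow> 'a set"
  cmap :: "'i \<Rightarrow> 'a \<Rightarrow> real^'n"

definition cran :: "('i, 'a, 'n::finite) atlas \<Rightarrow> 'i \<Rightarrow> (real^'n) set" where
  "cran M i = cmap M i ` cdom M i"

definition cinv :: "('i, 'a, 'n::finite) atlas \<Rightarrow> 'i \<Rightarrow> real^'n \<Rightarrow> 'a" where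
  "cinv M i = inv_into (cdom M i) (cmap M i)"

definition points :: "('i, 'a, 'n::finite) atlas \<Rightarrow> 'a set" where
  "points M = (\<Union>i\<in>charts M. cdom M i)"

definition overlap :: "('i, 'a, 'n::finite) atlas \<Rightarrow> 'i \<Rightarrow> 'i \<Rightarrow> (real^'n) set" where
  "overlap M i j = cmap M i ` (cdom M i \<inter> cdom M j)"

definition transition :: "('i, 'a, 'n::finite) atlas \<Rightarrow> 'i \<Rightarrow> 'i \<Rightarrow> real^'n \<Rightarrow> real^'n" where
  "transition M i j x = cmap M j (cinv M i x)"

definition manifold_topology :: "('i, 'a, 'n::finite) atlas \<Rightarrow> 'a topology" where
  "manifold_topology M =
     topology_generated_by {cdom M i \<inter> cmap M i -` V |i V. i \<in> charts M \<and> open V}"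

definition smooth_manifold :: "('i, 'a, 'n::finite) atlas \<Rightarrow> bool" where
  "smooth_manifold M \<longleftrightarrow>
     points M \<noteq> {} \<and>
     (\<forall>i\<in>charts M. inj_on (cmap M i) (cdom M i) \<and> open (cran M i)) \<and>
     (\<forall>i\<in>charts M. \<forall>j\<in>charts M.
        open (overlap M i j) \<and> smooth_on (transition M i j) (overlap M i j)) \<and>
     Hausdorff_space (manifold_topology M) \<and> second_countable (manifold_topology M)"

text \<open>With \<open>x\<close> the coordinates of chart \<open>i\<close> and \<open>x'\<close> those of chart \<open>j\<close>,
  \<open>jac M i j x a c\<close> is the partial derivative of \<open>x'\<^sup>c\<close> with respect to \<open>x\<^sup>a\<close>.\<close>

definition jac :: "('i, 'a, 'n::finite) atlas \<Rightarrow> 'i \<Rightarrow> 'i \<Rightarrow> real^'n \<Rightarrow> 'n \<Rightarrow> 'n \<Rightarrow> real" where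
  "jac M i j x a c = partial a (\<lambda>z. transition M i j z $ c) x"

definition local_rep :: "('i, 'a, 'n::finite) atlas \<Rightarrow> ('a \<Rightarrow> real) \<Rightarrow> 'i \<Rightarrow> real^'n \<Rightarrow> real" where
  "local_rep M f i x = f (cinv M i x)"

definition smooth_function :: "('i, 'a, 'n::finite) atlas \<Rightarrow> ('a \<Rightarrow> real) \<Rightarrow> bool" where
  "smooth_function M f \<longleftrightarrow> (\<forall>i\<in>charts M. smooth_on (local_rep M f i) (cran M i))"

definition critical_point :: "('i, 'a, 'n::finite) atlas \<Rightarrow> ('a \<Rightarrow> real) \<Rightarrow> 'a \<Rightarrow> bool" where
  "critical_point M f p \<longleftrightarrow>
     (\<forall>i\<in>charts M. p \<in> cdom M i \<longrightarrow> (\<forall>a. partial a (local_rep M f i) (cmap M i p) = 0))"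

section \<open>Tensor fields and connections\<close>

text \<open>\<open>B i x a b\<close> is \<open>B(\<partial>\<^sub>a, \<partial>\<^sub>b)\<close> for a field of type (0,2), and the coefficient in
  \<open>B \<partial>\<^sub>a = \<Sum>\<^sub>b B\<^sub>a\<^sup>b \<partial>\<^sub>b\<close> for a field of type (1,1).\<close>

type_synonym ('i, 'n) field2 = "'i \<Rightarrow> real^'n \<Rightarrow> 'n \<Rightarrow> 'n \<Rightarrow> real"

text \<open>Christoffel symbols: \<open>D\<^bsub>\<partial>a\<^esub> \<partial>\<^sub>b = \<Sum>\<^sub>c \<Gamma> x a b c \<partial>\<^sub>c\<close>.\<close>

type_synonym 'n christoffel = "real^'n \<Rightarrow> 'n \<Rightarrow> 'n \<Rightarrow> 'n \<Rightarrow> real"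

definition tensor_field_02 :: "('i, 'a, 'n::finite) atlas \<Rightarrow> ('i, 'n) field2 \<Rightarrow> bool" where
  "tensor_field_02 M B \<longleftrightarrow>
     (\<forall>i\<in>charts M. \<forall>a b. smooth_on (\<lambda>x. B i x a b) (cran M i)) \<and>
     (\<forall>i\<in>charts M. \<forall>j\<in>charts M. \<forall>x\<in>overlap M i j. \<forall>a b.
        B i x a b =
          (\<Sum>c\<in>UNIV. \<Sum>d\<in>UNIV. jac M i j x a c * jac M i j x b d * B j (transition M i j x) c d))"

definition symmetric_field :: "('i, 'a, 'n::finite) atlas \<Rightarrow> ('i, 'n) field2 \<Rightarrow> bool" where
  "symmetric_field M B \<longleftrightarrow> (\<forall>i\<in>charts M. \<forall>x\<in>cran M i. \<forall>a b. B i x a b = B i x b a)"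

definition tensor_field_11 :: "('i, 'a, 'n::finite) atlas \<Rightarrow> ('i, 'n) field2 \<Rightarrow> bool" where
  "tensor_field_11 M T \<longleftrightarrow>
     (\<forall>i\<in>charts M. \<forall>a b. smooth_on (\<lambda>x. T i x a b) (cran M i)) \<and>
     (\<forall>i\<in>charts M. \<forall>j\<in>charts M. \<forall>x\<in>overlap M i j. \<forall>a d.
        (\<Sum>b\<in>UNIV. T i x a b * jac M i j x b d) =
          (\<Sum>c\<in>UNIV. jac M i j x a c * T j (transition M i j x) c d))"

definition affine_connection :: "('i, 'a, 'n::finite) atlas \<Rightarrow> ('i \<Rightarrow> 'n christoffel) \<Rightarrow> bool" where
  "affine_connection M D \<longleftrightarrow>
     (\<forall>i\<in>charts M. \<forall>a b c. smooth_on (\<lambda>x. D i x a b c) (cran M i)) \<and>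
     (\<forall>i\<in>charts M. \<forall>j\<in>charts M. \<forall>x\<in>overlap M i j. \<forall>a b d.
        (\<Sum>c\<in>UNIV. D i x a b c * jac M i j x c d) =
          partial a (\<lambda>z. jac M i j z b d) x +
          (\<Sum>e\<in>UNIV. \<Sum>f\<in>UNIV. jac M i j x a e * jac M i j x b f * D j (transition M i j x) e f d))"

definition torsion_free :: "('i, 'a, 'n::finite) atlas \<Rightarrow> ('i \<Rightarrow> 'n christoffel) \<Rightarrow> bool" where
  "torsion_free M D \<longleftrightarrow> (\<forall>i\<in>charts M. \<forall>x\<in>cran M i. \<forall>a b c. D i x a b c = D i x b a c)"

definition affine_surface :: "('i, 'a, 2) atlas \<Rightarrow> ('i \<Rightarrow> 2 christoffel) \<Rightarrow> bool" where
  "affine_surface M D \<longleftrightarrow> smooth_manifold M \<and> affine_connection M D \<and> torsion_free M D"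

section \<open>Tensor calculus in one chart\<close>

text \<open>A covariant tensor of any order is a function of the list of its indices;
  the new index of the covariant derivative comes first.\<close>

definition cov_deriv ::
  "'n::finite christoffel \<Rightarrow> (real^'n \<Rightarrow> 'n list \<Rightarrow> real) \<Rightarrow> real^'n \<Rightarrow> 'n list \<Rightarrow> real" where
  "cov_deriv \<Gamma> S x ks = (case ks of [] \<Rightarrow> 0 | p # as \<Rightarrow>
     partial p (\<lambda>z. S z as) x -
     (\<Sum>m<length as. \<Sum>e\<in>UNIV. \<Gamma> x p (as ! m) e * S x (as[m := e])))"

definition differential :: "(real^'n::finite \<Rightarrow> real) \<Rightarrow> real^'n \<Rightarrow> 'n list \<Rightarrow> real" where
  "differential F x as = partial (hd as) F x"

definition hessian :: "'n::finite christoffel \<Rightarrow> (real^'n \<Rightarrow> real) \<Rightarrow> real^'n \<Rightarrow> 'n \<Rightarrow> 'n \<Rightarrow> real" where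
  "hessian \<Gamma> F x a b = cov_deriv \<Gamma> (differential F) x [a, b]"

text \<open>\<open>cov_deriv_11 \<Gamma> T x a b c\<close> is the \<open>\<partial>\<^sub>c\<close>-component of \<open>(D\<^bsub>\<partial>a\<^esub> T) \<partial>\<^sub>b\<close>.\<close>

definition cov_deriv_11 ::
  "'n::finite christoffel \<Rightarrow> (real^'n \<Rightarrow> 'n \<Rightarrow> 'n \<Rightarrow> real) \<Rightarrow> real^'n \<Rightarrow> 'n \<Rightarrow> 'n \<Rightarrow> 'n \<Rightarrow> real" where
  "cov_deriv_11 \<Gamma> T x a b c =
     partial a (\<lambda>z. T z b c) x + (\<Sum>e\<in>UNIV. \<Gamma> x a e c * T x b e - \<Gamma> x a b e * T x e c)"

text \<open>\<open>curvature \<Gamma> x a b c d\<close> is the \<open>\<partial>\<^sub>d\<close>-component of \<open>R(\<partial>\<^sub>a, \<partial>\<^sub>b) \<partial>\<^sub>c\<close>, where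
  \<open>R(X, Y) = [D\<^sub>X, D\<^sub>Y] - D\<^bsub>[X,Y]\<^esub>\<close>.\<close>

definition curvature :: "'n::finite christoffel \<Rightarrow> real^'n \<Rightarrow> 'n \<Rightarrow> 'n \<Rightarrow> 'n \<Rightarrow> 'n \<Rightarrow> real" where
  "curvature \<Gamma> x a b c d =
     partial a (\<lambda>z. \<Gamma> z b c d) x - partial b (\<lambda>z. \<Gamma> z a c d) x +
     (\<Sum>e\<in>UNIV. \<Gamma> x b c e * \<Gamma> x a e d - \<Gamma> x a c e * \<Gamma> x b e d)"

text \<open>\<open>\<rho>(X, Y) = tr {Z \<mapsto> R(Z, X) Y}\<close>.\<close>

definition ricci :: "'n::finite christoffel \<Rightarrow> real^'n \<Rightarrow> 'n \<Rightarrow> 'n \<Rightarrow> real" where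
  "ricci \<Gamma> x b c = (\<Sum>a\<in>UNIV. curvature \<Gamma> x a b c a)"

definition ricci_sym :: "'n::finite christoffel \<Rightarrow> real^'n \<Rightarrow> 'n \<Rightarrow> 'n \<Rightarrow> real" where
  "ricci_sym \<Gamma> x a b = (ricci \<Gamma> x a b + ricci \<Gamma> x b a) / 2"

section \<open>Pseudo-Riemannian geometry in one chart\<close>

type_synonym 'n metric = "real^'n \<Rightarrow> 'n \<Rightarrow> 'n \<Rightarrow> real"

definition metric_inv :: "'n::finite metric \<Rightarrow> 'n metric" where
  "metric_inv G x a b = matrix_inv (\<chi> c d. G x c d) $ a $ b"

definition levi_civita :: "'n::finite metric \<Rightarrow> 'n christoffel" where
  "levi_civita G x a b c = (\<Sum>e\<in>UNIV. metric_inv G x c e *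
     (partial a (\<lambda>z. G z b e) x + partial b (\<lambda>z. G z a e) x - partial e (\<lambda>z. G z a b) x)) / 2"

definition metric_ricci :: "'n::finite metric \<Rightarrow> real^'n \<Rightarrow> 'n \<Rightarrow> 'n \<Rightarrow> real" where
  "metric_ricci G = ricci (levi_civita G)"

definition riemann :: "'n::finite metric \<Rightarrow> real^'n \<Rightarrow> 'n \<Rightarrow> 'n \<Rightarrow> 'n \<Rightarrow> 'n \<Rightarrow> real" where
  "riemann G x a b c d = (\<Sum>e\<in>UNIV. curvature (levi_civita G) x a b c e * G x e d)"

definition scalar_curvature :: "'n::finite metric \<Rightarrow> real^'n \<Rightarrow> real" where
  "scalar_curvature G x = (\<Sum>a\<in>UNIV. \<Sum>b\<in>UNIV. metric_inv G x a b * metric_ricci G x a b)"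

text \<open>The trace-free part of \<open>riemann\<close>; with the sign convention above
  \<open>\<rho>\<^sub>b\<^sub>c = \<Sum> g\<^sup>a\<^sup>d R\<^sub>a\<^sub>b\<^sub>c\<^sub>d\<close>.\<close>

definition weyl :: "'n::finite metric \<Rightarrow> real^'n \<Rightarrow> 'n \<Rightarrow> 'n \<Rightarrow> 'n \<Rightarrow> 'n \<Rightarrow> real" where
  "weyl G x a b c d = riemann G x a b c d -
     (G x a d * metric_ricci G x b c + G x b c * metric_ricci G x a d
      - G x a c * metric_ricci G x b d - G x b d * metric_ricci G x a c) / (real CARD('n) - 2) +
     scalar_curvature G x * (G x a d * G x b c - G x a c * G x b d)
       / ((real CARD('n) - 1) * (real CARD('n) - 2))"

definition weyl_tensor :: "'n::finite metric \<Rightarrow> real^'n \<Rightarrow> 'n list \<Rightarrow> real" where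
  "weyl_tensor G x as = weyl G x (as ! 0) (as ! 1) (as ! 2) (as ! 3)"

text \<open>\<open>\<nabla>\<^sup>k \<nabla>\<^sup>l W\<^sub>k\<^sub>i\<^sub>j\<^sub>l + 1/2 \<rho>\<^sup>k\<^sup>l W\<^sub>k\<^sub>i\<^sub>j\<^sub>l\<close>, with \<open>p\<close> and \<open>q\<close> the lowered versions of the upper
  \<open>k\<close> and \<open>l\<close>.\<close>

definition bach :: "'n::finite metric \<Rightarrow> real^'n \<Rightarrow> 'n \<Rightarrow> 'n \<Rightarrow> real" where
  "bach G x i j = (\<Sum>k\<in>UNIV. \<Sum>l\<in>UNIV. \<Sum>p\<in>UNIV. \<Sum>q\<in>UNIV.
     metric_inv G x k p * metric_inv G x l q *
       (cov_deriv (levi_civita G) (cov_deriv (levi_civita G) (weyl_tensor G)) x [p, q, k, i, j, l]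
        + metric_ricci G x p q * weyl G x k i j l / 2))"

definition gradient :: "'n::finite metric \<Rightarrow> (real^'n \<Rightarrow> real) \<Rightarrow> real^'n \<Rightarrow> 'n \<Rightarrow> real" where
  "gradient G F x a = (\<Sum>b\<in>UNIV. metric_inv G x a b * partial b F x)"

definition gradient_sqnorm :: "'n::finite metric \<Rightarrow> (real^'n \<Rightarrow> real) \<Rightarrow> real^'n \<Rightarrow> real" where
  "gradient_sqnorm G F x = (\<Sum>a\<in>UNIV. \<Sum>b\<in>UNIV. G x a b * gradient G F x a * gradient G F x b)"

section \<open>Gradient Ricci solitons and Bach-flatness\<close>

definition bach_flat :: "('i, 'a, 'n::finite) atlas \<Rightarrow> ('i, 'n) field2 \<Rightarrow> bool" where
  "bach_flat M g \<longleftrightarrow> (\<forall>i\<in>charts M. \<forall>x\<in>cran M i. \<forall>a b. bach (g i) x a b = 0)"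

definition ricci_soliton_eq ::
  "('i, 'a, 'n::finite) atlas \<Rightarrow> ('i, 'n) field2 \<Rightarrow> ('a \<Rightarrow> real) \<Rightarrow> real \<Rightarrow> bool" where
  "ricci_soliton_eq M g f lam \<longleftrightarrow> (\<forall>i\<in>charts M. \<forall>x\<in>cran M i. \<forall>a b.
     hessian (levi_civita (g i)) (local_rep M f i) x a b + metric_ricci (g i) x a b
       = lam * g i x a b)"

definition gradient_ricci_soliton ::
  "('i, 'a, 'n::finite) atlas \<Rightarrow> ('i, 'n) field2 \<Rightarrow> ('a \<Rightarrow> real) \<Rightarrow> bool" where
  "gradient_ricci_soliton M g f \<longleftrightarrow> (\<exists>lam. ricci_soliton_eq M g f lam)"

definition steady ::
  "('i, 'a, 'n::finite) atlas \<Rightarrow> ('i, 'n) field2 \<Rightarrow> ('a \<Rightarrow> real) \<Rightarrow> bool" where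
  "steady M g f \<longleftrightarrow>
     gradient_ricci_soliton M g f \<and> (\<forall>lam. ricci_soliton_eq M g f lam \<longrightarrow> lam = 0)"

definition null_gradient ::
  "('i, 'a, 'n::finite) atlas \<Rightarrow> ('i, 'n) field2 \<Rightarrow> ('a \<Rightarrow> real) \<Rightarrow> bool" where
  "null_gradient M g f \<longleftrightarrow>
     (\<forall>i\<in>charts M. \<forall>x\<in>cran M i. gradient_sqnorm (g i) (local_rep M f i) x = 0)"

definition gradient_zero_at ::
  "('i, 'a, 'n::finite) atlas \<Rightarrow> ('i, 'n) field2 \<Rightarrow> ('a \<Rightarrow> real) \<Rightarrow> 'a \<Rightarrow> bool" where
  "gradient_zero_at M g f q \<longleftrightarrow>
     (\<forall>i\<in>charts M. q \<in> cdom M i \<longrightarrow> (\<forall>a. gradient (g i) (local_rep M f i) (cmap M i q) a = 0))"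

text \<open>Here \<open>\<nabla>f \<noteq> 0\<close> is read as an inequality of vector fields: \<open>f\<close> may have critical points.\<close>

definition isotropic ::
  "('i, 'a, 'n::finite) atlas \<Rightarrow> ('i, 'n) field2 \<Rightarrow> ('a \<Rightarrow> real) \<Rightarrow> bool" where
  "isotropic M g f \<longleftrightarrow> null_gradient M g f \<and> (\<exists>q\<in>points M. \<not> gradient_zero_at M g f q)"

section \<open>The cotangent bundle\<close>

text \<open>A covector at \<open>p\<close> is the family of its components in the charts around \<open>p\<close>
  (set to 0 for the other indices, so that equal covectors are equal as functions).\<close>

definition covectors :: "('i, 'a, 'n::finite) atlas \<Rightarrow> 'a \<Rightarrow> ('i \<Rightarrow> real^'n) set" where
  "covectors M p = {\<omega>.
     (\<forall>i. i \<notin> charts M \<or> p \<notin> cdom M i \<longrightarrow> \<omega> i = 0) \<and>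
     (\<forall>i\<in>charts M. \<forall>j\<in>charts M. p \<in> cdom M i \<and> p \<in> cdom M j \<longrightarrow>
        (\<forall>a. \<omega> i $ a = (\<Sum>c\<in>UNIV. jac M i j (cmap M i p) a c * \<omega> j $ c)))}"

text \<open>The index \<open>Inl a\<close> stands for the coordinate \<open>x\<^sup>a\<close> and \<open>Inr a\<close> for the fibre
  coordinate \<open>x\<^bsub>a'\<^esub>\<close>; the bundle projection is \<^term>\<open>fst\<close>.\<close>

definition cotangent_bundle ::
  "('i, 'a, 'n::finite) atlas \<Rightarrow> ('i, 'a \<times> ('i \<Rightarrow> real^'n), 'n + 'n) atlas" where
  "cotangent_bundle M = \<lparr>
     charts = charts M,
     cdom = (\<lambda>i. {(p, \<omega>). p \<in> cdom M i \<and> \<omega> \<in> covectors M p}),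
     cmap = (\<lambda>i (p, \<omega>). \<chi> s. case s of Inl a \<Rightarrow> cmap M i p $ a | Inr a \<Rightarrow> \<omega> i $ a)\<rparr>"

definition base_part :: "real^('n + 'n) \<Rightarrow> real^'n::finite" where
  "base_part y = (\<chi> a. y $ Inl a)"

definition fibre_part :: "real^('n + 'n) \<Rightarrow> real^'n::finite" where
  "fibre_part y = (\<chi> a. y $ Inr a)"

text \<open>The metric \<open>g\<^bsub>D,\<Phi>,T\<^esub> = \<iota>T \<circ> \<iota>T + g\<^sub>D + \<pi>\<^sup>*\<Phi>\<close> in induced coordinates.\<close>

definition cotangent_metric ::
  "('i \<Rightarrow> 'n::finite christoffel) \<Rightarrow> ('i, 'n) field2 \<Rightarrow> ('i, 'n) field2 \<Rightarrow> ('i, 'n + 'n) field2" where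
  "cotangent_metric D \<Phi> T i y s t =
     (let x = base_part y; \<xi> = fibre_part y in
      case (s, t) of
        (Inl a, Inl b) \<Rightarrow>
          (\<Sum>r\<in>UNIV. \<Sum>u\<in>UNIV. \<xi> $ r * \<xi> $ u * (T i x a r * T i x b u + T i x b r * T i x a u)) / 2
          - 2 * (\<Sum>k\<in>UNIV. \<xi> $ k * D i x a b k) + \<Phi> i x a b
      | (Inl a, Inr b) \<Rightarrow> (if a = b then 1 else 0)
      | (Inr a, Inl b) \<Rightarrow> (if a = b then 1 else 0)
      | (Inr a, Inr b) \<Rightarrow> 0)"

section \<open>Conditions on the endomorphism field\<close>

definition parallel ::
  "('i, 'a, 'n::finite) atlas \<Rightarrow> ('i \<Rightarrow> 'n christoffel) \<Rightarrow> ('i, 'n) field2 \<Rightarrow> bool" where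
  "parallel M D T \<longleftrightarrow>
     (\<forall>i\<in>charts M. \<forall>x\<in>cran M i. \<forall>a b c. cov_deriv_11 (D i) (T i) x a b c = 0)"

definition nilpotent :: "('i, 'a, 'n::finite) atlas \<Rightarrow> ('i, 'n) field2 \<Rightarrow> bool" where
  "nilpotent M T \<longleftrightarrow>
     (\<forall>i\<in>charts M. \<forall>x\<in>cran M i. \<forall>a c. (\<Sum>b\<in>UNIV. T i x a b * T i x b c) = 0)"

text \<open>On a connected manifold this says that \<open>T\<close> is not the zero field; connectedness
  is not assumed, so the field is required to be nonzero on each component.\<close>

definition nonzero_field :: "('i, 'a, 'n::finite) atlas \<Rightarrow> ('i, 'n) field2 \<Rightarrow> bool" where
  "nonzero_field M T \<longleftrightarrow> (\<forall>C\<in>connected_components_of (manifold_topology M).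
     \<exists>p\<in>C. \<exists>i\<in>charts M. p \<in> cdom M i \<and> (\<exists>a b. T i (cmap M i p) a b \<noteq> 0))"

definition dh_ker_zero ::
  "('i, 'a, 'n::finite) atlas \<Rightarrow> ('i, 'n) field2 \<Rightarrow> ('a \<Rightarrow> real) \<Rightarrow> bool" where
  "dh_ker_zero M T h \<longleftrightarrow> (\<forall>i\<in>charts M. \<forall>x\<in>cran M i. \<forall>v :: real^'n.
     (\<forall>b. (\<Sum>a\<in>UNIV. v $ a * T i x a b) = 0) \<longrightarrow>
     (\<Sum>a\<in>UNIV. v $ a * partial a (local_rep M h i) x) = 0)"

text \<open>\<open>\<Phi>(TX, TY)\<close>.\<close>

definition hat :: "('i, 'n::finite) field2 \<Rightarrow> ('i, 'n) field2 \<Rightarrow> ('i, 'n) field2" where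
  "hat T \<Phi> i x a b = (\<Sum>c\<in>UNIV. \<Sum>d\<in>UNIV. T i x a c * T i x b d * \<Phi> i x c d)"

end

theory Submission
  imports Defs
begin

text \<open>
  The field \<open>T\<close> is parallel and nonzero, so it vanishes nowhere. Near a point choose a constant vector \<open>v\<close> with
  \<open>T v \<noteq> 0\<close>; then \<open>E\<^sub>1 = v\<close>, \<open>E\<^sub>2 = T v\<close> is a frame, and \<open>D E\<^sub>1 = a E\<^sub>1 + b E\<^sub>2\<close>, \<open>D E\<^sub>2 = a E\<^sub>2\<close>
  because \<open>T\<close> is parallel. The vertical lifts of the dual forms together with suitably corrected
  horizontal lifts of \<open>E\<^sub>1\<close>, \<open>E\<^sub>2\<close> form a frame of the cotangent bundle in which the metric is constant.
  No adapted coordinates are needed: Levi-Civita connection, curvature and Bach tensor are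
  computed in this moving frame, where everything is polynomial in the fibre functions
  \<open>u\<^sub>j = \<iota>E\<^sub>j\<close>. The divergence of the Weyl tensor turns out to have a single independent component,
  which is constant along the fibres, and the Bach tensor vanishes for every \<open>\<Phi>\<close>. The Ricci tensor only
  has a component on \<open>(X\<^sub>1, X\<^sub>1)\<close>, so a mixed component of the soliton equation gives \<open>\<lambda> = 0\<close>, and its
  \<open>(X\<^sub>1, X\<^sub>1)\<close> component is affine in \<open>u\<^sub>2\<close>: the linear term is \<open>dh(E\<^sub>2)\<close>, and the rest is
  the equation for \<open>\<Phi>(T E\<^sub>1, T E\<^sub>1)\<close>.
\<close>

section \<open>Smooth functions\<close>

text \<open>The obstacle is the Bach tensor, which contains derivatives of the metric up to fourth
  order. In a frame with constant metric coefficients Koszul's formula keeps only its bracket terms,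
  and the brackets can be read off from the action of the frame on the base coordinates and on
  \<open>u 1\<close>, \<open>u 2\<close>. Straightening T by coordinates would need an integration
  argument; the frame only needs a constant v with det(v, T v) nonzero, and a coordinate axis will
  do. The price is that E_1 and E_2 need not commute, so their structure functions are carried
  along. The link between h and T is one connection coefficient. The form iota T takes the value u_2
  on E_1 and 0 on E_2, so the square of u_2 enters the metric only at (E_1, E_1). Its correction
  term produces the summand -u_2 in a connection coefficient, and this is what makes the soliton
  equation affine in u_2 with slope dh(E_2). All identities are pointwise and can be checked near
  each point. Only two facts are global: T vanishes nowhere, which needs connected components, and
  lambda is one constant for all charts.\<close>

lemma frechet_derivative_cong_open:
  assumes "open U" "x \<in> U" "\<And>z. z \<in> U \<Longrightarrow> f z = g z"
  shows "frechet_derivative f (at x) = frechet_derivative g (at x)"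
proof -
  have "(f has_derivative D) (at x) \<longleftrightarrow> (g has_derivative D) (at x)" for D
    using has_derivative_transform_within_open[of f D x UNIV U g]
      has_derivative_transform_within_open[of g D x UNIV U f] assms by auto
  then show ?thesis by (simp add: frechet_derivative_def)
qed

lemma differentiable_cong_open:
  assumes "open U" "x \<in> U" "\<And>z. z \<in> U \<Longrightarrow> f z = g z" "f differentiable (at x)"
  shows "g differentiable (at x)"
  using assms has_derivative_transform_within_open[of f _ x UNIV U g]
  unfolding differentiable_def by blast

lemma partial_cong_open:
  assumes "open U" "x \<in> U" "\<And>z. z \<in> U \<Longrightarrow> f z = g z"
  shows "partial a f x = partial a g x"
  unfolding partial_def using frechet_derivative_cong_open[OF assms] by simp

lemma Ck_on_cong:
  assumes "open U" "\<And>z. z \<in> U \<Longrightarrow> f z = g z" "Ck_on k f U"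
  shows "Ck_on k g U"
  using assms(2,3)
proof (induction k arbitrary: f g)
  case 0
  then show ?case by (simp cong: continuous_on_cong)
next
  case (Suc k)
  have "Ck_on k (\<lambda>x. frechet_derivative g (at x) v) U" for v
    by (rule Suc.IH[of "\<lambda>x. frechet_derivative f (at x) v"])
      (use Suc.prems frechet_derivative_cong_open[OF assms(1)] in \<open>auto, metis\<close>)
  then show ?case
    using Suc.prems differentiable_cong_open[OF assms(1), of _ f g] by auto
qed

lemma Ck_on_subset:
  "Ck_on k f S \<Longrightarrow> U \<subseteq> S \<Longrightarrow> Ck_on k f U"
  by (induction k arbitrary: f) (auto intro: continuous_on_subset)

lemma Ck_on_Suc_imp: "Ck_on (Suc k) f S \<Longrightarrow> Ck_on k f S"
proof (induction k arbitrary: f)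
  case 0
  then show ?case
    by (auto intro!: continuous_at_imp_continuous_on differentiable_imp_continuous_within)
qed auto

lemma Ck_on_const: "Ck_on k (\<lambda>x. c) U"
  by (induction k arbitrary: c) (simp_all add: frechet_derivative_const)

lemma Ck_on_add:
  assumes "open U" "Ck_on k f U" "Ck_on k g U"
  shows "Ck_on k (\<lambda>x. f x + g x) U"
  using assms(2,3)
proof (induction k arbitrary: f g)
  case (Suc k)
  have "Ck_on k (\<lambda>x. frechet_derivative (\<lambda>x. f x + g x) (at x) v) U" for v
    proof (rule Ck_on_cong[OF assms(1) _ Suc.IH])
    fix z assume "z \<in> U"
    then have "((\<lambda>x. f x + g x) has_derivative
        (\<lambda>h. frechet_derivative f (at z) h + frechet_derivative g (at z) h)) (at z)"
      using Suc.prems by (intro has_derivative_add) (auto simp: frechet_derivative_works[symmetric])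
    then show "frechet_derivative f (at z) v + frechet_derivative g (at z) v =
        frechet_derivative (\<lambda>x. f x + g x) (at z) v"
      using frechet_derivative_at by metis
  qed (use Suc.prems in auto)
  with Suc.prems show ?case by auto
qed (simp add: continuous_on_add)

lemma Ck_on_mult:
  fixes f g :: "'v::real_normed_vector \<Rightarrow> real"
  assumes "open U" "Ck_on k f U" "Ck_on k g U"
  shows "Ck_on k (\<lambda>x. f x * g x) U"
  using assms(2,3)
proof (induction k arbitrary: f g)
  case (Suc k)
  have "Ck_on k (\<lambda>x. frechet_derivative (\<lambda>x. f x * g x) (at x) v) U" for v
  proof (rule Ck_on_cong[OF assms(1) _ Ck_on_add[OF assms(1) Suc.IH Suc.IH]])
    fix z assume "z \<in> U"
    then have "((\<lambda>x. f x * g x) has_derivative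
        (\<lambda>h. f z * frechet_derivative g (at z) h + frechet_derivative f (at z) h * g z)) (at z)"
      using Suc.prems by (intro has_derivative_mult) (auto simp: frechet_derivative_works[symmetric])
    then show "f z * frechet_derivative g (at z) v + frechet_derivative f (at z) v * g z =
        frechet_derivative (\<lambda>x. f x * g x) (at z) v"
      using frechet_derivative_at by metis
  qed (use Suc.prems Ck_on_Suc_imp[of k] in auto)
  with Suc.prems show ?case by auto
qed (simp add: continuous_on_mult)

text \<open>The derivative of \<open>1/f\<close> is \<open>-(1/f) * f' * (1/f)\<close>, which
  contains no new reciprocal. The induction therefore runs for one fixed \<open>f\<close>.\<close>

lemma Ck_on_inverse:
  fixes f :: "'v::real_normed_vector \<Rightarrow> real"
  assumes "open U" "Ck_on k f U" "\<And>z. z \<in> U \<Longrightarrow> f z \<noteq> 0"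
  shows "Ck_on k (\<lambda>x. inverse (f x)) U"
  using assms(2)
proof (induction k)
  case (Suc k)
  then have inv: "Ck_on k (\<lambda>x. inverse (f x)) U"
    using Ck_on_Suc_imp[of k f U] by simp
  have "Ck_on k (\<lambda>x. frechet_derivative (\<lambda>x. inverse (f x)) (at x) v) U" for v
  proof (rule Ck_on_cong[OF assms(1) _
        Ck_on_mult[OF assms(1) Ck_on_const[of k "-1"]
          Ck_on_mult[OF assms(1) inv Ck_on_mult[OF assms(1) _ inv]]]])
    fix z assume z: "z \<in> U"
    then have "((\<lambda>x. inverse (f x)) has_derivative
        (\<lambda>h. - (inverse (f z) * frechet_derivative f (at z) h * inverse (f z)))) (at z)"
      using Suc.prems assms(3)
      by (intro Deriv.has_derivative_inverse) (auto simp: frechet_derivative_works[symmetric])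
    then show "- 1 * (inverse (f z) * (frechet_derivative f (at z) v * inverse (f z))) =
        frechet_derivative (\<lambda>x. inverse (f x)) (at z) v"
      using frechet_derivative_at by (metis mult.assoc mult_minus1)
  qed (use Suc.prems in auto)
  with Suc.prems assms(3) show ?case by (auto intro!: differentiable_inverse)
qed (use assms in \<open>simp add: continuous_on_inverse\<close>)

text \<open>For linear \<open>L\<close>, the derivative of \<open>f o L\<close> along
  \<open>v\<close> is the derivative of \<open>f\<close> along \<open>L v\<close>, again composed
  with \<open>L\<close>. This closes the induction without a chain rule of higher order.\<close>

lemma Ck_on_linear_compose:
  assumes L: "bounded_linear L" and "open S" and f: "Ck_on k f S"
  shows "Ck_on k (\<lambda>y. f (L y)) (L -` S)"
  using f
proof (induction k arbitrary: f)
  case 0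
  have "continuous_on (L -` S) L" by (rule linear_continuous_on[OF L])
  then show ?case using 0 by (auto intro: continuous_on_compose2)
next
  case (Suc k)
  have op: "open (L -` S)"
    using assms by (intro open_vimage) (auto intro: linear_continuous_on)
  have D: "((\<lambda>y. f (L y)) has_derivative (\<lambda>h. frechet_derivative f (at (L y)) (L h))) (at y)"
    if "y \<in> L -` S" for y
    using Suc.prems that
    by (intro has_derivative_compose[OF bounded_linear_imp_has_derivative[OF L]])
      (auto simp: frechet_derivative_works[symmetric])
  have eq: "frechet_derivative f (at (L y)) (L v) = frechet_derivative (\<lambda>y. f (L y)) (at y) v"
    if "y \<in> L -` S" for y v
    using D[OF that] frechet_derivative_at by metis
  have "Ck_on k (\<lambda>y. frechet_derivative (\<lambda>y. f (L y)) (at y) v) (L -` S)" for v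
    by (rule Ck_on_cong[OF op _ Suc.IH[of "\<lambda>x. frechet_derivative f (at x) (L v)"]])
      (use Suc.prems eq in auto)
  with D show ?case by (auto simp: differentiable_def)
qed

lemma Ck_on_linear: "bounded_linear L \<Longrightarrow> Ck_on k L U"
proof (cases k)
  case 0
  then show ?thesis if "bounded_linear L" using that by (simp add: linear_continuous_on)
next
  case (Suc k)
  assume L: "bounded_linear L"
  have "frechet_derivative L (at x) = L" for x
    using frechet_derivative_at[OF bounded_linear_imp_has_derivative[OF L]] by metis
  then show ?thesis using Suc L
    by (simp add: Ck_on_const bounded_linear_imp_differentiable)
qed

lemma smooth_on_cong:
  "open U \<Longrightarrow> (\<And>z. z \<in> U \<Longrightarrow> f z = g z) \<Longrightarrow> smooth_on f U \<Longrightarrow> smooth_on g U"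
  unfolding smooth_on_def using Ck_on_cong by blast

lemma smooth_on_subset: "smooth_on f S \<Longrightarrow> U \<subseteq> S \<Longrightarrow> smooth_on f U"
  unfolding smooth_on_def using Ck_on_subset by blast

lemma smooth_on_const: "smooth_on (\<lambda>x. c) U"
  unfolding smooth_on_def using Ck_on_const by blast

lemma smooth_on_add:
  "open U \<Longrightarrow> smooth_on f U \<Longrightarrow> smooth_on g U \<Longrightarrow> smooth_on (\<lambda>x. f x + g x) U"
  unfolding smooth_on_def using Ck_on_add by blast

lemma smooth_on_mult:
  fixes f g :: "'v::real_normed_vector \<Rightarrow> real"
  shows "open U \<Longrightarrow> smooth_on f U \<Longrightarrow> smooth_on g U \<Longrightarrow> smooth_on (\<lambda>x. f x * g x) U"
  unfolding smooth_on_def using Ck_on_mult by blast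

lemma smooth_on_minus:
  fixes f :: "'v::real_normed_vector \<Rightarrow> real"
  shows "open U \<Longrightarrow> smooth_on f U \<Longrightarrow> smooth_on (\<lambda>x. - f x) U"
  using smooth_on_mult[OF _ smooth_on_const[of "-1"], of U f] by simp

lemma smooth_on_diff:
  fixes f g :: "'v::real_normed_vector \<Rightarrow> real"
  shows "open U \<Longrightarrow> smooth_on f U \<Longrightarrow> smooth_on g U \<Longrightarrow> smooth_on (\<lambda>x. f x - g x) U"
  using smooth_on_add[OF _ _ smooth_on_minus, of U f g] by simp

lemma smooth_on_sum:
  assumes "open U" "\<And>i. i \<in> I \<Longrightarrow> smooth_on (f i) U"
  shows "smooth_on (\<lambda>x. \<Sum>i\<in>I. f i x) U"
proof (cases "finite I")
  case True
  then show ?thesis using assms(2)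
    by (induction I rule: finite_induct) (auto intro: smooth_on_const smooth_on_add[OF assms(1)])
qed (simp add: smooth_on_const)

lemma smooth_on_divide:
  fixes f g :: "'v::real_normed_vector \<Rightarrow> real"
  assumes "open U" "smooth_on f U" "smooth_on g U" "\<And>z. z \<in> U \<Longrightarrow> g z \<noteq> 0"
  shows "smooth_on (\<lambda>x. f x / g x) U"
  using assms unfolding divide_inverse smooth_on_def
  by (simp add: Ck_on_mult Ck_on_inverse)

lemma smooth_on_divide_const:
  fixes f :: "'v::real_normed_vector \<Rightarrow> real"
  shows "open U \<Longrightarrow> smooth_on f U \<Longrightarrow> smooth_on (\<lambda>x. f x / c) U"
  unfolding divide_inverse by (intro smooth_on_mult smooth_on_const)

lemma smooth_on_linear: "bounded_linear L \<Longrightarrow> smooth_on L U"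
  unfolding smooth_on_def using Ck_on_linear by blast

lemma smooth_on_linear_compose:
  "bounded_linear L \<Longrightarrow> open S \<Longrightarrow> smooth_on f S \<Longrightarrow> smooth_on (\<lambda>y. f (L y)) (L -` S)"
  unfolding smooth_on_def using Ck_on_linear_compose by blast

lemma smooth_on_partial: "smooth_on f U \<Longrightarrow> smooth_on (partial a f) U"
  unfolding smooth_on_def partial_def using Ck_on.simps(2) by blast

lemma smooth_on_differentiable: "smooth_on f U \<Longrightarrow> x \<in> U \<Longrightarrow> f differentiable (at x)"
  unfolding smooth_on_def using Ck_on.simps(2) by blast

lemma smooth_on_continuous: "smooth_on f U \<Longrightarrow> continuous_on U f"
  unfolding smooth_on_def using Ck_on.simps(1) by blast

section \<open>Partial derivatives\<close>

lemma partial_eqI: "(f has_derivative D) (at x) \<Longrightarrow> partial a f x = D (axis a 1)"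
  unfolding partial_def using frechet_derivative_at by metis

lemma partial_const: "partial a (\<lambda>x. c) x = 0"
  by (simp add: partial_def)

lemma partial_coordinate: "partial a (\<lambda>x::real^'n::finite. x $ b) x = (if a = b then 1 else 0)"
proof -
  have "((\<lambda>x. x $ b) has_derivative (\<lambda>x::real^'n. x $ b)) (at x)"
    by (rule bounded_linear_imp_has_derivative) (rule bounded_linear_vec_nth)
  from partial_eqI[OF this, of a] show ?thesis by (simp add: axis_def)
qed

lemma partial_add:
  assumes "f differentiable (at x)" "g differentiable (at x)"
  shows "partial a (\<lambda>x. f x + g x) x = partial a f x + partial a g x"
  using partial_eqI[OF has_derivative_add, of f _ x g _ a] assms
  by (simp add: partial_def frechet_derivative_works)

lemma partial_mult:
  assumes "f differentiable (at x)" "g differentiable (at x)"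
  shows "partial a (\<lambda>x. f x * g x) x = partial a f x * g x + f x * partial a g x"
  using partial_eqI[OF has_derivative_mult, of f _ x g _ a] assms
  by (simp add: partial_def frechet_derivative_works)

lemma partial_sum:
  assumes "finite I" "\<And>i. i \<in> I \<Longrightarrow> f i differentiable (at x)"
  shows "partial a (\<lambda>x. \<Sum>i\<in>I. f i x) x = (\<Sum>i\<in>I. partial a (f i) x)"
  using assms
  by (induction I rule: finite_induct) (auto simp: partial_const partial_add differentiable_sum)

lemma has_derivative_partial:
  fixes f :: "real^'n::finite \<Rightarrow> real"
  assumes "f differentiable (at x)"
  shows "(f has_derivative (\<lambda>h. \<Sum>c\<in>UNIV. h $ c * partial c f x)) (at x)"
proof -
  have D: "(f has_derivative frechet_derivative f (at x)) (at x)"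
    using assms frechet_derivative_works by blast
  interpret bounded_linear "frechet_derivative f (at x)"
    using D by (rule has_derivative_bounded_linear)
  have "frechet_derivative f (at x) h = (\<Sum>c\<in>UNIV. h $ c * partial c f x)" for h
  proof -
    have "frechet_derivative f (at x) h =
        frechet_derivative f (at x) (\<Sum>c\<in>UNIV. (h $ c) *\<^sub>R axis c 1)"
      using basis_expansion[of h] by (simp add: scalar_mult_eq_scaleR)
    then show ?thesis by (simp add: sum scale partial_def)
  qed
  then have "frechet_derivative f (at x) = (\<lambda>h. \<Sum>c\<in>UNIV. h $ c * partial c f x)" by auto
  then show ?thesis using D by simp
qed

lemma has_real_derivative_segment:
  fixes f :: "real^'n::finite \<Rightarrow> real"
  assumes "f differentiable (at (x + t *\<^sub>R v))"
  shows "((\<lambda>t. f (x + t *\<^sub>R v)) has_real_derivative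
    (\<Sum>c\<in>UNIV. v $ c * partial c f (x + t *\<^sub>R v))) (at t)"
proof -
  have "((\<lambda>t. x + t *\<^sub>R v) has_derivative (\<lambda>h. h *\<^sub>R v)) (at t)"
    by (auto intro!: derivative_eq_intros)
  from has_derivative_compose[OF this has_derivative_partial[OF assms]]
  have "((\<lambda>t. f (x + t *\<^sub>R v)) has_derivative
      (\<lambda>h. \<Sum>c\<in>UNIV. (h *\<^sub>R v) $ c * partial c f (x + t *\<^sub>R v))) (at t)" .
  moreover have "(\<lambda>h. \<Sum>c\<in>UNIV. (h *\<^sub>R v) $ c * partial c f (x + t *\<^sub>R v)) =
      (*) (\<Sum>c\<in>UNIV. v $ c * partial c f (x + t *\<^sub>R v))"
    by (intro ext) (simp add: sum_distrib_left sum_distrib_right mult_ac)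
  ultimately show ?thesis by (simp add: has_field_derivative_def)
qed

text \<open>Schwarz's theorem: by the mean value theorem the mixed second difference of step \<open>t\<close> is
  \<open>t\<^sup>2\<close> times a mixed derivative at an intermediate point, for either order.\<close>

lemma second_difference:
  fixes f :: "real^'n::finite \<Rightarrow> real"
  assumes "0 < t" and "ball x r \<subseteq> U" and "2 * t < r" and sm: "smooth_on f U"
  shows "\<exists>z. dist x z \<le> 2 * t \<and>
    f (x + t *\<^sub>R axis a 1 + t *\<^sub>R axis b 1) - f (x + t *\<^sub>R axis a 1) - f (x + t *\<^sub>R axis b 1) + f x
      = t\<^sup>2 * partial b (partial a f) z"
proof -
  have in_U: "x + s *\<^sub>R axis a 1 + s' *\<^sub>R axis b 1 \<in> U"
    and dist: "dist x (x + s *\<^sub>R axis a 1 + s' *\<^sub>R axis b 1) \<le> 2 * t"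
    if "0 \<le> s" "s \<le> t" "0 \<le> s'" "s' \<le> t" for s s'
  proof -
    have "norm (s *\<^sub>R axis a 1 + s' *\<^sub>R axis b (1::real) :: real^'n) \<le> s + s'"
      using that by (intro norm_triangle_le) (simp add: norm_axis_1)
    then show "dist x (x + s *\<^sub>R axis a 1 + s' *\<^sub>R axis b 1) \<le> 2 * t"
      using that norm_minus_cancel[of "s *\<^sub>R axis a 1 + s' *\<^sub>R axis b (1::real)"]
      by (simp add: dist_norm algebra_simps)
    then show "x + s *\<^sub>R axis a 1 + s' *\<^sub>R axis b 1 \<in> U" using assms(2,3) by auto
  qed
  have seg: "((\<lambda>t. F (y + t *\<^sub>R axis c 1)) has_real_derivative partial c F (y + s *\<^sub>R axis c 1)) (at s)"
    if "smooth_on F U" "y + s *\<^sub>R axis c 1 \<in> U" for F y s and c :: 'n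
    using has_real_derivative_segment[OF smooth_on_differentiable[OF that]]
    by (simp add: axis_def if_distrib[of "\<lambda>x. x * _"] cong: if_cong)
  have in_U': "x + t *\<^sub>R axis b 1 + s *\<^sub>R axis a 1 \<in> U" if "0 \<le> s" "s \<le> t" for s
    using in_U[of s t] that \<open>0 < t\<close> by (simp add: add_ac)
  have "\<exists>s. 0 < s \<and> s < t \<and>
      (f (x + t *\<^sub>R axis b 1 + t *\<^sub>R axis a 1) - f (x + t *\<^sub>R axis a 1)) -
      (f (x + t *\<^sub>R axis b 1 + 0 *\<^sub>R axis a 1) - f (x + 0 *\<^sub>R axis a 1)) =
      (t - 0) * (partial a f (x + t *\<^sub>R axis b 1 + s *\<^sub>R axis a 1) - partial a f (x + s *\<^sub>R axis a 1))"
    by (rule MVT2[OF \<open>0 < t\<close>, where f = "\<lambda>s. f (x + t *\<^sub>R axis b 1 + s *\<^sub>R axis a 1) - f (x + s *\<^sub>R axis a 1)"])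
      (use in_U' in_U[of _ 0] \<open>0 < t\<close> in \<open>auto intro!: DERIV_diff seg sm\<close>)
  then obtain s where s: "0 < s" "s < t" and 1:
      "(f (x + t *\<^sub>R axis b 1 + t *\<^sub>R axis a 1) - f (x + t *\<^sub>R axis a 1)) -
      (f (x + t *\<^sub>R axis b 1) - f x) =
      t * (partial a f (x + t *\<^sub>R axis b 1 + s *\<^sub>R axis a 1) - partial a f (x + s *\<^sub>R axis a 1))"
    by auto
  have "\<exists>s'. 0 < s' \<and> s' < t \<and>
      partial a f (x + s *\<^sub>R axis a 1 + t *\<^sub>R axis b 1) - partial a f (x + s *\<^sub>R axis a 1 + 0 *\<^sub>R axis b 1) =
      (t - 0) * partial b (partial a f) (x + s *\<^sub>R axis a 1 + s' *\<^sub>R axis b 1)"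
    by (rule MVT2[OF \<open>0 < t\<close>, where f = "\<lambda>s'. partial a f (x + s *\<^sub>R axis a 1 + s' *\<^sub>R axis b 1)"])
      (use in_U[of s] s in \<open>auto intro!: seg smooth_on_partial sm\<close>)
  then obtain s' where s': "0 < s'" "s' < t" and 2:
      "partial a f (x + s *\<^sub>R axis a 1 + t *\<^sub>R axis b 1) - partial a f (x + s *\<^sub>R axis a 1) =
      t * partial b (partial a f) (x + s *\<^sub>R axis a 1 + s' *\<^sub>R axis b 1)"
    by auto
  have "f (x + t *\<^sub>R axis a 1 + t *\<^sub>R axis b 1) - f (x + t *\<^sub>R axis a 1) - f (x + t *\<^sub>R axis b 1) + f x
      = t\<^sup>2 * partial b (partial a f) (x + s *\<^sub>R axis a 1 + s' *\<^sub>R axis b 1)"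
    using 1 2 by (simp add: add_ac power2_eq_square)
  then show ?thesis using dist[of s s'] s s' by (intro exI conjI) auto
qed

lemma partial_commute:
  fixes f :: "real^'n::finite \<Rightarrow> real"
  assumes "open U" "x \<in> U" and sm: "smooth_on f U"
  shows "partial a (partial b f) x = partial b (partial a f) x"
proof -
  obtain r where r: "r > 0" "ball x r \<subseteq> U" using assms openE by blast
  \<comment> \<open>The factor \<open>1/4\<close> gives \<open>2 * t n \<le> r / 2\<close>, so both
    difference squares stay inside the ball while the step tends to 0.\<close>
  define t where "t n = r / 4 * inverse (real (Suc n))" for n
  have t: "0 < t n" "2 * t n < r" for n
    using r by (auto simp: t_def field_simps intro: add_pos_nonneg)
  have t0: "(\<lambda>n. 2 * t n) \<longlonglongrightarrow> 0"
    unfolding t_def by (intro tendsto_mult_right_zero LIMSEQ_inverse_real_of_nat)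
  have "\<exists>z w. dist x z \<le> 2 * t n \<and> dist x w \<le> 2 * t n \<and>
      partial b (partial a f) z = partial a (partial b f) w" for n
  proof -
    obtain z where z: "dist x z \<le> 2 * t n" "f (x + t n *\<^sub>R axis a 1 + t n *\<^sub>R axis b 1)
        - f (x + t n *\<^sub>R axis a 1) - f (x + t n *\<^sub>R axis b 1) + f x = (t n)\<^sup>2 * partial b (partial a f) z"
      using second_difference[OF t(1) r(2) t(2) sm] by blast
    obtain w where w: "dist x w \<le> 2 * t n" "f (x + t n *\<^sub>R axis b 1 + t n *\<^sub>R axis a 1)
        - f (x + t n *\<^sub>R axis b 1) - f (x + t n *\<^sub>R axis a 1) + f x = (t n)\<^sup>2 * partial a (partial b f) w"
      using second_difference[OF t(1) r(2) t(2) sm] by blast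
    have "(t n)\<^sup>2 * partial b (partial a f) z = (t n)\<^sup>2 * partial a (partial b f) w"
      unfolding z(2)[symmetric] w(2)[symmetric] by (simp add: add_ac)
    then show ?thesis using z(1) w(1) t(1)[of n] by auto
  qed
  then obtain z w where zw: "\<And>n. dist x (z n) \<le> 2 * t n" "\<And>n. dist x (w n) \<le> 2 * t n"
      "\<And>n. partial b (partial a f) (z n) = partial a (partial b f) (w n)"
    by metis
  have lim: "y \<longlonglongrightarrow> x" if "\<And>n. dist x (y n) \<le> 2 * t n" for y
    using tendsto_sandwich[OF _ _ tendsto_const t0, of "\<lambda>n. dist (y n) x"] that
    by (subst tendsto_dist_iff) (auto simp: dist_commute)
  have cont: "isCont (partial c (partial d f)) x" for c d
    using smooth_on_continuous[OF smooth_on_partial[OF smooth_on_partial[OF sm]]] assms(1,2)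
    by (simp add: continuous_on_eq_continuous_at)
  have "(\<lambda>n. partial b (partial a f) (z n)) \<longlonglongrightarrow> partial b (partial a f) x"
    using isCont_tendsto_compose[OF cont lim[OF zw(1)]] .
  moreover have "(\<lambda>n. partial b (partial a f) (z n)) \<longlonglongrightarrow> partial a (partial b f) x"
    unfolding zw(3) using isCont_tendsto_compose[OF cont lim[OF zw(2)]] .
  ultimately show ?thesis using LIMSEQ_unique by blast
qed

section \<open>Moving frames\<close>

text \<open>\<open>J s t\<close> is the \<open>\<partial>\<^sub>t\<close>-component of the frame field \<open>X\<^sub>s\<close>, and \<open>K\<close> the inverse matrix.\<close>

locale frame_field =
  fixes U :: "(real^'n::finite) set" and J K :: "'n \<Rightarrow> 'n \<Rightarrow> real^'n \<Rightarrow> real"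
  assumes open_U: "open U"
    and smooth_J: "\<And>s t. smooth_on (J s t) U"
    and smooth_K: "\<And>s t. smooth_on (K s t) U"
    and JK: "\<And>y s t. y \<in> U \<Longrightarrow> (\<Sum>r\<in>UNIV. J s r y * K r t y) = (if s = t then 1 else 0)"
    and KJ: "\<And>y s t. y \<in> U \<Longrightarrow> (\<Sum>r\<in>UNIV. K s r y * J r t y) = (if s = t then 1 else 0)"
begin

definition X :: "'n \<Rightarrow> (real^'n \<Rightarrow> real) \<Rightarrow> real^'n \<Rightarrow> real" where
  "X s F y = (\<Sum>t\<in>UNIV. J s t y * partial t F y)"

definition bracket :: "'n \<Rightarrow> 'n \<Rightarrow> 'n \<Rightarrow> real^'n \<Rightarrow> real" where
  "bracket a b c y = (\<Sum>d\<in>UNIV. (X a (J b d) y - X b (J a d) y) * K d c y)"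

lemmas sm = smooth_on_const smooth_on_add[OF open_U] smooth_on_mult[OF open_U]
  smooth_on_minus[OF open_U] smooth_on_diff[OF open_U] smooth_on_sum[OF open_U] smooth_on_partial

lemma smooth_X: "smooth_on F U \<Longrightarrow> smooth_on (X s F) U"
  unfolding X_def[abs_def] by (intro sm smooth_J)

lemma smooth_bracket: "smooth_on (bracket a b c) U"
  unfolding bracket_def[abs_def] by (intro sm smooth_J smooth_K smooth_X)

lemma X_cong:
  assumes "\<And>z. z \<in> U \<Longrightarrow> F z = F' z" "y \<in> U"
  shows "X s F y = X s F' y"
  unfolding X_def using partial_cong_open[OF open_U assms(2) assms(1)] by simp

lemma X_const: "X s (\<lambda>z. c) y = 0"
  by (simp add: X_def partial_const)

lemma X_add:
  "y \<in> U \<Longrightarrow> smooth_on F U \<Longrightarrow> smooth_on F' U \<Longrightarrow> X s (\<lambda>z. F z + F' z) y = X s F y + X s F' y"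
  unfolding X_def
  by (simp add: partial_add smooth_on_differentiable[where U = U] distrib_left sum.distrib)

lemma X_mult:
  "y \<in> U \<Longrightarrow> smooth_on F U \<Longrightarrow> smooth_on F' U \<Longrightarrow>
    X s (\<lambda>z. F z * F' z) y = X s F y * F' y + F y * X s F' y"
  unfolding X_def
  by (simp add: partial_mult smooth_on_differentiable[where U = U] algebra_simps sum.distrib
      sum_distrib_left sum_distrib_right)

lemma X_minus: "y \<in> U \<Longrightarrow> smooth_on F U \<Longrightarrow> X s (\<lambda>z. - F z) y = - X s F y"
  using X_mult[OF _ smooth_on_const[of "-1"], of y F s] by (simp add: X_const)

lemma X_diff:
  "y \<in> U \<Longrightarrow> smooth_on F U \<Longrightarrow> smooth_on F' U \<Longrightarrow> X s (\<lambda>z. F z - F' z) y = X s F y - X s F' y"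
  using X_add[of y F "\<lambda>z. - F' z" s] by (simp add: X_minus sm)

lemma X_sum:
  "y \<in> U \<Longrightarrow> finite I \<Longrightarrow> (\<And>i. i \<in> I \<Longrightarrow> smooth_on (F i) U) \<Longrightarrow>
    X s (\<lambda>z. \<Sum>i\<in>I. F i z) y = (\<Sum>i\<in>I. X s (F i) y)"
  unfolding X_def
  by (simp add: partial_sum smooth_on_differentiable[where U = U] sum_distrib_left sum.swap[of _ UNIV I])

lemma sum_KJ: "y \<in> U \<Longrightarrow> (\<Sum>c\<in>UNIV. (\<Sum>d\<in>UNIV. V d * K d c y) * J c h y) = V h"
proof -
  assume y: "y \<in> U"
  have "(\<Sum>c\<in>UNIV. (\<Sum>d\<in>UNIV. V d * K d c y) * J c h y) = (\<Sum>d\<in>UNIV. V d * (\<Sum>c\<in>UNIV. K d c y * J c h y))"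
    unfolding sum_distrib_left sum_distrib_right by (subst sum.swap) (simp add: mult.assoc)
  then show ?thesis by (simp add: KJ[OF y] if_distrib[of "\<lambda>x. _ * x"] cong: if_cong)
qed

lemma sum_JK: "y \<in> U \<Longrightarrow> (\<Sum>h\<in>UNIV. (\<Sum>c\<in>UNIV. V c * J c h y) * K h d y) = V d"
proof -
  assume y: "y \<in> U"
  have "(\<Sum>h\<in>UNIV. (\<Sum>c\<in>UNIV. V c * J c h y) * K h d y) = (\<Sum>c\<in>UNIV. V c * (\<Sum>h\<in>UNIV. J c h y * K h d y))"
    unfolding sum_distrib_left sum_distrib_right by (subst sum.swap) (simp add: mult.assoc)
  then show ?thesis by (simp add: JK[OF y] if_distrib[of "\<lambda>x. _ * x"] cong: if_cong)
qed

lemma J_cancel: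
  assumes "y \<in> U" "\<And>h. (\<Sum>c\<in>UNIV. V c * J c h y) = (\<Sum>c\<in>UNIV. V' c * J c h y)"
  shows "V d = V' d"
  using sum_JK[OF assms(1), of V d] sum_JK[OF assms(1), of V' d] assms(2) by simp

lemma bracket_J: "y \<in> U \<Longrightarrow> (\<Sum>c\<in>UNIV. bracket a b c y * J c d y) = X a (J b d) y - X b (J a d) y"
  unfolding bracket_def by (rule sum_KJ)

lemma X_X:
  assumes y: "y \<in> U" and F: "smooth_on F U"
  shows "X s (X t F) y = (\<Sum>d\<in>UNIV. X s (J t d) y * partial d F y) +
    (\<Sum>d\<in>UNIV. \<Sum>e\<in>UNIV. J t d y * J s e y * partial e (partial d F) y)"
proof -
  have "X s (X t F) y = (\<Sum>d\<in>UNIV. X s (\<lambda>z. J t d z * partial d F z) y)"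
    unfolding X_def[of t, abs_def] by (rule X_sum[OF y]) (auto intro!: sm smooth_J F)
  also have "\<dots> = (\<Sum>d\<in>UNIV. X s (J t d) y * partial d F y + J t d y * X s (partial d F) y)"
    by (simp add: X_mult[OF y smooth_J smooth_on_partial[OF F]])
  also have "\<dots> = (\<Sum>d\<in>UNIV. X s (J t d) y * partial d F y) +
    (\<Sum>d\<in>UNIV. J t d y * X s (partial d F) y)" by (rule sum.distrib)
  finally show ?thesis by (simp add: X_def[of s "partial _ F"] sum_distrib_left mult.assoc)
qed

text \<open>By Schwarz's theorem the second-order terms are symmetric in the two fields, so the
  commutator is again of first order.\<close>

lemma X_commute:
  assumes y: "y \<in> U" and F: "smooth_on F U"
  shows "X s (X t F) y - X t (X s F) y = (\<Sum>d\<in>UNIV. (X s (J t d) y - X t (J s d) y) * partial d F y)"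
proof -
  have "(\<Sum>d\<in>UNIV. \<Sum>e\<in>UNIV. J t d y * J s e y * partial e (partial d F) y) =
      (\<Sum>d\<in>UNIV. \<Sum>e\<in>UNIV. J s d y * J t e y * partial e (partial d F) y)"
    by (subst sum.swap) (simp add: partial_commute[OF open_U y F] mult_ac)
  then show ?thesis
    by (simp add: X_X[OF y F] left_diff_distrib sum_subtractf)
qed

lemma X_bracket:
  assumes y: "y \<in> U" and F: "smooth_on F U"
  shows "X s (X t F) y - X t (X s F) y = (\<Sum>c\<in>UNIV. bracket s t c y * X c F y)"
proof -
  have "(\<Sum>c\<in>UNIV. bracket s t c y * X c F y) =
      (\<Sum>d\<in>UNIV. (\<Sum>c\<in>UNIV. bracket s t c y * J c d y) * partial d F y)"
    unfolding X_def[of _ F] sum_distrib_left sum_distrib_right by (subst sum.swap) (simp add: mult.assoc)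
  then show ?thesis by (simp add: X_commute[OF y F] bracket_J[OF y])
qed

end

section \<open>Covariant tensors of arbitrary order in a frame\<close>

lemma sum_swap_inner:
  "(\<Sum>a\<in>A. \<Sum>b\<in>B. \<Sum>c\<in>C. Q a b c) = (\<Sum>a\<in>A. \<Sum>c\<in>C. \<Sum>b\<in>B. Q a b c)"
  by (rule sum.cong[OF refl], rule sum.swap)

lemma sum_rotate:
  "(\<Sum>a\<in>A. \<Sum>b\<in>B. \<Sum>c\<in>C. Q a b c) = (\<Sum>c\<in>C. \<Sum>a\<in>A. \<Sum>b\<in>B. Q a b c)"
  unfolding sum_swap_inner[of Q] by (rule sum.swap)

text \<open>Evaluates a covariant tensor on frame fields, one row of \<open>A\<close> for each
  index. Recursion over the index list serves all orders at once: differentials, the metric, the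
  Weyl tensor and its first two covariant derivatives.\<close>

primrec frame_comp :: "('n::finite \<Rightarrow> 'n \<Rightarrow> real) \<Rightarrow> 'n list \<Rightarrow> ('n list \<Rightarrow> real) \<Rightarrow> real" where
  "frame_comp A [] F = F []"
| "frame_comp A (a # as) F = (\<Sum>c\<in>UNIV. A a c * frame_comp A as (\<lambda>cs. F (c # cs)))"

lemma frame_comp_diff:
  "frame_comp A as (\<lambda>bs. F bs - F' bs) = frame_comp A as F - frame_comp A as F'"
  by (induction as arbitrary: F F') (simp_all add: right_diff_distrib sum_subtractf)

lemma frame_comp_add:
  "frame_comp A as (\<lambda>bs. F bs + F' bs) = frame_comp A as F + frame_comp A as F'"
  by (induction as arbitrary: F F') (simp_all add: distrib_left sum.distrib)

lemma frame_comp_cmult: "frame_comp A as (\<lambda>bs. c * F bs) = c * frame_comp A as F"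
  by (induction as arbitrary: F) (simp_all add: sum_distrib_left mult.left_commute)

lemma frame_comp_0: "frame_comp A as (\<lambda>bs. 0) = 0"
  by (induction as) simp_all

lemma frame_comp_sum:
  "frame_comp A as (\<lambda>bs. \<Sum>i\<in>I. F i bs) = (\<Sum>i\<in>I. frame_comp A as (F i))"
  by (induction I rule: infinite_finite_induct) (simp_all add: frame_comp_0 frame_comp_add)

text \<open>The connection part of a covariant derivative. The coefficients are a parameter so that
  it applies both to Christoffel symbols \<open>\<Gamma>\<close> and to frame coefficients
  \<open>\<gamma>\<close>.\<close>

definition conn_term :: "('n::finite \<Rightarrow> 'n \<Rightarrow> 'n \<Rightarrow> real) \<Rightarrow> 'n \<Rightarrow> 'n list \<Rightarrow> ('n list \<Rightarrow> real) \<Rightarrow> real" where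
  "conn_term g p as F = (\<Sum>m<length as. \<Sum>e\<in>UNIV. g p (as ! m) e * F (as[m := e]))"

lemma conn_term_Nil: "conn_term g p [] F = 0"
  by (simp add: conn_term_def)

lemma conn_term_Cons:
  "conn_term g p (a # as) F =
    (\<Sum>e\<in>UNIV. g p a e * F (e # as)) + conn_term g p as (\<lambda>bs. F (a # bs))"
  unfolding conn_term_def by (simp only: length_Cons sum.lessThan_Suc_shift) simp

lemma conn_term_sum_cmult:
  "conn_term g p as (\<lambda>bs. \<Sum>c\<in>UNIV. k c * F c bs) = (\<Sum>c\<in>UNIV. k c * conn_term g p as (F c))"
proof (induction as arbitrary: F)
  case (Cons a as)
  have "(\<Sum>e\<in>UNIV. g p a e * (\<Sum>c\<in>UNIV. k c * F c (e # as))) =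
      (\<Sum>c\<in>UNIV. k c * (\<Sum>e\<in>UNIV. g p a e * F c (e # as)))"
    unfolding sum_distrib_left by (subst sum.swap) (simp add: mult_ac)
  then show ?case by (simp add: conn_term_Cons Cons.IH distrib_left sum.distrib)
qed (simp add: conn_term_Nil)

lemma cov_deriv_Cons:
  "cov_deriv \<Gamma> S x (p # as) = partial p (\<lambda>z. S z as) x - conn_term (\<Gamma> x) p as (S x)"
  by (simp add: cov_deriv_def conn_term_def)

lemma (in frame_field) smooth_frame_comp:
  assumes "\<And>bs. length bs = length as \<Longrightarrow> smooth_on (\<lambda>z. S z bs) U"
  shows "smooth_on (\<lambda>z. frame_comp (\<lambda>s t. J s t z) as (S z)) U"
  using assms by (induction as arbitrary: S) (auto intro!: sm smooth_J)

locale frame_connection = frame_field U J K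
  for U :: "(real^'n::finite) set" and J K +
  fixes \<Gamma> :: "'n christoffel"
  assumes smooth_\<Gamma>: "\<And>a b c. smooth_on (\<lambda>x. \<Gamma> x a b c) U"
begin

abbreviation fr :: "real^'n \<Rightarrow> 'n list \<Rightarrow> ('n list \<Rightarrow> real) \<Rightarrow> real" where
  "fr y \<equiv> frame_comp (\<lambda>s t. J s t y)"

text \<open>\<open>\<gamma> a b c\<close> is the \<open>X\<^sub>c\<close>-component of the covariant derivative of \<open>X\<^sub>b\<close> along \<open>X\<^sub>a\<close>.\<close>

definition \<gamma> :: "'n \<Rightarrow> 'n \<Rightarrow> 'n \<Rightarrow> real^'n \<Rightarrow> real" where
  "\<gamma> a b c y = (\<Sum>d\<in>UNIV.
    (X a (J b d) y + (\<Sum>e\<in>UNIV. \<Sum>f\<in>UNIV. J a e y * J b f y * \<Gamma> y e f d)) * K d c y)"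

lemma \<gamma>_J: "y \<in> U \<Longrightarrow> (\<Sum>c\<in>UNIV. \<gamma> a b c y * J c d y) =
    X a (J b d) y + (\<Sum>e\<in>UNIV. \<Sum>f\<in>UNIV. J a e y * J b f y * \<Gamma> y e f d)"
  unfolding \<gamma>_def by (rule sum_KJ)

lemma \<gamma>_torsion_free:
  assumes "y \<in> U" and sym: "\<And>e f d. \<Gamma> y e f d = \<Gamma> y f e d"
  shows "\<gamma> a b c y - \<gamma> b a c y = bracket a b c y"
proof -
  have "(\<Sum>e\<in>UNIV. \<Sum>f\<in>UNIV. J b e y * J a f y * \<Gamma> y e f d) =
      (\<Sum>e\<in>UNIV. \<Sum>f\<in>UNIV. J a e y * J b f y * \<Gamma> y e f d)" for d
    by (subst sum.swap) (simp add: mult_ac sym[of _ _ d])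
  then show ?thesis
    by (simp add: \<gamma>_def bracket_def sum_subtractf[symmetric] left_diff_distrib[symmetric])
qed

lemma smooth_\<gamma>: "smooth_on (\<gamma> a b c) U"
  unfolding \<gamma>_def[abs_def] by (intro sm smooth_J smooth_K smooth_\<Gamma> smooth_X)

text \<open>Covariant differentiation commutes with evaluation on frame fields. In the induction on
  the index list the product rule produces derivatives of the frame matrix \<open>J\<close>, and the
  definition of \<open>\<gamma>\<close> absorbs exactly these.\<close>

lemma frame_cov_deriv_aux:
  assumes y: "y \<in> U" and "\<And>bs. length bs = length as \<Longrightarrow> smooth_on (\<lambda>z. S z bs) U"
  shows "X p (\<lambda>z. fr z as (S z)) y - conn_term (\<lambda>a b c. \<gamma> a b c y) p as (\<lambda>bs. fr y bs (S y)) =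
    fr y as (\<lambda>bs. X p (\<lambda>z. S z bs) y - (\<Sum>q\<in>UNIV. J p q y * conn_term (\<Gamma> y) q bs (S y)))"
  using assms(2)
proof (induction as arbitrary: S)
  case Nil
  then show ?case by (simp add: conn_term_Nil)
next
  case (Cons a as)
  define S' where "S' c z bs = S z (c # bs)" for c z bs
  have smS': "smooth_on (\<lambda>z. S' c z bs) U" if "length bs = length as" for c bs
    using Cons.prems that by (simp add: S'_def)
  have smf: "smooth_on (\<lambda>z. fr z as (S' c z)) U" for c
    by (rule smooth_frame_comp) (rule smS')
  have "X p (\<lambda>z. fr z (a # as) (S z)) y = (\<Sum>c\<in>UNIV. X p (\<lambda>z. J a c z * fr z as (S' c z)) y)"
    unfolding frame_comp.simps S'_def[symmetric] by (rule X_sum[OF y]) (auto intro!: sm smooth_J smf)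
  also have "\<dots> = (\<Sum>c\<in>UNIV. X p (J a c) y * fr y as (S' c y)) + (\<Sum>c\<in>UNIV. J a c y * X p (\<lambda>z. fr z as (S' c z)) y)"
    by (simp add: X_mult[OF y smooth_J smf] sum.distrib)
  finally have 1: "X p (\<lambda>z. fr z (a # as) (S z)) y = \<dots>" .
  have 2: "conn_term (\<lambda>a b c. \<gamma> a b c y) p (a # as) (\<lambda>bs. fr y bs (S y)) =
      (\<Sum>c\<in>UNIV. (\<Sum>e\<in>UNIV. \<gamma> p a e y * J e c y) * fr y as (S' c y)) +
      (\<Sum>c\<in>UNIV. J a c y * conn_term (\<lambda>a b c. \<gamma> a b c y) p as (\<lambda>bs. fr y bs (S' c y)))"
  proof -
    have "(\<Sum>e\<in>UNIV. \<gamma> p a e y * (\<Sum>c\<in>UNIV. J e c y * fr y as (S' c y))) =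
        (\<Sum>c\<in>UNIV. (\<Sum>e\<in>UNIV. \<gamma> p a e y * J e c y) * fr y as (S' c y))"
      unfolding sum_distrib_left sum_distrib_right by (subst sum.swap) (simp add: mult.assoc)
    moreover have "(\<lambda>cs. S y (c # cs)) = S' c y" for c by (simp add: S'_def fun_eq_iff)
    ultimately show ?thesis by (simp add: conn_term_Cons conn_term_sum_cmult)
  qed
  \<comment> \<open>\<open>\<gamma>_J\<close> splits the sum: the derivatives of \<open>J\<close>
    cancel the extra term of \<open>1\<close>, and the Christoffel part is the contribution of the
    leading index in \<open>4\<close>.\<close>
  have 3: "(\<Sum>c\<in>UNIV. (\<Sum>e\<in>UNIV. \<gamma> p a e y * J e c y) * fr y as (S' c y)) =
      (\<Sum>c\<in>UNIV. X p (J a c) y * fr y as (S' c y)) +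
      (\<Sum>c\<in>UNIV. J a c y * fr y as (\<lambda>bs. \<Sum>q\<in>UNIV. J p q y * (\<Sum>e\<in>UNIV. \<Gamma> y q c e * S' e y bs)))"
  proof -
    have "(\<Sum>c\<in>UNIV. (\<Sum>q\<in>UNIV. \<Sum>f\<in>UNIV. J p q y * J a f y * \<Gamma> y q f c) * fr y as (S' c y)) =
        (\<Sum>c\<in>UNIV. \<Sum>f\<in>UNIV. \<Sum>q\<in>UNIV. J a f y * (J p q y * (\<Gamma> y q f c * fr y as (S' c y))))"
      unfolding sum_distrib_right by (subst sum_swap_inner) (simp add: mult_ac)
    also have "\<dots> = (\<Sum>f\<in>UNIV. \<Sum>q\<in>UNIV. \<Sum>c\<in>UNIV. J a f y * (J p q y * (\<Gamma> y q f c * fr y as (S' c y))))"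
      by (rule sum_rotate[symmetric])
    finally show ?thesis
      by (simp add: \<gamma>_J[OF y] distrib_right sum.distrib frame_comp_sum frame_comp_cmult sum_distrib_left)
  qed
  have 4: "fr y (a # as) (\<lambda>bs. X p (\<lambda>z. S z bs) y - (\<Sum>q\<in>UNIV. J p q y * conn_term (\<Gamma> y) q bs (S y))) =
      (\<Sum>c\<in>UNIV. J a c y * fr y as (\<lambda>bs. X p (\<lambda>z. S' c z bs) y -
        (\<Sum>q\<in>UNIV. J p q y * conn_term (\<Gamma> y) q bs (S' c y)))) -
      (\<Sum>c\<in>UNIV. J a c y * fr y as (\<lambda>bs. \<Sum>q\<in>UNIV. J p q y * (\<Sum>e\<in>UNIV. \<Gamma> y q c e * S' e y bs)))"
  proof -
    have "(\<lambda>cs. S y (c # cs)) = S' c y" for c by (simp add: S'_def fun_eq_iff)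
    then show ?thesis
      by (simp add: conn_term_Cons S'_def[symmetric] distrib_left sum.distrib frame_comp_diff
          frame_comp_add right_diff_distrib sum_subtractf)
  qed
  have IH: "fr y as (\<lambda>bs. X p (\<lambda>z. S' c z bs) y - (\<Sum>q\<in>UNIV. J p q y * conn_term (\<Gamma> y) q bs (S' c y))) =
      X p (\<lambda>z. fr z as (S' c z)) y - conn_term (\<lambda>a b c. \<gamma> a b c y) p as (\<lambda>bs. fr y bs (S' c y))" for c
    by (rule Cons.IH[symmetric]) (rule smS')
  show ?case
    unfolding 1 2 3 4 IH by (simp add: right_diff_distrib sum_subtractf)
qed

lemma frame_cov_deriv:
  assumes y: "y \<in> U" and "\<And>bs. length bs = length as \<Longrightarrow> smooth_on (\<lambda>z. S z bs) U"
  shows "fr y (p # as) (cov_deriv \<Gamma> S y) =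
    X p (\<lambda>z. fr z as (S z)) y - conn_term (\<lambda>a b c. \<gamma> a b c y) p as (\<lambda>bs. fr y bs (S y))"
proof -
  have "fr y (p # as) (cov_deriv \<Gamma> S y) =
      fr y as (\<lambda>bs. X p (\<lambda>z. S z bs) y - (\<Sum>q\<in>UNIV. J p q y * conn_term (\<Gamma> y) q bs (S y)))"
    by (simp add: cov_deriv_Cons X_def frame_comp_diff frame_comp_sum frame_comp_cmult
        right_diff_distrib sum_subtractf)
  then show ?thesis using frame_cov_deriv_aux[where S = S and p = p, OF assms] by simp
qed

section \<open>Curvature and Ricci tensor in a moving frame\<close>

text \<open>The last sum accounts for the brackets of the frame fields.\<close>

definition frame_curv :: "'n \<Rightarrow> 'n \<Rightarrow> 'n \<Rightarrow> 'n \<Rightarrow> real^'n \<Rightarrow> real" where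
  "frame_curv a b c d y = X a (\<gamma> b c d) y - X b (\<gamma> a c d) y +
    (\<Sum>e\<in>UNIV. \<gamma> b c e y * \<gamma> a e d y - \<gamma> a c e y * \<gamma> b e d y) -
    (\<Sum>e\<in>UNIV. bracket a b e y * \<gamma> e c d y)"

definition frame_ric :: "'n \<Rightarrow> 'n \<Rightarrow> real^'n \<Rightarrow> real" where
  "frame_ric b c y = (\<Sum>a\<in>UNIV. frame_curv a b c a y)"

text \<open>Covariant derivatives of one vector field in coordinate components, here along a
  coordinate field and in \<open>vec_X\<close> along a frame field. They mediate between the
  coordinate and the frame expression of the curvature.\<close>

definition vec_deriv :: "'n \<Rightarrow> ('n \<Rightarrow> real^'n \<Rightarrow> real) \<Rightarrow> 'n \<Rightarrow> real^'n \<Rightarrow> real" where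
  "vec_deriv e V h y = partial e (V h) y + (\<Sum>g\<in>UNIV. \<Gamma> y e g h * V g y)"

definition vec_X :: "'n \<Rightarrow> ('n \<Rightarrow> real^'n \<Rightarrow> real) \<Rightarrow> 'n \<Rightarrow> real^'n \<Rightarrow> real" where
  "vec_X a V h y = (\<Sum>e\<in>UNIV. J a e y * vec_deriv e V h y)"

lemma smooth_vec_deriv: "(\<And>g. smooth_on (V g) U) \<Longrightarrow> smooth_on (vec_deriv e V h) U"
  unfolding vec_deriv_def[abs_def] by (intro sm smooth_\<Gamma>)

lemma vec_X_eq: "vec_X a V h y = X a (V h) y + (\<Sum>e\<in>UNIV. \<Sum>g\<in>UNIV. J a e y * \<Gamma> y e g h * V g y)"
  unfolding vec_X_def vec_deriv_def X_def
  by (simp add: distrib_left sum.distrib sum_distrib_left mult.assoc)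

lemma vec_X_J: "y \<in> U \<Longrightarrow> vec_X a (J b) h y = (\<Sum>c\<in>UNIV. \<gamma> a b c y * J c h y)"
  by (simp add: vec_X_eq \<gamma>_J mult.assoc mult.commute[of "\<Gamma> _ _ _ _"])

lemma partial_add_U: "y \<in> U \<Longrightarrow> smooth_on F U \<Longrightarrow> smooth_on F' U \<Longrightarrow>
    partial a (\<lambda>z. F z + F' z) y = partial a F y + partial a F' y"
  by (rule partial_add) (auto intro: smooth_on_differentiable)

lemma partial_mult_U: "y \<in> U \<Longrightarrow> smooth_on F U \<Longrightarrow> smooth_on F' U \<Longrightarrow>
    partial a (\<lambda>z. F z * F' z) y = partial a F y * F' y + F y * partial a F' y"
  by (rule partial_mult) (auto intro: smooth_on_differentiable)

lemma partial_sum_U: "y \<in> U \<Longrightarrow> finite I \<Longrightarrow> (\<And>i. i \<in> I \<Longrightarrow> smooth_on (F i) U) \<Longrightarrow>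
    partial a (\<lambda>z. \<Sum>i\<in>I. F i z) y = (\<Sum>i\<in>I. partial a (F i) y)"
  by (rule partial_sum) (auto intro: smooth_on_differentiable)

lemma vec_deriv_vec_deriv:
  assumes y: "y \<in> U" and V: "\<And>g. smooth_on (V g) U"
  shows "vec_deriv e (vec_deriv f V) h y = partial e (partial f (V h)) y +
    (\<Sum>g\<in>UNIV. partial e (\<lambda>z. \<Gamma> z f g h) y * V g y + \<Gamma> y f g h * partial e (V g) y) +
    (\<Sum>i\<in>UNIV. \<Gamma> y e i h * partial f (V i) y) +
    (\<Sum>g\<in>UNIV. (\<Sum>i\<in>UNIV. \<Gamma> y f g i * \<Gamma> y e i h) * V g y)"
proof -
  have "partial e (vec_deriv f V h) y = partial e (partial f (V h)) y +
      (\<Sum>g\<in>UNIV. partial e (\<lambda>z. \<Gamma> z f g h) y * V g y + \<Gamma> y f g h * partial e (V g) y)"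
    unfolding vec_deriv_def[abs_def] using y
    by (simp add: partial_add_U partial_sum_U partial_mult_U sm smooth_\<Gamma> V)
  moreover have "(\<Sum>i\<in>UNIV. \<Gamma> y e i h * (\<Sum>g\<in>UNIV. \<Gamma> y f g i * V g y)) =
      (\<Sum>g\<in>UNIV. (\<Sum>i\<in>UNIV. \<Gamma> y f g i * \<Gamma> y e i h) * V g y)"
    unfolding sum_distrib_left sum_distrib_right by (subst sum.swap) (simp add: mult_ac)
  ultimately show ?thesis
    unfolding vec_deriv_def[of e "vec_deriv f V"] vec_deriv_def[of f V _ y]
    by (simp add: distrib_left sum.distrib)
qed

text \<open>The Ricci identity. Coordinate fields commute, so there is no bracket term, and the
  first derivatives of \<open>V\<close> cancel in pairs.\<close>

lemma vec_deriv_curvature: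
  assumes y: "y \<in> U" and V: "\<And>g. smooth_on (V g) U"
  shows "vec_deriv e (vec_deriv f V) h y - vec_deriv f (vec_deriv e V) h y =
    (\<Sum>g\<in>UNIV. curvature \<Gamma> y e f g h * V g y)"
  unfolding vec_deriv_vec_deriv[OF assms] curvature_def
  by (simp add: partial_commute[OF open_U y V, of e f] algebra_simps sum.distrib sum_subtractf
      sum_distrib_left)

lemma vec_X_vec_X:
  assumes y: "y \<in> U" and V: "\<And>g. smooth_on (V g) U"
  shows "vec_X a (vec_X b V) h y = (\<Sum>f\<in>UNIV. X a (J b f) y * vec_deriv f V h y) +
    (\<Sum>f\<in>UNIV. \<Sum>e\<in>UNIV. J a e y * J b f y * vec_deriv e (vec_deriv f V) h y)"
proof -
  have "X a (vec_X b V h) y =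
      (\<Sum>f\<in>UNIV. X a (J b f) y * vec_deriv f V h y + J b f y * X a (vec_deriv f V h) y)"
    unfolding vec_X_def[abs_def] using y
    by (simp add: X_sum X_mult sm smooth_J smooth_vec_deriv V)
  moreover have "(\<Sum>e\<in>UNIV. \<Sum>g\<in>UNIV. J a e y * \<Gamma> y e g h * vec_X b V g y) =
      (\<Sum>f\<in>UNIV. \<Sum>e\<in>UNIV. \<Sum>g\<in>UNIV. J a e y * \<Gamma> y e g h * (J b f y * vec_deriv f V g y))"
  proof -
    have "(\<Sum>e\<in>UNIV. \<Sum>g\<in>UNIV. J a e y * \<Gamma> y e g h * vec_X b V g y) =
        (\<Sum>e\<in>UNIV. \<Sum>f\<in>UNIV. \<Sum>g\<in>UNIV. J a e y * \<Gamma> y e g h * (J b f y * vec_deriv f V g y))"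
      unfolding vec_X_def sum_distrib_left by (rule sum_swap_inner)
    also have "\<dots> = (\<Sum>f\<in>UNIV. \<Sum>e\<in>UNIV. \<Sum>g\<in>UNIV. J a e y * \<Gamma> y e g h * (J b f y * vec_deriv f V g y))"
      by (rule sum.swap)
    finally show ?thesis .
  qed
  ultimately have "vec_X a (vec_X b V) h y = (\<Sum>f\<in>UNIV. X a (J b f) y * vec_deriv f V h y) +
      ((\<Sum>f\<in>UNIV. J b f y * X a (vec_deriv f V h) y) +
      (\<Sum>f\<in>UNIV. \<Sum>e\<in>UNIV. \<Sum>g\<in>UNIV. J a e y * \<Gamma> y e g h * (J b f y * vec_deriv f V g y)))"
    by (simp add: vec_X_eq[of a] sum.distrib)
  also have "(\<Sum>f\<in>UNIV. J b f y * X a (vec_deriv f V h) y) +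
      (\<Sum>f\<in>UNIV. \<Sum>e\<in>UNIV. \<Sum>g\<in>UNIV. J a e y * \<Gamma> y e g h * (J b f y * vec_deriv f V g y)) =
      (\<Sum>f\<in>UNIV. \<Sum>e\<in>UNIV. J a e y * J b f y * vec_deriv e (vec_deriv f V) h y)"
    unfolding vec_deriv_def[of _ "vec_deriv _ _"] X_def
    by (simp add: distrib_left sum.distrib sum_distrib_left mult_ac)
  finally show ?thesis .
qed

text \<open>The commutator of two covariant derivatives of a frame field is expanded in two ways:
  through \<open>\<gamma>\<close> in \<open>twice\<close>, and through coordinates by
  \<open>vec_X_vec_X\<close> and the Ricci identity.\<close>

lemma frame_curv_J:
  assumes y: "y \<in> U"
  shows "(\<Sum>d\<in>UNIV. frame_curv a b c d y * J d h y) =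
    (\<Sum>e\<in>UNIV. \<Sum>f\<in>UNIV. \<Sum>g\<in>UNIV. J a e y * J b f y * J c g y * curvature \<Gamma> y e f g h)"
proof -
  have twice: "vec_X a (vec_X b (J c)) h y = (\<Sum>d\<in>UNIV. X a (\<gamma> b c d) y * J d h y) +
      (\<Sum>d\<in>UNIV. (\<Sum>e\<in>UNIV. \<gamma> b c e y * \<gamma> a e d y) * J d h y)" for a b
  proof -
    have "vec_X a (vec_X b (J c)) h y = vec_X a (\<lambda>h z. \<Sum>d\<in>UNIV. \<gamma> b c d z * J d h z) h y"
      unfolding vec_X_eq[of a] using X_cong[OF vec_X_J y] by (simp add: vec_X_J[OF y])
    also have "\<dots> = (\<Sum>d\<in>UNIV. X a (\<gamma> b c d) y * J d h y) + (\<Sum>d\<in>UNIV. \<gamma> b c d y * X a (J d h) y) +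
        (\<Sum>e\<in>UNIV. \<Sum>g\<in>UNIV. \<Sum>d\<in>UNIV. \<gamma> b c d y * (J a e y * \<Gamma> y e g h * J d g y))"
      unfolding vec_X_eq using y
      by (simp add: X_sum X_mult sm smooth_\<gamma> smooth_J sum.distrib sum_distrib_left mult_ac)
    also have "(\<Sum>e\<in>UNIV. \<Sum>g\<in>UNIV. \<Sum>d\<in>UNIV. \<gamma> b c d y * (J a e y * \<Gamma> y e g h * J d g y)) =
        (\<Sum>d\<in>UNIV. \<Sum>e\<in>UNIV. \<Sum>g\<in>UNIV. \<gamma> b c d y * (J a e y * \<Gamma> y e g h * J d g y))"
      by (rule sum_rotate)
    also have "(\<Sum>d\<in>UNIV. X a (\<gamma> b c d) y * J d h y) + (\<Sum>d\<in>UNIV. \<gamma> b c d y * X a (J d h) y) + \<dots> =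
        (\<Sum>d\<in>UNIV. X a (\<gamma> b c d) y * J d h y) + (\<Sum>e\<in>UNIV. \<gamma> b c e y * vec_X a (J e) h y)"
      unfolding vec_X_eq by (simp add: distrib_left sum.distrib sum_distrib_left)
    also have "(\<Sum>e\<in>UNIV. \<gamma> b c e y * vec_X a (J e) h y) =
        (\<Sum>d\<in>UNIV. (\<Sum>e\<in>UNIV. \<gamma> b c e y * \<gamma> a e d y) * J d h y)"
      unfolding vec_X_J[OF y] sum_distrib_left sum_distrib_right
      by (subst sum.swap) (simp add: mult.assoc)
    finally show ?thesis .
  qed
  \<comment> \<open>The bracket sum of \<open>frame_curv\<close> is the derivative of the field
    \<open>X c\<close> along the bracket of \<open>X a\<close> and \<open>X b\<close>. The same term
    is left over in the coordinate expansion, since frame fields need not commute.\<close>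
  have br: "(\<Sum>d\<in>UNIV. (\<Sum>e\<in>UNIV. bracket a b e y * \<gamma> e c d y) * J d h y) =
      (\<Sum>f\<in>UNIV. (X a (J b f) y - X b (J a f) y) * vec_deriv f (J c) h y)"
  proof -
    have "(\<Sum>d\<in>UNIV. (\<Sum>e\<in>UNIV. bracket a b e y * \<gamma> e c d y) * J d h y) =
        (\<Sum>e\<in>UNIV. bracket a b e y * vec_X e (J c) h y)"
      unfolding vec_X_J[OF y] sum_distrib_left sum_distrib_right
      by (subst sum.swap) (simp add: mult.assoc)
    also have "\<dots> = (\<Sum>f\<in>UNIV. (\<Sum>e\<in>UNIV. bracket a b e y * J e f y) * vec_deriv f (J c) h y)"
      unfolding vec_X_def sum_distrib_left sum_distrib_right
      by (subst sum.swap) (simp add: mult.assoc)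
    finally show ?thesis by (simp add: bracket_J[OF y])
  qed
  have "vec_X a (vec_X b (J c)) h y - vec_X b (vec_X a (J c)) h y =
      (\<Sum>f\<in>UNIV. (X a (J b f) y - X b (J a f) y) * vec_deriv f (J c) h y) +
      (\<Sum>f\<in>UNIV. \<Sum>e\<in>UNIV. J a e y * J b f y *
        (vec_deriv e (vec_deriv f (J c)) h y - vec_deriv f (vec_deriv e (J c)) h y))"
  proof -
    have "(\<Sum>f\<in>UNIV. \<Sum>e\<in>UNIV. J b e y * J a f y * vec_deriv e (vec_deriv f (J c)) h y) =
        (\<Sum>f\<in>UNIV. \<Sum>e\<in>UNIV. J a e y * J b f y * vec_deriv f (vec_deriv e (J c)) h y)"
      by (subst sum.swap) (simp add: mult_ac)
    then show ?thesis
      by (simp add: vec_X_vec_X[OF y smooth_J] left_diff_distrib right_diff_distrib sum_subtractf)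
  qed
  also have "(\<Sum>f\<in>UNIV. \<Sum>e\<in>UNIV. J a e y * J b f y *
        (vec_deriv e (vec_deriv f (J c)) h y - vec_deriv f (vec_deriv e (J c)) h y)) =
      (\<Sum>e\<in>UNIV. \<Sum>f\<in>UNIV. \<Sum>g\<in>UNIV. J a e y * J b f y * J c g y * curvature \<Gamma> y e f g h)"
    unfolding vec_deriv_curvature[OF y smooth_J] sum_distrib_left
    by (subst sum.swap) (simp add: mult_ac)
  finally show ?thesis
    unfolding twice br[symmetric] frame_curv_def
    by (simp add: left_diff_distrib distrib_right sum.distrib sum_subtractf)
qed

text \<open>A trace does not depend on the basis: on the traced pair of indices \<open>K\<close>
  undoes \<open>J\<close>.\<close>

lemma frame_ric_J:
  assumes y: "y \<in> U"
  shows "frame_ric b c y = (\<Sum>f\<in>UNIV. \<Sum>g\<in>UNIV. J b f y * J c g y * ricci \<Gamma> y f g)"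
proof -
  have "frame_curv a b c a y = (\<Sum>h\<in>UNIV. (\<Sum>d\<in>UNIV. frame_curv a b c d y * J d h y) * K h a y)" for a
    by (rule sum_JK[OF y, symmetric])
  then have "frame_ric b c y = (\<Sum>a\<in>UNIV. \<Sum>h\<in>UNIV. \<Sum>e\<in>UNIV. \<Sum>f\<in>UNIV. \<Sum>g\<in>UNIV.
      J a e y * J b f y * J c g y * curvature \<Gamma> y e f g h * K h a y)"
    unfolding frame_ric_def frame_curv_J[OF y] by (simp add: sum_distrib_right)
  also have "\<dots> = (\<Sum>h\<in>UNIV. \<Sum>e\<in>UNIV. \<Sum>f\<in>UNIV. \<Sum>g\<in>UNIV. \<Sum>a\<in>UNIV.
      J a e y * J b f y * J c g y * curvature \<Gamma> y e f g h * K h a y)"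
  proof -
    have "(\<Sum>a\<in>UNIV. \<Sum>h\<in>UNIV. \<Sum>e\<in>UNIV. \<Sum>f\<in>UNIV. \<Sum>g\<in>UNIV. Q a h e f g) =
      (\<Sum>h\<in>UNIV. \<Sum>e\<in>UNIV. \<Sum>f\<in>UNIV. \<Sum>g\<in>UNIV. \<Sum>a\<in>UNIV. Q a h e f g)"
      for Q :: "'n \<Rightarrow> 'n \<Rightarrow> 'n \<Rightarrow> 'n \<Rightarrow> 'n \<Rightarrow> real"
    proof -
      have "(\<Sum>a\<in>UNIV. \<Sum>h\<in>UNIV. \<Sum>e\<in>UNIV. \<Sum>f\<in>UNIV. \<Sum>g\<in>UNIV. Q a h e f g) =
          (\<Sum>h\<in>UNIV. \<Sum>e\<in>UNIV. \<Sum>a\<in>UNIV. \<Sum>f\<in>UNIV. \<Sum>g\<in>UNIV. Q a h e f g)"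
        by (rule sum_rotate[symmetric])
      also have "\<dots> = (\<Sum>h\<in>UNIV. \<Sum>e\<in>UNIV. \<Sum>f\<in>UNIV. \<Sum>g\<in>UNIV. \<Sum>a\<in>UNIV. Q a h e f g)"
        by (rule sum.cong[OF refl], rule sum.cong[OF refl], rule sum_rotate[symmetric])
      finally show ?thesis .
    qed
    then show ?thesis .
  qed
  also have "\<dots> = (\<Sum>h\<in>UNIV. \<Sum>e\<in>UNIV. \<Sum>f\<in>UNIV. \<Sum>g\<in>UNIV.
      J b f y * J c g y * curvature \<Gamma> y e f g h * (\<Sum>a\<in>UNIV. K h a y * J a e y))"
    by (simp add: sum_distrib_left mult_ac)
  also have "\<dots> = (\<Sum>h\<in>UNIV. \<Sum>e\<in>UNIV. if h = e then
      (\<Sum>f\<in>UNIV. \<Sum>g\<in>UNIV. J b f y * J c g y * curvature \<Gamma> y e f g h) else 0)"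
    by (intro sum.cong refl) (simp add: KJ[OF y])
  also have "\<dots> = (\<Sum>h\<in>UNIV. \<Sum>f\<in>UNIV. \<Sum>g\<in>UNIV. J b f y * J c g y * curvature \<Gamma> y h f g h)"
    by (simp only: sum.delta'[OF finite] sum.delta[OF finite] UNIV_I if_True)
  also have "\<dots> = (\<Sum>f\<in>UNIV. \<Sum>g\<in>UNIV. \<Sum>h\<in>UNIV. J b f y * J c g y * curvature \<Gamma> y h f g h)"
    by (rule sum_rotate[symmetric])
  finally show ?thesis by (simp add: ricci_def sum_distrib_left)
qed

end

section \<open>Frames in which a metric is constant\<close>

text \<open>That \<open>\<eta>\<close> does not depend on the point is the whole gain of the frame:
  metric compatibility becomes skew symmetry of the connection coefficients.\<close>

locale frame_metric = frame_field U J K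
  for U :: "(real^'n::finite) set" and J K +
  fixes G :: "'n metric" and \<eta> \<eta>' :: "'n \<Rightarrow> 'n \<Rightarrow> real"
  assumes smooth_G: "\<And>a b. smooth_on (\<lambda>y. G y a b) U"
    and G_sym: "\<And>y a b. y \<in> U \<Longrightarrow> G y a b = G y b a"
    and frame_G: "\<And>y s t. y \<in> U \<Longrightarrow> (\<Sum>c\<in>UNIV. \<Sum>d\<in>UNIV. J s c y * J t d y * G y c d) = \<eta> s t"
    and \<eta>_sym: "\<And>s t. \<eta> s t = \<eta> t s"
    and \<eta>_inv: "\<And>s t. (\<Sum>r\<in>UNIV. \<eta> s r * \<eta>' r t) = (if s = t then 1 else 0)"
begin

lemma delta_mult: "(if P then 1 else 0) * (x::real) = (if P then x else 0)"
  "(x::real) * (if P then 1 else 0) = (if P then x else 0)"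
  by simp_all

text \<open>With \<open>A\<close> the matrix of the metric, \<open>frame_G\<close> reads
  \<open>J A J^T = E\<close>. Multiplication by \<open>K\<close> gives \<open>A = K E K^T\<close>,
  whose inverse is \<open>J^T E' J\<close>.\<close>

lemma metric_inverse_matrix:
  assumes y: "y \<in> U"
  defines "B \<equiv> (\<chi> a b. \<Sum>s\<in>UNIV. \<Sum>t\<in>UNIV. \<eta>' s t * J s a y * J t b y) :: real^'n^'n"
  shows "(\<chi> a b. G y a b) ** B = mat 1" "B ** (\<chi> a b. G y a b) = mat 1"
proof -
  let ?A = "(\<chi> a b. G y a b) :: real^'n^'n"
  let ?J = "(\<chi> a b. J a b y) :: real^'n^'n" and ?K = "(\<chi> a b. K a b y) :: real^'n^'n"
  let ?E = "(\<chi> a b. \<eta> a b) :: real^'n^'n" and ?E' = "(\<chi> a b. \<eta>' a b) :: real^'n^'n"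
  have 1: "?J ** ?K = mat 1" "?K ** ?J = mat 1" "?E ** ?E' = mat 1"
    by (simp_all add: vec_eq_iff matrix_matrix_mult_def mat_def JK[OF y] KJ[OF y] \<eta>_inv)
  have "?J ** ?A ** transpose ?J = ?E"
    by (simp add: vec_eq_iff matrix_matrix_mult_def transpose_def frame_G[OF y, symmetric]
        sum_distrib_right) (intro allI, subst sum.swap, simp add: mult_ac)
  then have "?K ** (?J ** ?A ** transpose ?J) ** transpose ?K = ?K ** ?E ** transpose ?K" by simp
  moreover have "?K ** (?J ** ?A ** transpose ?J) ** transpose ?K =
      (?K ** ?J) ** ?A ** transpose (?K ** ?J)"
    by (simp add: matrix_transpose_mul matrix_mul_assoc)
  ultimately have A: "?A = ?K ** ?E ** transpose ?K" by (simp add: 1 transpose_mat)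
  have B: "B = transpose ?J ** ?E' ** ?J"
    unfolding B_def
    by (simp add: vec_eq_iff matrix_matrix_mult_def transpose_def sum_distrib_right)
      (intro allI, subst sum.swap, simp add: mult_ac)
  have "?A ** B = ?K ** ?E ** transpose (?J ** ?K) ** ?E' ** ?J"
    unfolding A B by (simp only: matrix_transpose_mul matrix_mul_assoc)
  also have "\<dots> = ?K ** (?E ** ?E') ** ?J"
    by (simp only: 1(1) transpose_mat matrix_mul_assoc matrix_mul_rid)
  also have "\<dots> = mat 1" unfolding 1(3) matrix_mul_rid by (rule 1(2))
  finally show AB: "?A ** B = mat 1" .
  then show "B ** ?A = mat 1" using matrix_left_right_inverse by blast
qed

text \<open>\<open>matrix_inv\<close> chooses some two-sided inverse; uniqueness of inverses
  identifies it with the matrix at hand.\<close>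

lemma metric_inv_frame:
  assumes y: "y \<in> U"
  shows "metric_inv G y a b = (\<Sum>s\<in>UNIV. \<Sum>t\<in>UNIV. \<eta>' s t * J s a y * J t b y)"
proof -
  let ?A = "(\<chi> a b. G y a b) :: real^'n^'n"
  let ?B = "(\<chi> a b. \<Sum>s\<in>UNIV. \<Sum>t\<in>UNIV. \<eta>' s t * J s a y * J t b y) :: real^'n^'n"
  have "\<exists>B. ?A ** B = mat 1 \<and> B ** ?A = mat 1"
    using metric_inverse_matrix[OF y] by (intro exI conjI)
  then have inv: "matrix_inv ?A ** ?A = mat 1"
    unfolding matrix_inv_def by (rule someI_ex[THEN conjunct2])
  have "matrix_inv ?A = matrix_inv ?A ** (?A ** ?B)"
    unfolding metric_inverse_matrix(1)[OF y] by simp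
  also have "\<dots> = ?B"
    unfolding matrix_mul_assoc inv by simp
  finally show ?thesis by (simp add: metric_inv_def)
qed

lemma G_metric_inv:
  assumes y: "y \<in> U"
  shows "(\<Sum>r\<in>UNIV. G y a r * metric_inv G y r b) = (if a = b then 1 else 0)"
proof -
  let ?B = "(\<chi> a b. \<Sum>s\<in>UNIV. \<Sum>t\<in>UNIV. \<eta>' s t * J s a y * J t b y) :: real^'n^'n"
  have "metric_inv G y r b = ?B $ r $ b" for r
    by (simp only: metric_inv_frame[OF y] vec_lambda_beta)
  then have "(\<Sum>r\<in>UNIV. G y a r * metric_inv G y r b) = ((\<chi> a b. G y a b) ** ?B) $ a $ b"
    by (simp only: matrix_matrix_mult_def vec_lambda_beta)
  then show ?thesis
    by (simp only: metric_inverse_matrix(1)[OF y]) (simp add: mat_def)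
qed

lemma \<eta>_inv': "(\<Sum>r\<in>UNIV. \<eta>' s r * \<eta> r t) = (if s = t then 1 else 0)"
proof -
  have "(\<chi> a b. \<eta> a b) ** (\<chi> a b. \<eta>' a b) = (mat 1 :: real^'n^'n)"
    by (simp add: vec_eq_iff matrix_matrix_mult_def mat_def \<eta>_inv)
  then have "(\<chi> a b. \<eta>' a b) ** (\<chi> a b. \<eta> a b) = (mat 1 :: real^'n^'n)"
    using matrix_left_right_inverse by blast
  then show ?thesis by (simp add: vec_eq_iff matrix_matrix_mult_def mat_def)
qed

lemma \<eta>'_sym: "\<eta>' s t = \<eta>' t s"
proof -
  have "(\<Sum>r\<in>UNIV. (\<Sum>q\<in>UNIV. \<eta>' s q * \<eta> q r) * \<eta>' t r) = (\<Sum>q\<in>UNIV. \<eta>' s q * (\<Sum>r\<in>UNIV. \<eta>' t r * \<eta> r q))"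
    unfolding sum_distrib_left sum_distrib_right by (subst sum.swap) (simp add: mult_ac \<eta>_sym[of q for q])
  then show ?thesis
    unfolding \<eta>_inv' by (simp add: delta_mult)
qed

lemma smooth_metric_inv: "smooth_on (\<lambda>y. metric_inv G y a b) U"
  by (rule smooth_on_cong[OF open_U metric_inv_frame[symmetric]]) (auto intro!: sm smooth_J)

lemma smooth_levi_civita: "smooth_on (\<lambda>y. levi_civita G y a b c) U"
  unfolding levi_civita_def divide_inverse by (intro sm smooth_metric_inv smooth_G)

sublocale frame_connection U J K "levi_civita G"
  by unfold_locales (rule smooth_levi_civita)

lemma levi_civita_sym:
  assumes y: "y \<in> U"
  shows "levi_civita G y a b c = levi_civita G y b a c"
proof -
  have "partial e (\<lambda>z. G z a b) y = partial e (\<lambda>z. G z b a) y" for e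
    by (rule partial_cong_open[OF open_U y G_sym])
  then show ?thesis by (simp add: levi_civita_def add.commute)
qed

lemma levi_civita_lower:
  assumes y: "y \<in> U"
  shows "(\<Sum>c\<in>UNIV. levi_civita G y a b c * G y c d) =
    (partial a (\<lambda>z. G z b d) y + partial b (\<lambda>z. G z a d) y - partial d (\<lambda>z. G z a b) y) / 2"
proof -
  define S where
    "S e = partial a (\<lambda>z. G z b e) y + partial b (\<lambda>z. G z a e) y - partial e (\<lambda>z. G z a b) y" for e
  have "(\<Sum>c\<in>UNIV. levi_civita G y a b c * G y c d) =
      (\<Sum>c\<in>UNIV. \<Sum>e\<in>UNIV. G y d c * metric_inv G y c e * S e / 2)"
    by (simp add: levi_civita_def S_def[symmetric] sum_divide_distrib sum_distrib_left sum_distrib_right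
        mult_ac G_sym[OF y, of d])
  also have "\<dots> = (\<Sum>e\<in>UNIV. (\<Sum>c\<in>UNIV. G y d c * metric_inv G y c e) * S e / 2)"
    by (subst sum.swap) (simp add: sum_distrib_right sum_divide_distrib)
  also have "\<dots> = (\<Sum>e\<in>UNIV. if d = e then S e / 2 else 0)"
    by (rule sum.cong) (simp_all add: G_metric_inv[OF y])
  finally show ?thesis by (simp add: S_def)
qed

lemma metric_compatible:
  assumes y: "y \<in> U"
  shows "partial p (\<lambda>z. G z a b) y =
    (\<Sum>e\<in>UNIV. levi_civita G y p a e * G y e b) + (\<Sum>e\<in>UNIV. levi_civita G y p b e * G y a e)"
proof -
  have 1: "(\<Sum>e\<in>UNIV. levi_civita G y p b e * G y a e) = (\<Sum>e\<in>UNIV. levi_civita G y p b e * G y e a)"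
    by (simp add: G_sym[OF y, of a])
  have 2: "partial p (\<lambda>z. G z b a) y = partial p (\<lambda>z. G z a b) y"
    by (rule partial_cong_open[OF open_U y G_sym])
  show ?thesis
    unfolding 1 levi_civita_lower[OF y] 2 by (simp add: field_simps)
qed

lemma \<gamma>_torsion: "y \<in> U \<Longrightarrow> \<gamma> a b c y - \<gamma> b a c y = bracket a b c y"
  by (rule \<gamma>_torsion_free, assumption, rule levi_civita_sym)

text \<open>\<open>frame_cov_deriv\<close> is applied to the metric itself: its covariant derivative
  is 0 and its frame components are constant, so only the connection terms remain.\<close>

lemma \<gamma>_metric:
  assumes y: "y \<in> U"
  shows "(\<Sum>e\<in>UNIV. \<gamma> a b e y * \<eta> e c) + (\<Sum>e\<in>UNIV. \<gamma> a c e y * \<eta> e b) = 0"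
proof -
  define S where "S z as = G z (as ! 0) (as ! 1)" for z as
  have fS: "fr z [s, t] (S z) = \<eta> s t" if "z \<in> U" for z s t
    using frame_G[OF that, of s t] by (simp add: S_def sum_distrib_left mult.assoc)
  have "cov_deriv (levi_civita G) S y [p, q, r] = 0" for p q r
    using metric_compatible[OF y, of p q r]
    by (simp add: cov_deriv_Cons conn_term_Cons conn_term_Nil S_def)
  then have "fr y (a # [b, c]) (cov_deriv (levi_civita G) S y) = 0" by simp
  moreover have "X a (\<lambda>z. fr z [b, c] (S z)) y = 0"
    using X_cong[of "\<lambda>z. fr z [b, c] (S z)" "\<lambda>z. \<eta> b c" y a] fS y by (simp add: X_const)
  moreover have "fr y (a # [b, c]) (cov_deriv (levi_civita G) S y) =
      X a (\<lambda>z. fr z [b, c] (S z)) y - conn_term (\<lambda>a b c. \<gamma> a b c y) a [b, c] (\<lambda>bs. fr y bs (S y))"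
    by (rule frame_cov_deriv[OF y]) (simp add: S_def smooth_G)
  ultimately show ?thesis
    by (simp add: conn_term_Cons conn_term_Nil fS[OF y] \<eta>_sym[of b] del: frame_comp.simps)
qed

text \<open>Skew symmetry and vanishing torsion determine the connection by cyclic permutation of
  three indices. The derivative terms of the general formula are absent because
  \<open>\<eta>\<close> is constant.\<close>

lemma koszul:
  assumes y: "y \<in> U"
  defines "L a b c \<equiv> \<Sum>e\<in>UNIV. bracket a b e y * \<eta> e c"
  shows "(\<Sum>e\<in>UNIV. \<gamma> a b e y * \<eta> e c) = (L a b c - L b c a + L c a b) / 2"
proof -
  define g where "g a b c = (\<Sum>e\<in>UNIV. \<gamma> a b e y * \<eta> e c)" for a b c
  have L: "L a b c = g a b c - g b a c" for a b c
    by (simp add: L_def g_def \<gamma>_torsion[OF y, symmetric] left_diff_distrib sum_subtractf)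
  have skew: "g a b c + g a c b = 0" for a b c
    using \<gamma>_metric[OF y] by (simp add: g_def)
  show ?thesis
    unfolding g_def[symmetric] L using skew[of a b c] skew[of b a c] skew[of c b a] by argo
qed

text \<open>The skew symmetry of \<open>\<gamma>_metric\<close> with an index raised, the form in
  which it acts on a contracted pair.\<close>

lemma \<gamma>_raised_skew:
  assumes y: "y \<in> U"
  shows "(\<Sum>q\<in>UNIV. \<eta>' l q * \<gamma> p q e y) = - (\<Sum>q\<in>UNIV. \<eta>' e q * \<gamma> p q l y)"
proof -
  define N where "N b c = (\<Sum>f\<in>UNIV. \<gamma> p b f y * \<eta> f c)" for b c
  have skew: "N b c = - N c b" for b c
    using \<gamma>_metric[OF y, of p b c] by (simp add: N_def)
  have \<gamma>: "\<gamma> p q f y = (\<Sum>c\<in>UNIV. N q c * \<eta>' c f)" for q f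
  proof -
    have "(\<Sum>c\<in>UNIV. N q c * \<eta>' c f) = (\<Sum>d\<in>UNIV. \<gamma> p q d y * (\<Sum>c\<in>UNIV. \<eta> d c * \<eta>' c f))"
      unfolding N_def sum_distrib_left sum_distrib_right by (subst sum.swap) (simp add: mult.assoc)
    then show ?thesis by (simp add: \<eta>_inv delta_mult)
  qed
  have pointwise: "\<eta>' l q * (N q c * \<eta>' c e) = - (\<eta>' e c * (N c q * \<eta>' q l))" for q c
    using skew[of q c] by (simp add: \<eta>'_sym[of l q] \<eta>'_sym[of e c])
  have "(\<Sum>q\<in>UNIV. \<Sum>c\<in>UNIV. \<eta>' l q * (N q c * \<eta>' c e)) =
      (\<Sum>c\<in>UNIV. \<Sum>q\<in>UNIV. - (\<eta>' e c * (N c q * \<eta>' q l)))"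
    unfolding pointwise by (rule sum.swap)
  then show ?thesis by (simp add: \<gamma> sum_distrib_left sum_negf)
qed

subsection \<open>Curvature tensors of the metric\<close>

lemma smooth_curvature: "smooth_on (\<lambda>y. curvature (levi_civita G) y a b c d) U"
  unfolding curvature_def by (intro sm smooth_levi_civita)

lemma smooth_ricci: "smooth_on (\<lambda>y. metric_ricci G y a b) U"
  unfolding metric_ricci_def ricci_def by (intro sm smooth_curvature)

lemma smooth_scalar: "smooth_on (scalar_curvature G) U"
  unfolding scalar_curvature_def[abs_def] by (intro sm smooth_ricci smooth_metric_inv)

lemma smooth_weyl: "smooth_on (\<lambda>y. weyl G y a b c d) U"
  unfolding weyl_def riemann_def divide_inverse
  by (intro sm smooth_ricci smooth_scalar smooth_curvature smooth_G)

lemma smooth_cov_deriv: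
  assumes "\<And>bs. length bs = length as \<Longrightarrow> smooth_on (\<lambda>z. S z bs) U"
  shows "smooth_on (\<lambda>z. cov_deriv (levi_civita G) S z (p # as)) U"
  unfolding cov_deriv_Cons conn_term_def by (intro sm smooth_levi_civita assms) simp_all

definition frame_scalar :: "real^'n \<Rightarrow> real" where
  "frame_scalar y = (\<Sum>s\<in>UNIV. \<Sum>t\<in>UNIV. \<eta>' s t * frame_ric s t y)"

definition frame_weyl :: "'n \<Rightarrow> 'n \<Rightarrow> 'n \<Rightarrow> 'n \<Rightarrow> real^'n \<Rightarrow> real" where
  "frame_weyl a b c d y = (\<Sum>e\<in>UNIV. frame_curv a b c e y * \<eta> e d) -
     (\<eta> a d * frame_ric b c y + \<eta> b c * frame_ric a d y
      - \<eta> a c * frame_ric b d y - \<eta> b d * frame_ric a c y) / (real CARD('n) - 2) +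
     frame_scalar y * (\<eta> a d * \<eta> b c - \<eta> a c * \<eta> b d)
       / ((real CARD('n) - 1) * (real CARD('n) - 2))"

lemma contract:
  assumes y: "y \<in> U"
  shows "(\<Sum>s\<in>UNIV. \<Sum>t\<in>UNIV. \<eta>' s t * (\<Sum>c\<in>UNIV. \<Sum>d\<in>UNIV. J s c y * J t d y * F c d)) =
    (\<Sum>c\<in>UNIV. \<Sum>d\<in>UNIV. metric_inv G y c d * F c d)"
proof -
  have "(\<Sum>s\<in>UNIV. \<Sum>t\<in>UNIV. \<Sum>c\<in>UNIV. \<Sum>d\<in>UNIV. \<eta>' s t * (J s c y * J t d y * F c d)) =
      (\<Sum>c\<in>UNIV. \<Sum>s\<in>UNIV. \<Sum>t\<in>UNIV. \<Sum>d\<in>UNIV. \<eta>' s t * (J s c y * J t d y * F c d))"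
    by (rule sum_rotate)
  also have "\<dots> = (\<Sum>c\<in>UNIV. \<Sum>d\<in>UNIV. \<Sum>s\<in>UNIV. \<Sum>t\<in>UNIV. \<eta>' s t * (J s c y * J t d y * F c d))"
    by (rule sum.cong[OF refl]) (rule sum_rotate)
  finally show ?thesis
    by (simp add: sum_distrib_left metric_inv_frame[OF y] sum_distrib_right mult_ac)
qed

lemma frame_scalar: "y \<in> U \<Longrightarrow> frame_scalar y = scalar_curvature G y"
  unfolding frame_scalar_def scalar_curvature_def metric_ricci_def
  by (simp add: frame_ric_J contract)

lemma frame_weyl:
  assumes y: "y \<in> U"
  shows "fr y [a, b, c, d] (weyl_tensor G y) = frame_weyl a b c d y"
proof -
  define P where "P s t = (\<Sum>f\<in>UNIV. \<Sum>g\<in>UNIV. J s f y * J t g y * metric_ricci G y f g)" for s t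
  have P: "frame_ric s t y = P s t" for s t
    by (simp add: frame_ric_J[OF y] P_def metric_ricci_def)
  have \<eta>: "\<eta> s t = (\<Sum>f\<in>UNIV. \<Sum>g\<in>UNIV. J s f y * J t g y * G y f g)" for s t
    by (rule frame_G[OF y, symmetric])
  \<comment> \<open>The products in the Weyl tensor pair the four index positions in two ways only,
    (0,3)(1,2) and (0,2)(1,3). For each, the fourfold sum factors into two double sums.\<close>
  have 1: "fr y [a, b, c, d] (\<lambda>as. F (as ! 0) (as ! 3) * F' (as ! 1) (as ! 2)) =
      (\<Sum>f\<in>UNIV. \<Sum>g\<in>UNIV. J a f y * J d g y * F f g) * (\<Sum>f\<in>UNIV. \<Sum>g\<in>UNIV. J b f y * J c g y * F' f g)"
    for F F'
  proof -
    have "fr y [a, b, c, d] (\<lambda>as. F (as ! 0) (as ! 3) * F' (as ! 1) (as ! 2)) =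
        (\<Sum>a'\<in>UNIV. \<Sum>b'\<in>UNIV. \<Sum>c'\<in>UNIV. \<Sum>d'\<in>UNIV.
          (J a a' y * (J d d' y * F a' d')) * (J b b' y * (J c c' y * F' b' c')))"
      by (simp add: sum_distrib_left mult_ac numeral_3_eq_3)
    also have "\<dots> = (\<Sum>a'\<in>UNIV. \<Sum>d'\<in>UNIV. J a a' y * (J d d' y * F a' d')) *
        (\<Sum>b'\<in>UNIV. \<Sum>c'\<in>UNIV. J b b' y * (J c c' y * F' b' c'))"
      by (simp only: sum_distrib_left[symmetric] sum_distrib_right[symmetric])
    finally show ?thesis by (simp add: mult.assoc)
  qed
  have 2: "fr y [a, b, c, d] (\<lambda>as. F (as ! 0) (as ! 2) * F' (as ! 1) (as ! 3)) =
      (\<Sum>f\<in>UNIV. \<Sum>g\<in>UNIV. J a f y * J c g y * F f g) * (\<Sum>f\<in>UNIV. \<Sum>g\<in>UNIV. J b f y * J d g y * F' f g)"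
    for F F'
  proof -
    have "fr y [a, b, c, d] (\<lambda>as. F (as ! 0) (as ! 2) * F' (as ! 1) (as ! 3)) =
        (\<Sum>a'\<in>UNIV. \<Sum>b'\<in>UNIV. \<Sum>c'\<in>UNIV. \<Sum>d'\<in>UNIV.
          (J a a' y * (J c c' y * F a' c')) * (J b b' y * (J d d' y * F' b' d')))"
      by (simp add: sum_distrib_left mult_ac numeral_3_eq_3 numeral_2_eq_2)
    also have "\<dots> = (\<Sum>a'\<in>UNIV. \<Sum>c'\<in>UNIV. J a a' y * (J c c' y * F a' c')) *
        (\<Sum>b'\<in>UNIV. \<Sum>d'\<in>UNIV. J b b' y * (J d d' y * F' b' d'))"
      by (simp only: sum_distrib_left[symmetric] sum_distrib_right[symmetric])
    finally show ?thesis by (simp add: mult.assoc)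
  qed
  have 3: "fr y [a, b, c, d] (\<lambda>as. riemann G y (as ! 0) (as ! 1) (as ! 2) (as ! 3)) =
      (\<Sum>e\<in>UNIV. frame_curv a b c e y * \<eta> e d)"
  proof -
    have "(\<Sum>e\<in>UNIV. frame_curv a b c e y * \<eta> e d) =
        (\<Sum>e\<in>UNIV. \<Sum>h\<in>UNIV. frame_curv a b c e y * J e h y * (\<Sum>d'\<in>UNIV. J d d' y * G y h d'))"
      by (simp add: \<eta> sum_distrib_left mult_ac)
    also have "\<dots> = (\<Sum>h\<in>UNIV. (\<Sum>e\<in>UNIV. frame_curv a b c e y * J e h y) * (\<Sum>d'\<in>UNIV. J d d' y * G y h d'))"
      by (subst sum.swap) (simp only: sum_distrib_right)
    also have "\<dots> = (\<Sum>h\<in>UNIV. \<Sum>a'\<in>UNIV. \<Sum>b'\<in>UNIV. \<Sum>c'\<in>UNIV.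
        J a a' y * J b b' y * J c c' y * (\<Sum>d'\<in>UNIV. J d d' y * (curvature (levi_civita G) y a' b' c' h * G y h d')))"
      unfolding frame_curv_J[OF y]
      by (simp add: sum_distrib_left sum_distrib_right mult_ac)
    also have "\<dots> = (\<Sum>a'\<in>UNIV. \<Sum>b'\<in>UNIV. \<Sum>c'\<in>UNIV. \<Sum>h\<in>UNIV.
        J a a' y * J b b' y * J c c' y * (\<Sum>d'\<in>UNIV. J d d' y * (curvature (levi_civita G) y a' b' c' h * G y h d')))"
      by (subst sum_rotate[symmetric], rule sum.cong[OF refl], rule sum.cong[OF refl], rule sum.swap)
    also have "\<dots> = (\<Sum>a'\<in>UNIV. \<Sum>b'\<in>UNIV. \<Sum>c'\<in>UNIV.
        J a a' y * J b b' y * J c c' y * (\<Sum>d'\<in>UNIV. J d d' y * riemann G y a' b' c' d'))"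
      unfolding riemann_def sum_distrib_left[symmetric]
      by (simp only: sum_distrib_left, subst sum.swap) (rule refl)
    finally show ?thesis by (simp add: sum_distrib_left mult.assoc numeral_3_eq_3)
  qed
  have "weyl_tensor G y = (\<lambda>as. riemann G y (as ! 0) (as ! 1) (as ! 2) (as ! 3) -
      inverse (real CARD('n) - 2) *
      (G y (as ! 0) (as ! 3) * metric_ricci G y (as ! 1) (as ! 2) +
       metric_ricci G y (as ! 0) (as ! 3) * G y (as ! 1) (as ! 2) -
       G y (as ! 0) (as ! 2) * metric_ricci G y (as ! 1) (as ! 3) -
       metric_ricci G y (as ! 0) (as ! 2) * G y (as ! 1) (as ! 3)) +
      scalar_curvature G y * inverse ((real CARD('n) - 1) * (real CARD('n) - 2)) *
      (G y (as ! 0) (as ! 3) * G y (as ! 1) (as ! 2) - G y (as ! 0) (as ! 2) * G y (as ! 1) (as ! 3)))"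
    by (simp add: fun_eq_iff weyl_tensor_def weyl_def divide_inverse mult_ac)
  then have "fr y [a, b, c, d] (weyl_tensor G y) = (\<Sum>e\<in>UNIV. frame_curv a b c e y * \<eta> e d) -
      inverse (real CARD('n) - 2) * (\<eta> a d * P b c + P a d * \<eta> b c - \<eta> a c * P b d - P a c * \<eta> b d) +
      scalar_curvature G y * inverse ((real CARD('n) - 1) * (real CARD('n) - 2)) *
      (\<eta> a d * \<eta> b c - \<eta> a c * \<eta> b d)"
    by (simp only: frame_comp_add frame_comp_diff frame_comp_cmult 1 2 3 P_def[symmetric] \<eta>[symmetric])
  then show ?thesis
    by (simp add: frame_weyl_def P frame_scalar[OF y] divide_inverse mult_ac)
qed

subsection \<open>The Bach tensor\<close>

definition frame_weyl_deriv :: "'n \<Rightarrow> 'n \<Rightarrow> 'n \<Rightarrow> 'n \<Rightarrow> 'n \<Rightarrow> real^'n \<Rightarrow> real" where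
  "frame_weyl_deriv q k a b l y = X q (frame_weyl k a b l) y -
    ((\<Sum>e\<in>UNIV. \<gamma> q k e y * frame_weyl e a b l y) + (\<Sum>e\<in>UNIV. \<gamma> q a e y * frame_weyl k e b l y) +
     (\<Sum>e\<in>UNIV. \<gamma> q b e y * frame_weyl k a e l y) + (\<Sum>e\<in>UNIV. \<gamma> q l e y * frame_weyl k a b e y))"

text \<open>The inner divergence: \<open>l\<close> is contracted with the inner derivative index
  \<open>q\<close>. Contracting before the second differentiation leaves only a tensor with three
  indices to be differentiated again.\<close>

definition frame_div_weyl :: "'n \<Rightarrow> 'n \<Rightarrow> 'n \<Rightarrow> real^'n \<Rightarrow> real" where
  "frame_div_weyl k a b y = (\<Sum>l\<in>UNIV. \<Sum>q\<in>UNIV. \<eta>' l q * frame_weyl_deriv q k a b l y)"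

definition frame_bach :: "'n \<Rightarrow> 'n \<Rightarrow> real^'n \<Rightarrow> real" where
  "frame_bach a b y = (\<Sum>k\<in>UNIV. \<Sum>p\<in>UNIV. \<eta>' k p * (X p (frame_div_weyl k a b) y -
      ((\<Sum>e\<in>UNIV. \<gamma> p k e y * frame_div_weyl e a b y) + (\<Sum>e\<in>UNIV. \<gamma> p a e y * frame_div_weyl k e b y) +
       (\<Sum>e\<in>UNIV. \<gamma> p b e y * frame_div_weyl k a e y)) +
      (\<Sum>l\<in>UNIV. \<Sum>q\<in>UNIV. \<eta>' l q * (frame_ric p q y * frame_weyl k a b l y / 2))))"

lemma smooth_frame_curv: "smooth_on (frame_curv a b c d) U"
  unfolding frame_curv_def[abs_def] by (intro sm smooth_X smooth_\<gamma> smooth_bracket)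

lemma smooth_frame_ric: "smooth_on (frame_ric a b) U"
  unfolding frame_ric_def[abs_def] by (intro sm smooth_frame_curv)

lemma smooth_frame_weyl: "smooth_on (frame_weyl a b c d) U"
  unfolding frame_weyl_def[abs_def] frame_scalar_def divide_inverse
  by (intro sm smooth_frame_curv smooth_frame_ric)

lemma smooth_frame_weyl_deriv: "smooth_on (frame_weyl_deriv q k a b l) U"
  unfolding frame_weyl_deriv_def[abs_def] by (intro sm smooth_frame_weyl smooth_X smooth_\<gamma>)

lemma frame_weyl_deriv:
  assumes y: "y \<in> U"
  shows "fr y [q, k, a, b, l] (cov_deriv (levi_civita G) (weyl_tensor G) y) =
    frame_weyl_deriv q k a b l y"
proof -
  have "fr y (q # [k, a, b, l]) (cov_deriv (levi_civita G) (weyl_tensor G) y) =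
      X q (\<lambda>z. fr z [k, a, b, l] (weyl_tensor G z)) y -
      conn_term (\<lambda>a b c. \<gamma> a b c y) q [k, a, b, l] (\<lambda>bs. fr y bs (weyl_tensor G y))"
    by (rule frame_cov_deriv[OF y]) (simp add: weyl_tensor_def smooth_weyl)
  also have "X q (\<lambda>z. fr z [k, a, b, l] (weyl_tensor G z)) y = X q (frame_weyl k a b l) y"
    by (rule X_cong[OF frame_weyl y])
  finally show ?thesis
    by (simp add: conn_term_Cons conn_term_Nil frame_weyl[OF y] frame_weyl_deriv_def
        del: frame_comp.simps)
qed

lemma frame_weyl_deriv2:
  assumes y: "y \<in> U"
  shows "fr y [p, q, k, a, b, l] (cov_deriv (levi_civita G) (cov_deriv (levi_civita G) (weyl_tensor G)) y) =
    X p (frame_weyl_deriv q k a b l) y -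
    ((\<Sum>e\<in>UNIV. \<gamma> p q e y * frame_weyl_deriv e k a b l y) +
     (\<Sum>e\<in>UNIV. \<gamma> p k e y * frame_weyl_deriv q e a b l y) +
     (\<Sum>e\<in>UNIV. \<gamma> p a e y * frame_weyl_deriv q k e b l y) +
     (\<Sum>e\<in>UNIV. \<gamma> p b e y * frame_weyl_deriv q k a e l y) +
     (\<Sum>e\<in>UNIV. \<gamma> p l e y * frame_weyl_deriv q k a b e y))"
proof -
  let ?S = "cov_deriv (levi_civita G) (weyl_tensor G)"
  have "smooth_on (\<lambda>z. ?S z bs) U" if "length bs = 5" for bs
  proof (cases bs)
    case (Cons c cs)
    show ?thesis unfolding Cons by (rule smooth_cov_deriv) (simp add: weyl_tensor_def smooth_weyl)
  qed (use that in simp)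
  then have "fr y (p # [q, k, a, b, l]) (cov_deriv (levi_civita G) ?S y) =
      X p (\<lambda>z. fr z [q, k, a, b, l] (?S z)) y -
      conn_term (\<lambda>a b c. \<gamma> a b c y) p [q, k, a, b, l] (\<lambda>bs. fr y bs (?S y))"
    by (intro frame_cov_deriv[OF y]) simp
  also have "X p (\<lambda>z. fr z [q, k, a, b, l] (?S z)) y = X p (frame_weyl_deriv q k a b l) y"
    by (rule X_cong[OF frame_weyl_deriv y])
  finally show ?thesis
    by (simp add: conn_term_Cons conn_term_Nil frame_weyl_deriv[OF y] del: frame_comp.simps)
qed

text \<open>Contraction commutes with covariant differentiation: on a contracted pair the two
  connection terms cancel by skew symmetry.\<close>

lemma contract_skew:
  assumes y: "y \<in> U"
  shows "(\<Sum>l\<in>UNIV. \<Sum>q\<in>UNIV. \<eta>' l q * ((\<Sum>e\<in>UNIV. \<gamma> p q e y * F e l) + (\<Sum>e\<in>UNIV. \<gamma> p l e y * F q e))) = 0"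
proof -
  have "(\<Sum>l\<in>UNIV. \<Sum>q\<in>UNIV. \<eta>' l q * (\<Sum>e\<in>UNIV. \<gamma> p q e y * F e l)) =
      (\<Sum>l\<in>UNIV. \<Sum>e\<in>UNIV. (\<Sum>q\<in>UNIV. \<eta>' l q * \<gamma> p q e y) * F e l)"
    unfolding sum_distrib_left sum_distrib_right
    by (rule sum.cong[OF refl], subst sum.swap) (simp add: mult.assoc)
  also have "\<dots> = - (\<Sum>l\<in>UNIV. \<Sum>e\<in>UNIV. (\<Sum>q\<in>UNIV. \<eta>' e q * \<gamma> p q l y) * F e l)"
    unfolding sum_negf[symmetric]
    by (intro sum.cong refl) (subst \<gamma>_raised_skew[OF y], rule mult_minus_left)
  also have "(\<Sum>l\<in>UNIV. \<Sum>e\<in>UNIV. (\<Sum>q\<in>UNIV. \<eta>' e q * \<gamma> p q l y) * F e l) =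
      (\<Sum>q\<in>UNIV. \<Sum>l\<in>UNIV. \<Sum>e\<in>UNIV. \<eta>' e q * \<gamma> p q l y * F e l)"
    unfolding sum_distrib_right by (rule sum_rotate)
  also have "\<dots> = (\<Sum>l\<in>UNIV. \<Sum>q\<in>UNIV. \<eta>' l q * (\<Sum>e\<in>UNIV. \<gamma> p l e y * F q e))"
    unfolding sum_distrib_left
    by (rule sum.cong[OF refl], subst sum.swap) (simp add: mult.assoc \<eta>'_sym)
  finally show ?thesis by (simp add: distrib_left sum.distrib)
qed

lemma contract_frame_weyl_deriv2:
  assumes y: "y \<in> U"
  shows "(\<Sum>l\<in>UNIV. \<Sum>q\<in>UNIV. \<eta>' l q *
      fr y [p, q, k, a, b, l] (cov_deriv (levi_civita G) (cov_deriv (levi_civita G) (weyl_tensor G)) y)) =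
    X p (frame_div_weyl k a b) y -
      ((\<Sum>e\<in>UNIV. \<gamma> p k e y * frame_div_weyl e a b y) + (\<Sum>e\<in>UNIV. \<gamma> p a e y * frame_div_weyl k e b y) +
       (\<Sum>e\<in>UNIV. \<gamma> p b e y * frame_div_weyl k a e y))"
proof -
  have X: "X p (frame_div_weyl k a b) y =
      (\<Sum>l\<in>UNIV. \<Sum>q\<in>UNIV. \<eta>' l q * X p (frame_weyl_deriv q k a b l) y)"
    unfolding frame_div_weyl_def[abs_def] using y
    by (simp add: X_sum X_mult X_const sm smooth_frame_weyl_deriv)
  have pull: "(\<Sum>e\<in>UNIV. c e * (\<Sum>l\<in>UNIV. \<Sum>q\<in>UNIV. \<eta>' l q * F e l q)) =
      (\<Sum>l\<in>UNIV. \<Sum>q\<in>UNIV. \<eta>' l q * (\<Sum>e\<in>UNIV. c e * F e l q))" for c F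
    unfolding sum_distrib_left by (subst sum_rotate[symmetric]) (simp add: mult.left_commute)
  \<comment> \<open>\<open>B\<close> and \<open>D\<close> are the connection terms of the contracted
    indices \<open>q\<close> and \<open>l\<close>, which \<open>contract_skew\<close> removes.
    \<open>C1\<close>, \<open>C2\<close>, \<open>C3\<close> survive as those of \<open>k\<close>,
    \<open>a\<close>, \<open>b\<close>.\<close>
  have split: "\<eta>' l q * (A - (B + C1 + C2 + C3 + D)) =
      \<eta>' l q * A - (\<eta>' l q * C1 + \<eta>' l q * C2 + \<eta>' l q * C3) - \<eta>' l q * (B + D)" for l q A B C1 C2 C3 D
    by (simp add: algebra_simps)
  show ?thesis
    unfolding frame_weyl_deriv2[OF y] split X frame_div_weyl_def[of _ _ _ y] pull
    by (simp only: sum_subtractf sum.distrib contract_skew[OF y, of p "\<lambda>q l. frame_weyl_deriv q k a b l y"]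
        diff_0_right)
qed

text \<open>Contraction of one index, treated as an operator, so that six nested contractions can be
  reordered by rewriting whatever tensor stands inside.\<close>

definition slot :: "real^'n \<Rightarrow> 'n \<Rightarrow> ('n \<Rightarrow> real) \<Rightarrow> real" where
  "slot y a F = (\<Sum>i\<in>UNIV. J a i y * F i)"

lemma slot_swap: "slot y a (\<lambda>i. slot y b (\<lambda>j. F i j)) = slot y b (\<lambda>j. slot y a (\<lambda>i. F i j))"
  unfolding slot_def sum_distrib_left by (subst sum.swap) (simp add: mult.left_commute)

lemma slot_sum: "slot y a (\<lambda>i. \<Sum>s\<in>UNIV. F s i) = (\<Sum>s\<in>UNIV. slot y a (F s))"
  unfolding slot_def sum_distrib_left by (rule sum.swap)

lemma slot_cmult: "slot y a (\<lambda>i. c * F i) = c * slot y a F"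
  unfolding slot_def sum_distrib_left by (simp add: mult.left_commute)

lemma frame_comp_slot:
  "fr y [p, q, k, a, b, l] H = slot y p (\<lambda>p. slot y q (\<lambda>q. slot y k (\<lambda>k. slot y a (\<lambda>a.
    slot y b (\<lambda>b. slot y l (\<lambda>l. H [p, q, k, a, b, l]))))))"
  by (simp add: slot_def)

lemma contract_slot:
  "y \<in> U \<Longrightarrow> (\<Sum>c\<in>UNIV. \<Sum>d\<in>UNIV. metric_inv G y c d * F c d) =
    (\<Sum>s\<in>UNIV. \<Sum>t\<in>UNIV. \<eta>' s t * slot y s (\<lambda>c. slot y t (\<lambda>d. F c d)))"
  by (simp add: contract[symmetric] slot_def sum_distrib_left mult.assoc)

lemma frame_bach:
  assumes y: "y \<in> U"
  shows "(\<Sum>i\<in>UNIV. \<Sum>j\<in>UNIV. J a i y * J b j y * bach G y i j) = frame_bach a b y"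
proof -
  let ?D = "cov_deriv (levi_civita G) (cov_deriv (levi_civita G) (weyl_tensor G)) y"
  define H where "H bs = ?D bs +
    1/2 * (metric_ricci G y (bs!0) (bs!1) * weyl_tensor G y (drop 2 bs))" for bs
  have frH: "fr y [p, q, k, a, b, l] H = fr y [p, q, k, a, b, l] ?D + frame_ric p q y * frame_weyl k a b l y / 2"
    for p q k l
  proof -
    have "fr y [p, q, k, a, b, l] (\<lambda>bs. metric_ricci G y (bs!0) (bs!1) * weyl_tensor G y (drop 2 bs)) =
        (\<Sum>p'\<in>UNIV. \<Sum>q'\<in>UNIV. (J p p' y * (J q q' y * metric_ricci G y p' q'))) * fr y [k, a, b, l] (weyl_tensor G y)"
      by (simp only: frame_comp.simps(2)[of _ p] frame_comp.simps(2)[of _ q] nth_Cons_0 nth_Cons_Suc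
          One_nat_def numeral_2_eq_2 drop_Suc_Cons drop_0 frame_comp_cmult sum_distrib_left
          sum_distrib_right mult.assoc)
    also have "\<dots> = frame_ric p q y * frame_weyl k a b l y"
      by (simp add: frame_weyl[OF y] frame_ric_J[OF y] metric_ricci_def mult.assoc del: frame_comp.simps)
    finally show ?thesis
      unfolding H_def by (simp only: frame_comp_add frame_comp_cmult)
  qed
  have B: "bach G y i j = (\<Sum>k\<in>UNIV. \<Sum>p\<in>UNIV. metric_inv G y k p *
      (\<Sum>l\<in>UNIV. \<Sum>q\<in>UNIV. metric_inv G y l q * H [p, q, k, i, j, l]))" for i j
  proof -
    have "bach G y i j = (\<Sum>k\<in>UNIV. \<Sum>l\<in>UNIV. \<Sum>p\<in>UNIV. \<Sum>q\<in>UNIV.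
        metric_inv G y k p * (metric_inv G y l q * H [p, q, k, i, j, l]))"
      by (simp add: bach_def H_def weyl_tensor_def mult.assoc numeral_2_eq_2 numeral_3_eq_3)
    also have "\<dots> = (\<Sum>k\<in>UNIV. \<Sum>p\<in>UNIV. \<Sum>l\<in>UNIV. \<Sum>q\<in>UNIV.
        metric_inv G y k p * (metric_inv G y l q * H [p, q, k, i, j, l]))"
      by (rule sum.cong[OF refl], rule sum.swap)
    finally show ?thesis by (simp only: sum_distrib_left)
  qed
  have perm: "slot y a (\<lambda>i. slot y b (\<lambda>j. slot y k (\<lambda>k. slot y p (\<lambda>p. slot y l (\<lambda>l. slot y q (\<lambda>q.
      H [p, q, k, i, j, l])))))) = fr y [p, q, k, a, b, l] H" for k p l q
  proof -
    have "slot y a (\<lambda>i. slot y b (\<lambda>j. slot y k (\<lambda>k. slot y p (\<lambda>p. slot y l (\<lambda>l. slot y q (\<lambda>q.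
        F p q k i j l)))))) = slot y p (\<lambda>p. slot y q (\<lambda>q. slot y k (\<lambda>k. slot y a (\<lambda>i.
        slot y b (\<lambda>j. slot y l (\<lambda>l. F p q k i j l))))))" for F
      \<comment> \<open>A sort: each instance exchanges one pair of neighbours, and both sides
        arrive at the order \<open>q, p, k, a, b, l\<close>.\<close>
      unfolding slot_swap[of y l q] slot_swap[of y p q] slot_swap[of y k p] slot_swap[of y k q]
        slot_swap[of y b p] slot_swap[of y b q] slot_swap[of y b k]
        slot_swap[of y a p] slot_swap[of y a q] slot_swap[of y a k] by (rule refl)
    then show ?thesis unfolding frame_comp_slot .
  qed
  have "(\<Sum>i\<in>UNIV. \<Sum>j\<in>UNIV. J a i y * J b j y * bach G y i j) =
      slot y a (\<lambda>i. slot y b (\<lambda>j. bach G y i j))"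
    by (simp add: slot_def sum_distrib_left mult.assoc)
  also have "\<dots> = (\<Sum>k\<in>UNIV. \<Sum>p\<in>UNIV. \<eta>' k p * (\<Sum>l\<in>UNIV. \<Sum>q\<in>UNIV. \<eta>' l q * fr y [p, q, k, a, b, l] H))"
    unfolding B contract_slot[OF y] slot_sum slot_cmult perm by (rule refl)
  also have "\<dots> = frame_bach a b y"
    unfolding frH distrib_left sum.distrib contract_frame_weyl_deriv2[OF y] frame_bach_def by (rule refl)
  finally show ?thesis .
qed

end

lemma (in frame_field) covector_zeroI:
  assumes y: "y \<in> U" and zero: "\<And>a. (\<Sum>i\<in>UNIV. J a i y * V i) = 0"
  shows "V h = 0"
proof -
  have "(\<Sum>a\<in>UNIV. K h a y * (\<Sum>i\<in>UNIV. J a i y * V i)) =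
      (\<Sum>i\<in>UNIV. (\<Sum>a\<in>UNIV. K h a y * J a i y) * V i)"
    unfolding sum_distrib_left sum_distrib_right by (subst sum.swap) (simp add: mult.assoc)
  then show ?thesis by (simp add: KJ[OF y] zero if_distrib[of "\<lambda>x. x * _"] cong: if_cong)
qed

lemma (in frame_field) coordinate_zeroI:
  assumes y: "y \<in> U"
    and zero: "\<And>a b. (\<Sum>i\<in>UNIV. \<Sum>j\<in>UNIV. J a i y * J b j y * B i j) = 0"
  shows "B i j = 0"
proof -
  have "(\<Sum>i\<in>UNIV. J a i y * (\<Sum>j\<in>UNIV. J b j y * B i j)) = 0" for a b
    using zero[of a b] by (simp add: sum_distrib_left mult.assoc)
  then have "(\<Sum>j\<in>UNIV. J b j y * B i j) = 0" for b i
    by (rule covector_zeroI[OF y])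
  then show ?thesis by (rule covector_zeroI[OF y])
qed

section \<open>An adapted frame on the cotangent bundle\<close>

lemma sum_UNIV_Plus:
  "(\<Sum>s\<in>(UNIV :: ('a::finite + 'b::finite) set). f s) = (\<Sum>i\<in>UNIV. f (Inl i)) + (\<Sum>j\<in>UNIV. f (Inr j))"
  using sum.Plus[of "UNIV :: 'a set" "UNIV :: 'b set" f] by (simp add: UNIV_Plus_UNIV)

lemma two_neq_one: "(2::2) \<noteq> 1" "(1::2) \<noteq> 2"
  by simp_all

lemma forall_22: "(\<forall>s::2 + 2. P s) \<longleftrightarrow> P (Inl 1) \<and> P (Inl 2) \<and> P (Inr 1) \<and> P (Inr 2)"
proof safe
  fix s assume *: "P (Inl 1)" "P (Inl 2)" "P (Inr 1)" "P (Inr 2)"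
  show "P s"
  proof (cases s)
    case (Inl i)
    then show ?thesis using * exhaust_2[of i] by auto
  next
    case (Inr i)
    then show ?thesis using * exhaust_2[of i] by auto
  qed
qed auto

section \<open>Functions pulled back along the bundle projection\<close>

lemma bounded_linear_base_part: "bounded_linear (base_part :: real^('n + 'n) \<Rightarrow> real^'n::finite)"
  unfolding linear_conv_bounded_linear[symmetric]
  by (rule linearI) (simp_all add: base_part_def vec_eq_iff)

definition lift :: "(real^'n::finite \<Rightarrow> real) \<Rightarrow> real^('n + 'n) \<Rightarrow> real" where
  "lift F y = F (base_part y)"

lemma smooth_lift: "open U \<Longrightarrow> smooth_on F U \<Longrightarrow> smooth_on (lift F) (base_part -` U)"
  unfolding lift_def[abs_def] by (rule smooth_on_linear_compose[OF bounded_linear_base_part])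

lemma partial_lift:
  assumes "F differentiable (at (base_part y))"
  shows "partial (Inl a) (lift F) y = lift (partial a F) y" "partial (Inr a) (lift F) y = 0"
proof -
  have D: "(lift F has_derivative (\<lambda>h. \<Sum>c\<in>UNIV. base_part h $ c * partial c F (base_part y))) (at y)"
    unfolding lift_def[abs_def]
    by (rule has_derivative_compose[OF bounded_linear_imp_has_derivative[OF bounded_linear_base_part]
        has_derivative_partial[OF assms]])
  have 1: "base_part (axis (Inl a) (1::real)) $ c = (if c = a then 1 else 0)" for c :: 'a
    by (simp add: base_part_def axis_def)
  have 2: "base_part (axis (Inr a) (1::real)) $ c = 0" for c :: 'a
    by (simp add: base_part_def axis_def)
  show "partial (Inl a) (lift F) y = lift (partial a F) y"
    unfolding partial_eqI[OF D] 1 by (simp add: lift_def if_distrib[of "\<lambda>x. x * _"] cong: if_cong)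
  show "partial (Inr a) (lift F) y = 0"
    unfolding partial_eqI[OF D] 2 by simp
qed

lemma smooth_coordinate: "smooth_on (\<lambda>x::real^'n::finite. x $ a) U"
  by (rule smooth_on_linear) (rule bounded_linear_vec_nth)

text \<open>The situation over a small open piece of one chart. \<open>v_generic\<close> says that
  the determinant of \<open>v\<close> and \<open>T v\<close> does not vanish, so that the two form a
  frame.\<close>

locale nilpotent_structure =
  fixes U :: "(real^2) set" and D :: "2 christoffel" and T \<Phi> :: "real^2 \<Rightarrow> 2 \<Rightarrow> 2 \<Rightarrow> real"
    and v :: "real^2"
  assumes open_base: "open U"
    and smooth_D: "\<And>a b c. smooth_on (\<lambda>x. D x a b c) U"
    and smooth_T: "\<And>a b. smooth_on (\<lambda>x. T x a b) U"
    and smooth_\<Phi>: "\<And>a b. smooth_on (\<lambda>x. \<Phi> x a b) U"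
    and D_sym: "\<And>x a b c. x \<in> U \<Longrightarrow> D x a b c = D x b a c"
    and \<Phi>_sym: "\<And>x a b. x \<in> U \<Longrightarrow> \<Phi> x a b = \<Phi> x b a"
    and T_parallel: "\<And>x a b c. x \<in> U \<Longrightarrow> cov_deriv_11 D T x a b c = 0"
    and T_nilpotent: "\<And>x a c. x \<in> U \<Longrightarrow> (\<Sum>b\<in>UNIV. T x a b * T x b c) = 0"
    and v_generic: "\<And>x. x \<in> U \<Longrightarrow>
      v $ 1 * (\<Sum>b\<in>UNIV. v $ b * T x b 2) - v $ 2 * (\<Sum>b\<in>UNIV. v $ b * T x b 1) \<noteq> 0"
begin

text \<open>\<open>E i c\<close> is the \<open>\<partial>\<^sub>c\<close>-component of the frame field \<open>E\<^sub>i\<close>, with \<open>E\<^sub>1 = v\<close> and \<open>E\<^sub>2 = T v\<close>;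
  \<open>\<theta> c i\<close> is the \<open>dx\<^sup>c\<close>-component of the \<open>i\<close>-th form of the dual coframe.\<close>

definition E :: "2 \<Rightarrow> 2 \<Rightarrow> real^2 \<Rightarrow> real" where
  "E i c x = (if i = 1 then v $ c else \<Sum>b\<in>UNIV. v $ b * T x b c)"

definition frame_det :: "real^2 \<Rightarrow> real" where
  "frame_det x = E 1 1 x * E 2 2 x - E 1 2 x * E 2 1 x"

definition \<theta> :: "2 \<Rightarrow> 2 \<Rightarrow> real^2 \<Rightarrow> real" where
  "\<theta> c i x = (if c = 1 then (if i = 1 then E 2 2 x else - E 1 2 x)
    else (if i = 1 then - E 2 1 x else E 1 1 x)) / frame_det x"

lemma frame_det: "x \<in> U \<Longrightarrow> frame_det x \<noteq> 0"
  using v_generic by (simp add: frame_det_def E_def)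

lemmas base_sm = smooth_on_const smooth_on_add[OF open_base] smooth_on_mult[OF open_base]
  smooth_on_minus[OF open_base] smooth_on_diff[OF open_base] smooth_on_sum[OF open_base]
  smooth_on_partial

lemma smooth_E: "smooth_on (E i c) U"
proof -
  have "smooth_on (\<lambda>x. \<Sum>b\<in>UNIV. v $ b * T x b c) U" by (intro base_sm smooth_T)
  then show ?thesis by (cases "i = 1") (simp_all add: E_def[abs_def] smooth_on_const)
qed

lemma smooth_\<theta>: "smooth_on (\<theta> c i) U"
proof -
  have "smooth_on (\<lambda>x. F x / frame_det x) U" if "smooth_on F U" for F
    unfolding frame_det_def
    by (intro smooth_on_divide[OF open_base] that base_sm smooth_E) (use frame_det in \<open>simp add: frame_det_def\<close>)
  from this[OF smooth_E] this[OF smooth_on_minus[OF open_base smooth_E]] show ?thesis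
    by (cases "c = 1"; cases "i = 1") (simp_all add: \<theta>_def[abs_def])
qed

sublocale base: frame_connection U E \<theta> D
proof
  fix x and s t :: 2
  assume x: "x \<in> U"
  have "s = 1 \<or> s = 2" "t = 1 \<or> t = 2" using exhaust_2 by auto
  then show "(\<Sum>r\<in>UNIV. E s r x * \<theta> r t x) = (if s = t then 1 else 0)"
    "(\<Sum>r\<in>UNIV. \<theta> s r x * E r t x) = (if s = t then 1 else 0)"
    using frame_det[OF x]
    by (auto simp: sum_2 \<theta>_def two_neq_one frame_det_def divide_simps)
qed (fact open_base smooth_E smooth_\<theta> smooth_D)+

definition ca :: "2 \<Rightarrow> real^2 \<Rightarrow> real" where "ca i = base.\<gamma> i 1 1"
definition cb :: "2 \<Rightarrow> real^2 \<Rightarrow> real" where "cb i = base.\<gamma> i 1 2"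

lemma T_E:
  assumes "x \<in> U"
  shows "(\<Sum>b\<in>UNIV. E 1 b x * T x b c) = E 2 c x" "(\<Sum>b\<in>UNIV. E 2 b x * T x b c) = 0"
proof -
  show "(\<Sum>b\<in>UNIV. E 1 b x * T x b c) = E 2 c x" by (simp add: E_def two_neq_one)
  have "(\<Sum>b\<in>UNIV. E 2 b x * T x b c) = (\<Sum>a\<in>UNIV. v $ a * (\<Sum>b\<in>UNIV. T x a b * T x b c))"
    by (simp add: E_def two_neq_one sum_2 algebra_simps)
  then show "(\<Sum>b\<in>UNIV. E 2 b x * T x b c) = 0" by (simp add: T_nilpotent[OF assms])
qed

text \<open>As \<open>T\<close> is parallel, \<open>D E_2 = D (T E_1) = T (D E_1)\<close>, and
  \<open>T\<close> maps \<open>a E_1 + b E_2\<close> to \<open>a E_2\<close>.\<close>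

lemma base_\<gamma>:
  assumes x: "x \<in> U"
  shows "base.\<gamma> i 1 1 x = ca i x" "base.\<gamma> i 1 2 x = cb i x"
    "base.\<gamma> i 2 1 x = 0" "base.\<gamma> i 2 2 x = ca i x"
proof -
  show "base.\<gamma> i 1 1 x = ca i x" "base.\<gamma> i 1 2 x = cb i x" by (simp_all add: ca_def cb_def)
  have par: "partial e (\<lambda>z. T z b d) x = (\<Sum>f\<in>UNIV. D x e b f * T x f d - D x e f d * T x b f)" for e b d
    using T_parallel[OF x, of e b d] unfolding cov_deriv_11_def
    by (simp add: sum_subtractf algebra_simps)
  have "base.X i (E 2 d) x = (\<Sum>e\<in>UNIV. E i e x * (\<Sum>b\<in>UNIV. v $ b * partial e (\<lambda>z. T z b d) x))" for d
  proof -
    have "base.X i (E 2 d) x = base.X i (\<lambda>z. \<Sum>b\<in>UNIV. v $ b * T z b d) x"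
      by (rule arg_cong[where f = "\<lambda>F. base.X i F x"]) (simp add: E_def fun_eq_iff two_neq_one)
    also have "\<dots> = (\<Sum>b\<in>UNIV. v $ b * base.X i (\<lambda>z. T z b d) x)"
      using x by (simp add: base.X_sum base.X_mult base.X_const base_sm smooth_T)
    finally show ?thesis by (simp add: base.X_def sum_2 algebra_simps)
  qed
  moreover have "base.X i (E 1 d) x = 0" for d
  proof -
    have "E 1 d = (\<lambda>x. v $ d)" by (simp add: E_def fun_eq_iff)
    then show ?thesis by (simp only: base.X_const)
  qed
  ultimately have "(\<Sum>c\<in>UNIV. base.\<gamma> i 2 c x * E c d x) =
      (\<Sum>f\<in>UNIV. (\<Sum>c\<in>UNIV. base.\<gamma> i 1 c x * E c f x) * T x f d)" for d
    unfolding base.\<gamma>_J[OF x] par by (simp add: sum_2 E_def two_neq_one algebra_simps)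
  also have "(\<Sum>f\<in>UNIV. (\<Sum>c\<in>UNIV. base.\<gamma> i 1 c x * E c f x) * T x f d) =
      base.\<gamma> i 1 1 x * (\<Sum>f\<in>UNIV. E 1 f x * T x f d) + base.\<gamma> i 1 2 x * (\<Sum>f\<in>UNIV. E 2 f x * T x f d)" for d
    by (simp add: sum_2 algebra_simps)
  also have "\<dots> d = (\<Sum>c\<in>UNIV. (if c = 2 then ca i x else 0) * E c d x)" for d
    by (simp add: T_E[OF x] sum_2 two_neq_one ca_def)
  finally have "(\<Sum>c\<in>UNIV. base.\<gamma> i 2 c x * E c d x) = (\<Sum>c\<in>UNIV. (if c = 2 then ca i x else 0) * E c d x)" for d .
  from base.J_cancel[OF x this] show "base.\<gamma> i 2 1 x = 0" "base.\<gamma> i 2 2 x = ca i x"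
    by (simp_all add: two_neq_one)
qed

lemma base_bracket:
  assumes x: "x \<in> U"
  shows "base.bracket i j k x = base.\<gamma> i j k x - base.\<gamma> j i k x"
  by (rule base.\<gamma>_torsion_free[OF x D_sym[OF x], symmetric])

lemma base_X_E:
  assumes x: "x \<in> U"
  shows "base.X i (E j d) x = (\<Sum>k\<in>UNIV. base.\<gamma> i j k x * E k d x) -
    (\<Sum>e\<in>UNIV. \<Sum>f\<in>UNIV. E i e x * E j f x * D x e f d)"
  using base.\<gamma>_J[OF x, of i j d] by simp

definition \<phi> :: "2 \<Rightarrow> 2 \<Rightarrow> real^2 \<Rightarrow> real" where
  "\<phi> i j x = (\<Sum>a\<in>UNIV. \<Sum>b\<in>UNIV. E i a x * E j b x * \<Phi> x a b)"

text \<open>\<open>R(E\<^sub>1, E\<^sub>2) E\<^sub>1 = A E\<^sub>1 + B E\<^sub>2\<close>.\<close>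

definition cA :: "real^2 \<Rightarrow> real" where
  "cA x = base.X 1 (ca 2) x - base.X 2 (ca 1) x + cb 2 x * ca 2 x"

definition cB :: "real^2 \<Rightarrow> real" where
  "cB x = base.X 1 (cb 2) x - base.X 2 (cb 1) x + ca 2 x * cb 1 x - (ca 1 x - cb 2 x) * cb 2 x"

text \<open>\<open>S1\<close> and \<open>S2\<close> are the parts of the vertical components \<open>P\<close> and \<open>Q\<close> of
  \<open>[X\<^bsub>Inl 1\<^esub>, X\<^bsub>Inl 2\<^esub>]\<close> that are constant along the fibres.\<close>

definition S1 :: "real^2 \<Rightarrow> real" where
  "S1 x = 2 * ca 1 x * \<phi> 1 2 x - ca 2 x * \<phi> 1 1 x + cb 1 x * \<phi> 2 2 x / 2 - cb 2 x * \<phi> 1 2 x +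
    base.X 2 (\<phi> 1 1) x / 2 - base.X 1 (\<phi> 1 2) x"

definition S2 :: "real^2 \<Rightarrow> real" where
  "S2 x = ca 1 x * \<phi> 2 2 x - cb 2 x * \<phi> 2 2 x / 2 - base.X 1 (\<phi> 2 2) x / 2"

lemma smooth_ca: "smooth_on (ca i) U" and smooth_cb: "smooth_on (cb i) U"
  unfolding ca_def cb_def by (rule base.smooth_\<gamma>)+

lemma smooth_\<phi>: "smooth_on (\<phi> i j) U"
  unfolding \<phi>_def[abs_def] by (intro base_sm smooth_E smooth_\<Phi>)

lemma smooth_cA: "smooth_on cA U" and smooth_cB: "smooth_on cB U"
  unfolding cA_def[abs_def] cB_def[abs_def] by (intro base_sm smooth_ca smooth_cb base.smooth_X)+

lemma smooth_S1: "smooth_on S1 U" and smooth_S2: "smooth_on S2 U"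
  unfolding S1_def[abs_def] S2_def[abs_def] divide_inverse
  by (intro base_sm smooth_ca smooth_cb smooth_\<phi> base.smooth_X)+

section \<open>The adapted frame of the cotangent bundle\<close>

abbreviation total :: "(real^(2 + 2)) set" where "total \<equiv> base_part -` U"

definition u :: "2 \<Rightarrow> real^(2 + 2) \<Rightarrow> real" where
  "u j y = (\<Sum>c\<in>UNIV. y $ Inr c * lift (E j c) y)"

text \<open>Constancy of the metric fixes only the symmetric part:
  \<open>corr i j + corr j i\<close> must cancel \<open>\<tau> i * \<tau> j + \<phi> i j\<close>,
  where \<open>\<tau> 1 = u 2\<close> and \<open>\<tau> 2 = 0\<close> are the values of iota T on
  the lifts. Placing the whole mixed part on the second field is a choice; it keeps the derivative
  of \<open>u 2\<close> along the first field free of \<open>\<Phi>\<close>.\<close>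

definition corr :: "2 \<Rightarrow> 2 \<Rightarrow> real^(2 + 2) \<Rightarrow> real" where
  "corr i j y = (if i = 1 then (if j = 1 then - ((u 2 y * u 2 y + lift (\<phi> 1 1) y) / 2) else 0)
    else if j = 1 then - lift (\<phi> 1 2) y else - (lift (\<phi> 2 2) y / 2))"

text \<open>\<open>X\<^bsub>Inl i\<^esub>\<close> is the horizontal lift of \<open>E\<^sub>i\<close> corrected by vertical vectors so that the
  metric becomes constant in the frame; \<open>X\<^bsub>Inr i\<^esub>\<close> is the vertical lift of the dual form.\<close>

definition J :: "2 + 2 \<Rightarrow> 2 + 2 \<Rightarrow> real^(2 + 2) \<Rightarrow> real" where
  "J s t y = (case (s, t) of
      (Inl i, Inl c) \<Rightarrow> lift (E i c) y
    | (Inl i, Inr c) \<Rightarrow> (\<Sum>a\<in>UNIV. \<Sum>d\<in>UNIV. lift (E i a) y * lift (\<lambda>x. D x a c d) y * y $ Inr d) +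
        (\<Sum>j\<in>UNIV. corr i j y * lift (\<theta> c j) y)
    | (Inr i, Inl c) \<Rightarrow> 0
    | (Inr i, Inr c) \<Rightarrow> lift (\<theta> c i) y)"

text \<open>The inverse of a block triangular matrix: \<open>J\<close> has diagonal blocks
  \<open>E\<close> and \<open>\<theta>^T\<close> and corner \<open>N\<close>, so the inverse has
  \<open>\<theta>\<close>, \<open>E^T\<close> and corner \<open>- \<theta> N E^T\<close>.\<close>

definition K :: "2 + 2 \<Rightarrow> 2 + 2 \<Rightarrow> real^(2 + 2) \<Rightarrow> real" where
  "K s t y = (case (s, t) of
      (Inl c, Inl i) \<Rightarrow> lift (\<theta> c i) y
    | (Inl c, Inr j) \<Rightarrow> - (\<Sum>i\<in>UNIV. lift (\<theta> c i) y * (\<Sum>b\<in>UNIV. J (Inl i) (Inr b) y * lift (E j b) y))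
    | (Inr c, Inl i) \<Rightarrow> 0
    | (Inr c, Inr j) \<Rightarrow> lift (E j c) y)"

text \<open>A single chart is considered here, so the chart index of \<open>cotangent_metric\<close>
  is instantiated with the unit type.\<close>

definition G :: "(2 + 2) metric" where
  "G = cotangent_metric (\<lambda>_::unit. D) (\<lambda>_. \<Phi>) (\<lambda>_. T) ()"

definition \<eta> :: "2 + 2 \<Rightarrow> 2 + 2 \<Rightarrow> real" where
  "\<eta> s t = (case (s, t) of (Inl a, Inr b) \<Rightarrow> (if a = b then 1 else 0)
    | (Inr a, Inl b) \<Rightarrow> (if a = b then 1 else 0) | _ \<Rightarrow> 0)"

lemma open_total: "open total"
  using bounded_linear_base_part open_base
  by (intro open_vimage) (auto intro: linear_continuous_on)

lemmas total_sm = smooth_on_const smooth_on_add[OF open_total] smooth_on_mult[OF open_total]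
  smooth_on_minus[OF open_total] smooth_on_diff[OF open_total] smooth_on_sum[OF open_total]
  smooth_on_divide_const[OF open_total] smooth_on_partial smooth_coordinate smooth_lift[OF open_base]

lemma smooth_u: "smooth_on (u j) total"
  unfolding u_def[abs_def] by (intro total_sm smooth_E)

lemma smooth_corr: "smooth_on (corr i j) total"
  by (cases "i = 1"; cases "j = 1")
    (auto simp: corr_def[abs_def] intro!: total_sm smooth_u smooth_\<phi>)

lemma smooth_J: "smooth_on (J s t) total"
  by (cases s; cases t)
    (auto simp: J_def[abs_def] intro!: total_sm smooth_corr smooth_E smooth_\<theta> smooth_D)

lemma smooth_K: "smooth_on (K s t) total"
  by (cases s; cases t)
    (auto simp: K_def[abs_def] intro!: total_sm smooth_J smooth_E smooth_\<theta> simp del: sum_2)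

lemma J_simps:
  "J (Inl i) (Inl c) y = lift (E i c) y"
  "J (Inl i) (Inr c) y = (\<Sum>a\<in>UNIV. \<Sum>d\<in>UNIV. lift (E i a) y * lift (\<lambda>x. D x a c d) y * y $ Inr d) +
        (\<Sum>j\<in>UNIV. corr i j y * lift (\<theta> c j) y)"
  "J (Inr i) (Inl c) y = 0" "J (Inr i) (Inr c) y = lift (\<theta> c i) y"
  by (simp_all add: J_def)

lemma lift_E_\<theta>:
  assumes "y \<in> total"
  shows "(\<Sum>c\<in>UNIV. lift (E i c) y * lift (\<theta> c j) y) = (if i = j then 1 else 0)"
    "(\<Sum>c\<in>UNIV. lift (\<theta> c j) y * lift (E i c) y) = (if i = j then 1 else 0)"
  using assms base.JK[of "base_part y" i j] by (simp_all add: lift_def mult.commute)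

lemma J_Inr_E:
  assumes y: "y \<in> total"
  shows "(\<Sum>b\<in>UNIV. J (Inl i) (Inr b) y * lift (E j b) y) =
    (\<Sum>b\<in>UNIV. \<Sum>a\<in>UNIV. \<Sum>d\<in>UNIV. lift (E i a) y * lift (E j b) y * lift (\<lambda>x. D x a b d) y * y $ Inr d) +
    corr i j y"
proof -
  have "(\<Sum>b\<in>UNIV. (\<Sum>k\<in>UNIV. corr i k y * lift (\<theta> b k) y) * lift (E j b) y) =
      (\<Sum>k\<in>UNIV. corr i k y * (\<Sum>b\<in>UNIV. lift (\<theta> b k) y * lift (E j b) y))"
    unfolding sum_distrib_left sum_distrib_right by (subst sum.swap) (simp add: mult.assoc)
  also have "\<dots> = corr i j y"
    by (simp add: lift_E_\<theta>[OF y] if_distrib[of "\<lambda>x. _ * x"] cong: if_cong)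
  finally have c: "(\<Sum>b\<in>UNIV. (\<Sum>k\<in>UNIV. corr i k y * lift (\<theta> b k) y) * lift (E j b) y) = corr i j y" .
  show ?thesis
    unfolding J_simps distrib_right sum.distrib c by (simp add: sum_distrib_left sum_distrib_right mult_ac)
qed

lemma JK:
  assumes y: "y \<in> total"
  shows "(\<Sum>r\<in>UNIV. J s r y * K r t y) = (if s = t then 1 else 0)"
proof -
  have cancel: "(\<Sum>c\<in>UNIV. lift (E i c) y * (\<Sum>k\<in>UNIV. lift (\<theta> c k) y * F k)) = F i" for i F
  proof -
    have "(\<Sum>c\<in>UNIV. lift (E i c) y * (\<Sum>k\<in>UNIV. lift (\<theta> c k) y * F k)) =
        (\<Sum>k\<in>UNIV. (\<Sum>c\<in>UNIV. lift (E i c) y * lift (\<theta> c k) y) * F k)"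
      unfolding sum_distrib_left sum_distrib_right by (subst sum.swap) (simp add: mult.assoc)
    then show ?thesis by (simp add: lift_E_\<theta>[OF y] if_distrib[of "\<lambda>x. x * _"] cong: if_cong)
  qed
  show ?thesis
  proof (cases s; cases t)
    fix i j assume "s = Inl i" "t = Inl j"
    then show ?thesis by (simp add: sum_UNIV_Plus K_def J_def lift_E_\<theta>[OF y])
  next
    fix i j assume st: "s = Inl i" "t = Inr j"
    show ?thesis unfolding st sum_UNIV_Plus
      using cancel[of i "\<lambda>i. \<Sum>b\<in>UNIV. J (Inl i) (Inr b) y * lift (E j b) y"]
      by (simp add: K_def J_def[of "Inl i" "Inl c" for c] sum_negf)
  next
    fix i j assume "s = Inr i" "t = Inl j"
    then show ?thesis by (simp add: sum_UNIV_Plus K_def J_def)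
  next
    fix i j assume "s = Inr i" "t = Inr j"
    then show ?thesis by (auto simp add: sum_UNIV_Plus K_def J_def lift_E_\<theta>[OF y])
  qed
qed

lemma KJ:
  assumes y: "y \<in> total"
  shows "(\<Sum>r\<in>UNIV. K s r y * J r t y) = (if s = t then 1 else 0)"
proof -
  have "(\<chi> a b. J a b y) ** (\<chi> a b. K a b y) = (mat 1 :: real^(2+2)^(2+2))"
    by (simp add: vec_eq_iff matrix_matrix_mult_def mat_def JK[OF y])
  then have "(\<chi> a b. K a b y) ** (\<chi> a b. J a b y) = (mat 1 :: real^(2+2)^(2+2))"
    using matrix_left_right_inverse by blast
  then show ?thesis by (simp add: vec_eq_iff matrix_matrix_mult_def mat_def)
qed

lemma G_simps:
  "G y (Inl a) (Inl b) = (\<Sum>r\<in>UNIV. \<Sum>s\<in>UNIV. y $ Inr r * y $ Inr s *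
      (lift (\<lambda>x. T x a r) y * lift (\<lambda>x. T x b s) y + lift (\<lambda>x. T x b r) y * lift (\<lambda>x. T x a s) y)) / 2
      - 2 * (\<Sum>k\<in>UNIV. y $ Inr k * lift (\<lambda>x. D x a b k) y) + lift (\<lambda>x. \<Phi> x a b) y"
  "G y (Inl a) (Inr b) = (if a = b then 1 else 0)" "G y (Inr a) (Inl b) = (if a = b then 1 else 0)"
  "G y (Inr a) (Inr b) = 0"
  by (simp_all add: G_def cotangent_metric_def Let_def lift_def fibre_part_def)

lemma smooth_G: "smooth_on (\<lambda>y. G y s t) total"
  by (cases s; cases t)
    (auto simp: G_simps intro!: total_sm smooth_T smooth_D smooth_\<Phi>)

lemma G_sym: "y \<in> total \<Longrightarrow> G y s t = G y t s"
proof (cases s; cases t)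
  fix a b assume y: "y \<in> total" and st: "s = Inl a" "t = Inl b"
  have "D (base_part y) a b k = D (base_part y) b a k" for k using y by (intro D_sym) simp
  moreover have "\<Phi> (base_part y) a b = \<Phi> (base_part y) b a" using y by (intro \<Phi>_sym) simp
  ultimately show ?thesis unfolding st G_simps by (simp only: lift_def add.commute)
qed (auto simp: G_simps)

lemma frame_G:
  assumes y: "y \<in> total"
  shows "(\<Sum>c\<in>UNIV. \<Sum>d\<in>UNIV. J s c y * J t d y * G y c d) = \<eta> s t"
proof -
  \<comment> \<open>\<open>H\<close> collects the Christoffel terms. It enters with factor -2 from
    the metric and once from each mixed block, and these cancel because \<open>H\<close> is
    symmetric for a torsion free connection.\<close>
  define H where "H i j = (\<Sum>b\<in>UNIV. \<Sum>a\<in>UNIV. \<Sum>d\<in>UNIV.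
    lift (E i a) y * lift (E j b) y * lift (\<lambda>x. D x a b d) y * y $ Inr d)" for i j
  define \<tau> where "\<tau> i = (\<Sum>r\<in>UNIV. y $ Inr r * (\<Sum>a\<in>UNIV. lift (E i a) y * lift (\<lambda>x. T x a r) y))" for i
  have x: "base_part y \<in> U" using y by simp
  have \<tau>: "\<tau> 1 = u 2 y" "\<tau> 2 = 0"
    using T_E[OF x] by (simp_all add: \<tau>_def u_def lift_def)
  have D: "D (base_part y) 2 1 k = D (base_part y) 1 2 k" for k
    by (rule D_sym[OF x])
  have "\<Phi> (base_part y) 2 1 = \<Phi> (base_part y) 1 2"
    by (rule \<Phi>_sym[OF x])
  then have \<phi>: "lift (\<phi> 2 1) y = lift (\<phi> 1 2) y"
    by (simp add: \<phi>_def lift_def sum_2 algebra_simps)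
  have H_sym: "H i j = H j i" for i j
    by (simp add: H_def sum_2 lift_def D algebra_simps)
  have main: "(\<Sum>a\<in>UNIV. \<Sum>b\<in>UNIV. lift (E i a) y * lift (E j b) y * G y (Inl a) (Inl b)) =
      \<tau> i * \<tau> j - 2 * H i j + lift (\<phi> i j) y" for i j
    by (simp add: G_simps sum_2 \<phi>_def \<tau>_def H_def lift_def field_simps)
  have c1: "(\<Sum>a\<in>UNIV. \<Sum>b\<in>UNIV. F a * F' b * (if a = b then 1 else 0)) = (\<Sum>a\<in>UNIV. F a * F' a)"
    for F F' :: "2 \<Rightarrow> real"
    by (simp add: if_distrib[of "\<lambda>x. _ * x"] cong: if_cong)
  have mixed: "(\<Sum>a\<in>UNIV. lift (E i a) y * J (Inl j) (Inr a) y) = H i j + corr j i y"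
    "(\<Sum>a\<in>UNIV. J (Inl i) (Inr a) y * lift (E j a) y) = H i j + corr i j y" for i j
    using J_Inr_E[OF y, of j i] J_Inr_E[OF y, of i j] H_sym[of j i]
    by (simp_all add: H_def mult.commute)
  show ?thesis
  proof (cases s; cases t)
    fix i j assume st: "s = Inl i" "t = Inl j"
    have "(\<Sum>c\<in>UNIV. \<Sum>d\<in>UNIV. J s c y * J t d y * G y c d) =
        \<tau> i * \<tau> j - 2 * H i j + lift (\<phi> i j) y + (H i j + corr j i y) + (H i j + corr i j y)"
      unfolding st sum_UNIV_Plus sum.distrib
      by (simp only: J_simps(1) main) (simp add: G_simps(2-4) c1 mixed)
    moreover have "i = 1 \<or> i = 2" "j = 1 \<or> j = 2" using exhaust_2 by auto
    ultimately show ?thesis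
      unfolding st by (auto simp: \<eta>_def corr_def two_neq_one \<tau> \<phi> power2_eq_square)
  next
    fix i j assume st: "s = Inl i" "t = Inr j"
    show ?thesis unfolding st sum_UNIV_Plus sum.distrib
      by (simp add: J_simps(1,3,4) G_simps(2-4) c1 lift_E_\<theta>[OF y] \<eta>_def)
  next
    fix i j assume st: "s = Inr i" "t = Inl j"
    show ?thesis unfolding st sum_UNIV_Plus sum.distrib
      by (simp add: J_simps(1,3,4) G_simps(2-4) c1 lift_E_\<theta>[OF y] \<eta>_def)
  next
    fix i j assume st: "s = Inr i" "t = Inr j"
    show ?thesis unfolding st sum_UNIV_Plus sum.distrib
      by (simp add: J_simps(3,4) G_simps(4) \<eta>_def)
  qed
qed

lemma \<eta>_involution: "(\<Sum>r\<in>UNIV. \<eta> s r * \<eta> r t) = (if s = t then 1 else 0)"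
  by (cases s; cases t)
    (auto simp: sum_UNIV_Plus \<eta>_def if_distrib[of "\<lambda>x. _ * x"] if_distrib[of "\<lambda>x. x * _"] cong: if_cong)

sublocale frame_metric total J K G \<eta> \<eta>
proof
  show "\<eta> s t = \<eta> t s" for s t
    by (cases s; cases t) (auto simp: \<eta>_def)
qed (fact open_total smooth_J smooth_K JK KJ smooth_G G_sym frame_G \<eta>_involution)+

section \<open>Derivatives of the fibre functions and brackets of the frame\<close>

lemma X_lift:
  assumes "y \<in> total" "smooth_on F U"
  shows "X (Inl i) (lift F) y = lift (base.X i F) y" "X (Inr i) (lift F) y = 0"
proof -
  have "F differentiable (at (base_part y))"
    using smooth_on_differentiable assms by blast
  then show "X (Inl i) (lift F) y = lift (base.X i F) y" "X (Inr i) (lift F) y = 0"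
    by (simp_all add: X_def base.X_def sum_UNIV_Plus partial_lift J_simps lift_def)
qed

lemma X_u_gen:
  assumes y: "y \<in> total"
  shows "X s (u j) y = (\<Sum>c\<in>UNIV. J s (Inr c) y * lift (E j c) y) +
    (\<Sum>c\<in>UNIV. y $ Inr c * X s (lift (E j c)) y)"
proof -
  have "X s (\<lambda>y. y $ t) y = J s t y" for t
    by (simp add: X_def partial_coordinate if_distrib[of "\<lambda>x. _ * x"] cong: if_cong)
  then show ?thesis
    unfolding u_def[abs_def] using y
    by (simp add: X_sum X_mult total_sm smooth_E sum.distrib)
qed

text \<open>Along a horizontal lift the function iota \<open>E_j\<close> changes by iota of the
  covariant derivative of \<open>E_j\<close>; the vertical correction adds
  \<open>corr i j\<close>.\<close>

lemma X_Inl_u: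
  assumes y: "y \<in> total"
  shows "X (Inl i) (u j) y = (\<Sum>k\<in>UNIV. lift (base.\<gamma> i j k) y * u k y) + corr i j y"
proof -
  have x: "base_part y \<in> U" using y by simp
  show ?thesis
    unfolding X_u_gen[OF y] J_Inr_E[OF y] X_lift(1)[OF y smooth_E]
    by (simp add: lift_def base_X_E[OF x] u_def sum_2 algebra_simps)
qed

lemma X_u:
  assumes y: "y \<in> total"
  shows "X (Inl 1) (u 1) y = lift (ca 1) y * u 1 y + lift (cb 1) y * u 2 y - (u 2 y * u 2 y + lift (\<phi> 1 1) y) / 2"
    "X (Inl 2) (u 1) y = lift (ca 2) y * u 1 y + lift (cb 2) y * u 2 y - lift (\<phi> 1 2) y"
    "X (Inl 1) (u 2) y = lift (ca 1) y * u 2 y"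
    "X (Inl 2) (u 2) y = lift (ca 2) y * u 2 y - lift (\<phi> 2 2) y / 2"
    "X (Inr 1) (u 1) y = 1" "X (Inr 2) (u 1) y = 0" "X (Inr 1) (u 2) y = 0" "X (Inr 2) (u 2) y = 1"
proof -
  have x: "base_part y \<in> U" using y by simp
  show "X (Inl 1) (u 1) y = lift (ca 1) y * u 1 y + lift (cb 1) y * u 2 y - (u 2 y * u 2 y + lift (\<phi> 1 1) y) / 2"
    "X (Inl 2) (u 1) y = lift (ca 2) y * u 1 y + lift (cb 2) y * u 2 y - lift (\<phi> 1 2) y"
    "X (Inl 1) (u 2) y = lift (ca 1) y * u 2 y"
    "X (Inl 2) (u 2) y = lift (ca 2) y * u 2 y - lift (\<phi> 2 2) y / 2"
    by (simp_all add: X_Inl_u[OF y] sum_2 lift_def base_\<gamma>[OF x] corr_def two_neq_one)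
  have "X (Inr i) (u j) y = (if i = j then 1 else 0)" for i j
    using lift_E_\<theta>(2)[OF y, of i j] by (auto simp: X_u_gen[OF y] J_simps X_lift(2)[OF y smooth_E])
  then show "X (Inr 1) (u 1) y = 1" "X (Inr 2) (u 1) y = 0" "X (Inr 1) (u 2) y = 0" "X (Inr 2) (u 2) y = 1"
    by (simp_all add: two_neq_one)
qed

text \<open>A value at one point cannot be differentiated further, so the formulas of
  \<open>X_u\<close> are inserted under the outer derivative as identities on all of
  \<open>total\<close>.\<close>

lemma X_X_u:
  assumes y: "y \<in> total"
  shows "X s (X (Inl 1) (u 1)) y =
      X s (\<lambda>y. lift (ca 1) y * u 1 y + lift (cb 1) y * u 2 y - (u 2 y * u 2 y + lift (\<phi> 1 1) y) / 2) y"
    "X s (X (Inl 2) (u 1)) y = X s (\<lambda>y. lift (ca 2) y * u 1 y + lift (cb 2) y * u 2 y - lift (\<phi> 1 2) y) y"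
    "X s (X (Inl 1) (u 2)) y = X s (\<lambda>y. lift (ca 1) y * u 2 y) y"
    "X s (X (Inl 2) (u 2)) y = X s (\<lambda>y. lift (ca 2) y * u 2 y - lift (\<phi> 2 2) y / 2) y"
    "X s (X (Inr i) (u j)) y = 0"
proof -
  have "X s (X (Inr i) (u j)) y = X s (\<lambda>z. if i = j then 1 else 0) y"
    by (rule X_cong[OF _ y]) (use X_u exhaust_2[of i] exhaust_2[of j] in \<open>auto simp: two_neq_one\<close>)
  then show "X s (X (Inr i) (u j)) y = 0" by (simp add: X_const)
qed (rule X_cong[OF _ y], erule X_u)+

lemma partial_u: "y \<in> total \<Longrightarrow> partial (Inr c) (u j) y = lift (E j c) y"
proof -
  assume y: "y \<in> total"
  have d: "E j c differentiable (at (base_part y))" for c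
    using smooth_on_differentiable[OF smooth_E] y by blast
  show ?thesis
    unfolding u_def[abs_def] using y
    by (simp add: partial_sum_U partial_mult_U total_sm smooth_E partial_coordinate partial_lift[OF d]
        if_distrib[of "\<lambda>x. x * _"] cong: if_cong)
qed

text \<open>A vector field is determined by its action on the functions \<open>x\<^sup>c\<close> and \<open>u j\<close>.\<close>

lemma bracketI:
  assumes y: "y \<in> total"
    and base_eq: "\<And>c. X s (J t (Inl c)) y - X t (J s (Inl c)) y = (\<Sum>r\<in>UNIV. tab r * J r (Inl c) y)"
    and fibre_eq: "\<And>j. X s (X t (u j)) y - X t (X s (u j)) y = (\<Sum>r\<in>UNIV. tab r * X r (u j) y)"
  shows "bracket s t r y = tab r"
proof -
  define W where "W d = X s (J t d) y - X t (J s d) y - (\<Sum>r\<in>UNIV. tab r * J r d y)" for d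
  have W_Inl: "W (Inl c) = 0" for c
    using base_eq[of c] by (simp add: W_def)
  have "(\<Sum>c\<in>UNIV. E j c (base_part y) * W (Inr c)) = 0" for j
  proof -
    have "(\<Sum>d\<in>UNIV. (\<Sum>r\<in>UNIV. tab r * J r d y) * partial d (u j) y) = (\<Sum>r\<in>UNIV. tab r * X r (u j) y)"
      unfolding X_def sum_distrib_left sum_distrib_right by (subst sum.swap) (simp add: mult.assoc)
    then have "(\<Sum>d\<in>UNIV. W d * partial d (u j) y) = 0"
      using fibre_eq[of j] unfolding X_commute[OF y smooth_u]
      by (simp add: W_def left_diff_distrib sum_subtractf)
    then show ?thesis
      by (simp add: sum_UNIV_Plus W_Inl partial_u[OF y] lift_def mult.commute)
  qed
  then have "W (Inr c) = 0" for c
    using base.covector_zeroI[of "base_part y" "\<lambda>c. W (Inr c)"] y by simp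
  with W_Inl have "W d = 0" for d
    by (cases d) simp_all
  then have "X s (J t d) y - X t (J s d) y = (\<Sum>r\<in>UNIV. tab r * J r d y)" for d
    by (simp add: W_def)
  then show ?thesis
    unfolding bracket_def by (simp add: sum_JK[OF y])
qed

lemma X_J_Inl:
  assumes y: "y \<in> total"
  shows "X s (J (Inl i) (Inl c)) y = X s (lift (E i c)) y" "X s (J (Inr i) (Inl c)) y = 0"
  using X_cong[of "J (Inl i) (Inl c)" "lift (E i c)" y s] X_cong[of "J (Inr i) (Inl c)" "\<lambda>_. 0" y s] y
  by (simp_all add: J_simps X_const)

lemmas sm_total = total_sm smooth_u smooth_ca smooth_cb smooth_\<phi> smooth_cA smooth_cB smooth_S1 smooth_S2
  base.smooth_X smooth_E base_sm

lemmas X_rules = X_add X_mult X_minus X_diff X_const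

lemma X_divide_const: "y \<in> total \<Longrightarrow> smooth_on F total \<Longrightarrow> X s (\<lambda>z. F z / c) y = X s F y / c"
  unfolding divide_inverse by (simp add: X_mult X_const smooth_on_const)

text \<open>The curvature terms here and in \<open>Q\<close> are iota of
  \<open>R(E_1, E_2) E_1\<close> and of \<open>R(E_1, E_2) E_2 = cA E_2\<close>, the latter because
  curvature commutes with a parallel \<open>T\<close>. The product of \<open>\<phi> 2 2\<close> and
  \<open>u 2\<close> arises from differentiating the square of \<open>u 2\<close> along the second
  field; terms quadratic in \<open>u 2\<close> cancel.\<close>

definition P :: "real^(2 + 2) \<Rightarrow> real" where
  "P y = lift cA y * u 1 y + lift cB y * u 2 y + lift S1 y - lift (\<phi> 2 2) y * u 2 y / 2"

definition Q :: "real^(2 + 2) \<Rightarrow> real" where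
  "Q y = lift cA y * u 2 y + lift S2 y"

lemma bracket_horizontal:
  assumes y: "y \<in> total"
  shows "bracket (Inl 1) (Inl 2) r y = (case r of Inl i \<Rightarrow> if i = 1 then - lift (ca 2) y else lift (ca 1) y - lift (cb 2) y
    | Inr i \<Rightarrow> if i = 1 then P y else Q y)"
proof (rule bracketI[OF y])
  have x: "base_part y \<in> U" using y by simp
  fix c
  have "base.X 1 (E 2 c) (base_part y) - base.X 2 (E 1 c) (base_part y) =
      - ca 2 (base_part y) * E 1 c (base_part y) + (ca 1 (base_part y) - cb 2 (base_part y)) * E 2 c (base_part y)"
    unfolding base.bracket_J[OF x, symmetric] by (simp add: base_bracket[OF x] base_\<gamma>[OF x] sum_2)
  then show "X (Inl 1) (J (Inl 2) (Inl c)) y - X (Inl 2) (J (Inl 1) (Inl c)) y =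
    (\<Sum>r\<in>UNIV. (case r of Inl i \<Rightarrow> if i = 1 then - lift (ca 2) y else lift (ca 1) y - lift (cb 2) y
    | Inr i \<Rightarrow> if i = 1 then P y else Q y) * J r (Inl c) y)"
    using X_lift[OF y smooth_E]
    by (simp add: X_J_Inl[OF y] J_simps sum_UNIV_Plus sum_2 two_neq_one lift_def)
next
  fix j :: 2
  consider "j = 1" | "j = 2" using exhaust_2 by auto
  then show "X (Inl 1) (X (Inl 2) (u j)) y - X (Inl 2) (X (Inl 1) (u j)) y =
    (\<Sum>r\<in>UNIV. (case r of Inl i \<Rightarrow> if i = 1 then - lift (ca 2) y else lift (ca 1) y - lift (cb 2) y
    | Inr i \<Rightarrow> if i = 1 then P y else Q y) * X r (u j) y)"
    by cases (use y in \<open>simp_all add: X_X_u X_rules X_divide_const sm_total X_u X_lift P_def Q_def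
      sum_UNIV_Plus sum_2 two_neq_one\<close>, simp_all add: lift_def cA_def cB_def S1_def S2_def field_simps)
qed

lemma bracket_vertical:
  assumes y: "y \<in> total"
  shows "bracket (Inl 1) (Inr 1) r y = (if r = Inr 1 then - lift (ca 1) y else 0)"
    "bracket (Inl 1) (Inr 2) r y = (if r = Inr 1 then u 2 y - lift (cb 1) y else if r = Inr 2 then - lift (ca 1) y else 0)"
    "bracket (Inl 2) (Inr 1) r y = (if r = Inr 1 then - lift (ca 2) y else 0)"
    "bracket (Inl 2) (Inr 2) r y = (if r = Inr 1 then - lift (cb 2) y else if r = Inr 2 then - lift (ca 2) y else 0)"
    "bracket (Inr i) (Inr j) r y = 0"
proof -
  have b: "X s (J (Inr i) (Inl c)) y - X (Inr i) (J s (Inl c)) y = 0" for s i c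
    using X_lift[OF y smooth_E] by (cases s) (simp_all add: X_J_Inl[OF y])
  \<comment> \<open>A vertical field differentiates every \<open>u j\<close> to a constant, so one
    of the two second derivatives in the commutator drops out.\<close>
  have vertical: "bracket s (Inr i) r y = tab r"
    if "\<forall>c. (\<Sum>r\<in>UNIV. tab r * J r (Inl c) y) = 0"
      and "\<forall>j. - X (Inr i) (X s (u j)) y = (\<Sum>r\<in>UNIV. tab r * X r (u j) y)" for s i tab
    by (rule bracketI[OF y]) (simp_all add: b X_X_u(5)[OF y] that)
  show "bracket (Inl 1) (Inr 1) r y = (if r = Inr 1 then - lift (ca 1) y else 0)"
    "bracket (Inl 1) (Inr 2) r y = (if r = Inr 1 then u 2 y - lift (cb 1) y else if r = Inr 2 then - lift (ca 1) y else 0)"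
    "bracket (Inl 2) (Inr 1) r y = (if r = Inr 1 then - lift (ca 2) y else 0)"
    "bracket (Inl 2) (Inr 2) r y = (if r = Inr 1 then - lift (cb 2) y else if r = Inr 2 then - lift (ca 2) y else 0)"
    by (rule vertical; use y in \<open>simp add: forall_2 X_X_u X_rules X_divide_const sm_total X_u X_lift
      sum_UNIV_Plus sum_2 two_neq_one J_simps\<close>)+
  show "bracket (Inr i) (Inr j) r y = 0"
    by (rule vertical) (simp_all add: X_X_u[OF y])
qed

text \<open>With all indices lowered the connection coefficients are skew in the last two indices, and the
  curvature in both pairs; both are tabulated in the following basis of two-forms.\<close>

definition \<epsilon> :: "2 + 2 \<Rightarrow> 2 + 2 \<Rightarrow> 2 + 2 \<Rightarrow> 2 + 2 \<Rightarrow> real" where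
  "\<epsilon> i j a b = (if a = i \<and> b = j then 1 else if a = j \<and> b = i then - 1 else 0)"

text \<open>The metric pairs \<open>Inl i\<close> with \<open>Inr i\<close> only, so raising or
  lowering an index amounts to this exchange.\<close>

definition dual :: "2 + 2 \<Rightarrow> 2 + 2" where
  "dual s = (case s of Inl i \<Rightarrow> Inr i | Inr i \<Rightarrow> Inl i)"

definition conn :: "2 + 2 \<Rightarrow> 2 + 2 \<Rightarrow> 2 + 2 \<Rightarrow> real^(2 + 2) \<Rightarrow> real" where
  "conn a b c y = (case a of Inr i \<Rightarrow> 0 | Inl i \<Rightarrow>
     lift (ca i) y * (\<epsilon> (Inl 1) (Inr 1) b c + \<epsilon> (Inl 2) (Inr 2) b c) +
     (if i = 1 then lift (cb 1) y - u 2 y else lift (cb 2) y) * \<epsilon> (Inl 1) (Inr 2) b c -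
     (if i = 1 then P y else Q y) * \<epsilon> (Inl 1) (Inl 2) b c)"

lemma bracket_skew: "bracket s t r y = - bracket t s r y"
  by (simp add: bracket_def sum_negf[symmetric] minus_mult_left)

lemma bracket_self: "bracket s s r y = 0"
  by (simp add: bracket_def)

lemma \<eta>_dual: "\<eta> s t = (if t = dual s then 1 else 0)"
  by (cases s; cases t) (auto simp: \<eta>_def dual_def)

lemma sum_\<eta>: "(\<Sum>e\<in>UNIV. F e * \<eta> e c) = F (dual c)" "(\<Sum>e\<in>UNIV. \<eta> c e * F e) = F (dual c)"
proof -
  have "c = dual e \<longleftrightarrow> e = dual c" for e by (cases e; cases c) (auto simp: dual_def)
  then show "(\<Sum>e\<in>UNIV. F e * \<eta> e c) = F (dual c)" "(\<Sum>e\<in>UNIV. \<eta> c e * F e) = F (dual c)"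
    by (simp_all add: \<eta>_dual if_distrib[of "\<lambda>x. _ * x"] if_distrib[of "\<lambda>x. x * _"] cong: if_cong)
qed

lemma dual_simps: "dual (Inl i) = Inr i" "dual (Inr i) = Inl i" "dual (dual s) = s"
  by (simp_all add: dual_def split: sum.split)

lemma \<gamma>_conn:
  assumes y: "y \<in> total"
  shows "\<gamma> a b c y = conn a b (dual c) y"
proof -
  \<comment> \<open>Since \<open>\<eta>\<close> permutes the indices, each pairing in Koszul's
    formula is a single bracket component. The 64 index triples are checked one by one.\<close>
  have "\<forall>a b c. (bracket a b (dual c) y - bracket b c (dual a) y + bracket c a (dual b) y) / 2 = conn a b c y"
    unfolding forall_22
    by (simp add: conn_def dual_simps \<epsilon>_def bracket_horizontal[OF y] bracket_vertical[OF y] two_neq_one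
        bracket_skew[of "Inl 2" "Inl 1"] bracket_skew[of "Inr _" "Inl _"] bracket_self)
  then have "(bracket a b c y - bracket b (dual c) (dual a) y + bracket (dual c) a (dual b) y) / 2 =
      conn a b (dual c) y"
    by (metis dual_simps(3))
  then show ?thesis
    using koszul[OF y, of a b "dual c"] by (simp add: sum_\<eta> dual_simps)
qed

end

section \<open>Curvature and Bach tensor in the adapted frame\<close>

context nilpotent_structure
begin

text \<open>\<open>\<Omega>\<close> is the component \<open>R(X\<^bsub>Inl 1\<^esub>, X\<^bsub>Inl 2\<^esub>, X\<^bsub>Inl 1\<^esub>, X\<^bsub>Inl 2\<^esub>)\<close> of the curvature, up to
  symmetry the only one that involves second derivatives of \<open>\<Phi>\<close>.\<close>

definition \<Omega> :: "real^(2 + 2) \<Rightarrow> real" where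
  "\<Omega> y = (lift (base.X 2 cA) y - 2 * lift cA y * lift (ca 2) y) * u 1 y +
    (2 * lift cA y * lift (ca 1) y - lift (base.X 1 cA) y - 2 * lift cB y * lift (ca 2) y +
      lift (base.X 2 cB) y + lift (ca 2) y * lift (\<phi> 2 2) y - lift (base.X 2 (\<phi> 2 2)) y / 2) * u 2 y -
    lift cA y * lift (\<phi> 1 2) y - lift cB y * lift (\<phi> 2 2) y / 2 - 3 * lift S1 y * lift (ca 2) y +
    lift (base.X 2 S1) y + 3 * lift S2 y * lift (ca 1) y - lift S2 y * lift (cb 2) y -
    lift (base.X 1 S2) y + lift (\<phi> 2 2) y * lift (\<phi> 2 2) y / 4"

text \<open>The last entry, with coefficient 1, is up to sign the vertical derivative of the summand
  \<open>- u 2\<close> in \<open>conn\<close>; it is the trace that the square of iota T leaves in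
  the Weyl tensor.\<close>

definition weyl_table :: "2 + 2 \<Rightarrow> 2 + 2 \<Rightarrow> 2 + 2 \<Rightarrow> 2 + 2 \<Rightarrow> real^(2 + 2) \<Rightarrow> real" where
  "weyl_table a b c d y =
    \<Omega> y * (\<epsilon> (Inl 1) (Inl 2) a b * \<epsilon> (Inl 1) (Inl 2) c d) +
    lift cA y *
     (\<epsilon> (Inl 1) (Inl 2) a b * \<epsilon> (Inl 1) (Inr 1) c d + \<epsilon> (Inl 1) (Inr 1) a b * \<epsilon> (Inl 1) (Inl 2) c d +
      \<epsilon> (Inl 1) (Inl 2) a b * \<epsilon> (Inl 2) (Inr 2) c d + \<epsilon> (Inl 2) (Inr 2) a b * \<epsilon> (Inl 1) (Inl 2) c d) +
    \<epsilon> (Inl 1) (Inr 2) a b * \<epsilon> (Inl 1) (Inr 2) c d"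

text \<open>The added coefficient is minus one half of the only Ricci component, the one on
  \<open>(Inl 1, Inl 1)\<close>.\<close>

definition curv_table :: "2 + 2 \<Rightarrow> 2 + 2 \<Rightarrow> 2 + 2 \<Rightarrow> 2 + 2 \<Rightarrow> real^(2 + 2) \<Rightarrow> real" where
  "curv_table a b c d y = weyl_table a b c d y + (lift cB y - lift (\<phi> 2 2) y / 2) *
     (\<epsilon> (Inl 1) (Inl 2) a b * \<epsilon> (Inl 1) (Inr 2) c d + \<epsilon> (Inl 1) (Inr 2) a b * \<epsilon> (Inl 1) (Inl 2) c d)"

lemma smooth_P: "smooth_on P total" and smooth_Q: "smooth_on Q total" and smooth_\<Omega>: "smooth_on \<Omega> total"
  unfolding P_def[abs_def] Q_def[abs_def] \<Omega>_def[abs_def] by (intro sm_total)+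

text \<open>Two derivatives are eliminated in favour of \<open>cA\<close> and \<open>cB\<close>, so
  that expressions for the same curvature acquire one normal form and can be compared as
  polynomials.\<close>

lemma structure_equations:
  "lift (base.X 1 (ca 2)) y = lift cA y + lift (base.X 2 (ca 1)) y - lift (cb 2) y * lift (ca 2) y"
  "lift (base.X 1 (cb 2)) y = lift cB y + lift (base.X 2 (cb 1)) y - lift (ca 2) y * lift (cb 1) y +
    (lift (ca 1) y - lift (cb 2) y) * lift (cb 2) y"
  by (simp_all add: lift_def cA_def cB_def)

lemma X_PQ:
  assumes y: "y \<in> total"
  shows "X s P y = X s (\<lambda>y. lift cA y * u 1 y + lift cB y * u 2 y + lift S1 y - lift (\<phi> 2 2) y * u 2 y / 2) y"
   "X s Q y = X s (\<lambda>y. lift cA y * u 2 y + lift S2 y) y"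
  by (simp_all add: P_def[abs_def] Q_def[abs_def])

lemma X_\<gamma>: "y \<in> total \<Longrightarrow> X s (\<gamma> a b c) y = X s (conn a b (dual c)) y"
  by (rule X_cong[OF \<gamma>_conn])

lemmas frame_simps = conn_def[abs_def] dual_simps \<epsilon>_def two_neq_one sum_UNIV_Plus sum_2
  bracket_horizontal bracket_vertical curv_table_def weyl_table_def[abs_def] X_rules X_divide_const X_u X_lift
  sm_total smooth_P smooth_Q smooth_\<Omega>

lemma frame_curv_horizontal:
  assumes y: "y \<in> total"
  shows "\<forall>c d. frame_curv (Inl 1) (Inl 2) c d y = curv_table (Inl 1) (Inl 2) c (dual d) y"
  unfolding forall_22 frame_curv_def X_\<gamma>[OF y] \<gamma>_conn[OF y]
  by (intro conjI; use y in \<open>simp add: frame_simps X_PQ\<close>)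
    (simp_all add: P_def Q_def \<Omega>_def structure_equations field_simps)

lemma frame_curv_mixed:
  assumes y: "y \<in> total"
  shows "\<forall>c d. frame_curv (Inl 1) (Inr 1) c d y = curv_table (Inl 1) (Inr 1) c (dual d) y"
    "\<forall>c d. frame_curv (Inl 1) (Inr 2) c d y = curv_table (Inl 1) (Inr 2) c (dual d) y"
    "\<forall>c d. frame_curv (Inl 2) (Inr 1) c d y = curv_table (Inl 2) (Inr 1) c (dual d) y"
    "\<forall>c d. frame_curv (Inl 2) (Inr 2) c d y = curv_table (Inl 2) (Inr 2) c (dual d) y"
    "\<forall>c d. frame_curv (Inr i) (Inr j) c d y = curv_table (Inr i) (Inr j) c (dual d) y"
  unfolding forall_22 frame_curv_def X_\<gamma>[OF y] \<gamma>_conn[OF y]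
  by (intro conjI; use y in \<open>simp add: frame_simps X_PQ; simp add: algebra_simps\<close>)+

lemma frame_curv_skew: "frame_curv a b c d y = - frame_curv b a c d y"
proof -
  have "(\<Sum>e\<in>UNIV. bracket a b e y * \<gamma> e c d y) = - (\<Sum>e\<in>UNIV. bracket b a e y * \<gamma> e c d y)"
    unfolding sum_negf[symmetric] by (subst bracket_skew) simp
  then show ?thesis by (simp add: frame_curv_def sum_subtractf)
qed

lemma \<epsilon>_skew: "\<epsilon> i j b a = - \<epsilon> i j a b" if "i \<noteq> j"
  using that by (auto simp: \<epsilon>_def)

text \<open>Both sides are skew in the first pair of indices, so the pairs already computed
  suffice.\<close>

lemma frame_curv_table:
  assumes y: "y \<in> total"
  shows "frame_curv a b c d y = curv_table a b c (dual d) y"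
proof -
  have skew: "curv_table a b c (dual d) y = - curv_table b a c (dual d) y" for a b
    by (simp add: curv_table_def weyl_table_def \<epsilon>_skew[of _ _ a b] two_neq_one algebra_simps)
  have swap: "frame_curv a b c d y = curv_table a b c (dual d) y"
    if "frame_curv b a c d y = curv_table b a c (dual d) y" for a b
    using that frame_curv_skew[of a b c d y] skew[of a b] by simp
  have same: "frame_curv a a c d y = curv_table a a c (dual d) y" for a
    using frame_curv_skew[of a a c d y] skew[of a a] by simp
  have "\<forall>a b. frame_curv a b c d y = curv_table a b c (dual d) y"
    unfolding forall_22
    using frame_curv_horizontal[OF y] frame_curv_mixed[OF y] by (auto intro: swap same)
  then show ?thesis by blast
qed

section \<open>Ricci, Weyl and Bach tensors of the cotangent metric\<close>

lemma frame_ric_table: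
  assumes y: "y \<in> total"
  shows "frame_ric b c y = (if b = Inl 1 \<and> c = Inl 1 then lift (\<phi> 2 2) y - 2 * lift cB y else 0)"
proof -
  have "\<forall>b c. frame_ric b c y = (if b = Inl 1 \<and> c = Inl 1 then lift (\<phi> 2 2) y - 2 * lift cB y else 0)"
    unfolding forall_22 frame_ric_def frame_curv_table[OF y]
    by (simp add: sum_UNIV_Plus sum_2 dual_simps curv_table_def weyl_table_def \<epsilon>_def two_neq_one)
  then show ?thesis by blast
qed

lemma frame_weyl_table:
  assumes y: "y \<in> total"
  shows "frame_weyl a b c d y = weyl_table a b c d y"
proof -
  \<comment> \<open>The only Ricci component sits on \<open>(Inl 1, Inl 1)\<close>, where the
    inverse metric is 0. In dimension 4 the divisor \<open>n - 2\<close> of the Weyl tensor is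
    2.\<close>
  have "frame_scalar y = 0"
    by (simp add: frame_scalar_def sum_\<eta> frame_ric_table[OF y] sum_UNIV_Plus sum_2 dual_simps
        \<eta>_dual two_neq_one)
  moreover have "\<forall>a b c d. curv_table a b c d y = weyl_table a b c d y +
    (\<eta> a d * frame_ric b c y + \<eta> b c * frame_ric a d y
      - \<eta> a c * frame_ric b d y - \<eta> b d * frame_ric a c y) / 2"
    unfolding forall_22
    by (simp add: curv_table_def \<epsilon>_def frame_ric_table[OF y] \<eta>_dual dual_simps two_neq_one field_simps)
  ultimately show ?thesis
    by (simp add: frame_weyl_def sum_\<eta> frame_curv_table[OF y] dual_simps card_UNIV_sum)
qed

text \<open>In the divergence \<open>\<Omega>\<close> occurs with a horizontal last index, which is
  contracted with a vertical derivative. Hence only vertical derivatives of \<open>\<Omega>\<close>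
  are tabulated.\<close>

lemma X_\<Omega>:
  assumes y: "y \<in> total"
  shows "X (Inr 1) \<Omega> y = lift (base.X 2 cA) y - 2 * lift cA y * lift (ca 2) y"
    "X (Inr 2) \<Omega> y = 2 * lift cA y * lift (ca 1) y - lift (base.X 1 cA) y - 2 * lift cB y * lift (ca 2) y +
      lift (base.X 2 cB) y + lift (ca 2) y * lift (\<phi> 2 2) y - lift (base.X 2 (\<phi> 2 2)) y / 2"
  unfolding \<Omega>_def[abs_def] using y
  by (simp_all add: X_rules X_divide_const X_u X_lift sm_total)

lemma X_weyl_table: "y \<in> total \<Longrightarrow> X s (frame_weyl a b c d) y = X s (weyl_table a b c d) y"
  by (rule X_cong[OF frame_weyl_table])

text \<open>This is minus one half of the covariant derivative of the Ricci tensor along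
  \<open>X (Inl 2)\<close>, evaluated on \<open>(Inl 1, Inl 1)\<close>, as the contracted Bianchi
  identity predicts.\<close>

definition div_weyl :: "real^2 \<Rightarrow> real" where
  "div_weyl x = base.X 2 cB x - 2 * cB x * ca 2 x + ca 2 x * \<phi> 2 2 x - base.X 2 (\<phi> 2 2) x / 2"

lemma frame_div_weyl_table:
  assumes y: "y \<in> total"
  shows "frame_div_weyl k a b y =
    (if b = Inl 1 then lift div_weyl y * \<epsilon> (Inl 1) (Inl 2) k a else 0)"
proof -
  have "\<forall>k a b. (\<Sum>l\<in>UNIV. frame_weyl_deriv (dual l) k a b l y) =
    (if b = Inl 1 then lift div_weyl y * \<epsilon> (Inl 1) (Inl 2) k a else 0)"
    unfolding forall_22 frame_weyl_deriv_def X_weyl_table[OF y] \<gamma>_conn[OF y] frame_weyl_table[OF y]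
    by (intro conjI; use y in \<open>simp add: frame_simps X_\<Omega>\<close>)
      (simp_all add: lift_def div_weyl_def field_simps)
  then show ?thesis by (simp add: frame_div_weyl_def sum_\<eta>)
qed

lemma smooth_div_weyl: "smooth_on div_weyl U"
  unfolding div_weyl_def[abs_def] divide_inverse
  by (intro base_sm smooth_ca smooth_cB smooth_\<phi> base.smooth_X)

text \<open>Every term vanishes separately. The divergence has horizontal indices only. If
  \<open>k\<close> is horizontal, the contracted derivative is vertical: along it the component is
  constant and all \<open>\<gamma>\<close> vanish. If \<open>k\<close> is vertical, the connection
  does not turn it into a horizontal index. In the Ricci term only \<open>k = l = Inr 1\<close>
  could contribute, and the Weyl tensor is 0 there.\<close>

lemma frame_bach_zero:
  assumes y: "y \<in> total"
  shows "frame_bach a b y = 0"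
proof -
  have X: "X p (frame_div_weyl k a b) y =
      X p (\<lambda>y. if b = Inl 1 then lift div_weyl y * \<epsilon> (Inl 1) (Inl 2) k a else 0) y" for p k a b
    by (rule X_cong[OF frame_div_weyl_table y])
  have "\<forall>a b. (\<Sum>k\<in>UNIV. X (dual k) (frame_div_weyl k a b) y -
      ((\<Sum>e\<in>UNIV. \<gamma> (dual k) k e y * frame_div_weyl e a b y) + (\<Sum>e\<in>UNIV. \<gamma> (dual k) a e y * frame_div_weyl k e b y) +
       (\<Sum>e\<in>UNIV. \<gamma> (dual k) b e y * frame_div_weyl k a e y)) +
      (\<Sum>l\<in>UNIV. frame_ric (dual k) (dual l) y * frame_weyl k a b l y / 2)) = 0"
    unfolding forall_22 X frame_div_weyl_table[OF y] \<gamma>_conn[OF y] frame_weyl_table[OF y] frame_ric_table[OF y]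
    by (intro conjI; use y in \<open>simp add: frame_simps smooth_div_weyl\<close>)
  then show ?thesis unfolding frame_bach_def sum_\<eta> by blast
qed

lemma bach_zero:
  assumes y: "y \<in> total"
  shows "bach G y i j = 0"
proof (rule coordinate_zeroI[OF y])
  show "(\<Sum>i\<in>UNIV. \<Sum>j\<in>UNIV. J a i y * J b j y * bach G y i j) = 0" for a b
    unfolding frame_bach[OF y] by (rule frame_bach_zero[OF y])
qed

end

section \<open>The soliton equation\<close>

lemma (in frame_connection) frame_hessian:
  assumes y: "y \<in> U" and F: "smooth_on F U"
  shows "(\<Sum>i\<in>UNIV. \<Sum>j\<in>UNIV. J a i y * J b j y * hessian \<Gamma> F y i j) =
    X a (X b F) y - (\<Sum>e\<in>UNIV. \<gamma> a b e y * X e F y)"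
proof -
  have X: "fr z [b] (differential F z) = X b F z" for b z
    by (simp add: differential_def X_def)
  have "fr y (a # [b]) (cov_deriv \<Gamma> (differential F) y) =
      X a (\<lambda>z. fr z [b] (differential F z)) y -
      conn_term (\<lambda>a b c. \<gamma> a b c y) a [b] (\<lambda>bs. fr y bs (differential F y))"
    by (rule frame_cov_deriv[OF y]) (simp add: differential_def[abs_def] sm F)
  also have "\<dots> = X a (X b F) y - (\<Sum>e\<in>UNIV. \<gamma> a b e y * X e F y)"
    by (simp only: X conn_term_Cons conn_term_Nil add_0_right)
  finally show ?thesis by (simp add: hessian_def sum_distrib_left mult.assoc)
qed

definition bundle_point :: "real^'n \<Rightarrow> real^'n \<Rightarrow> real^('n::finite + 'n)" where
  "bundle_point x \<xi> = (\<chi> s. case s of Inl a \<Rightarrow> x $ a | Inr a \<Rightarrow> \<xi> $ a)"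

lemma bundle_point: "base_part (bundle_point x \<xi>) = x" "bundle_point x \<xi> $ Inr a = \<xi> $ a"
  by (simp_all add: base_part_def bundle_point_def)

context nilpotent_structure
begin

text \<open>The mixed components are opposite, so the symmetric part is supported on
  \<open>(E_1, E_1)\<close>. Its value \<open>- cB\<close> explains the factor 2 in front of the
  symmetric Ricci tensor: the bundle contributes \<open>- 2 * cB\<close>.\<close>

lemma base_frame_ric:
  assumes x: "x \<in> U"
  shows "base.frame_ric 1 1 x = - cB x" "base.frame_ric 1 2 x = - cA x"
    "base.frame_ric 2 1 x = cA x" "base.frame_ric 2 2 x = 0"
proof -
  have X\<gamma>: "base.X s (base.\<gamma> i 1 1) x = base.X s (ca i) x" "base.X s (base.\<gamma> i 1 2) x = base.X s (cb i) x"
    "base.X s (base.\<gamma> i 2 1) x = 0" "base.X s (base.\<gamma> i 2 2) x = base.X s (ca i) x" for s i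
    using base.X_cong[OF base_\<gamma>(1) x] base.X_cong[OF base_\<gamma>(2) x]
      base.X_cong[OF base_\<gamma>(3) x] base.X_cong[OF base_\<gamma>(4) x] by (simp_all add: base.X_const)
  show "base.frame_ric 1 1 x = - cB x" "base.frame_ric 1 2 x = - cA x"
    "base.frame_ric 2 1 x = cA x" "base.frame_ric 2 2 x = 0"
    by (simp_all add: base.frame_ric_def base.frame_curv_def sum_2 X\<gamma> base_bracket[OF x] base_\<gamma>[OF x]
        cA_def cB_def algebra_simps)
qed

definition soliton_defect :: "(real^2 \<Rightarrow> real) \<Rightarrow> real \<Rightarrow> real^(2 + 2) \<Rightarrow> 2 + 2 \<Rightarrow> 2 + 2 \<Rightarrow> real" where
  "soliton_defect H lam y i j =
    hessian (levi_civita G) (lift H) y i j + metric_ricci G y i j - lam * G y i j"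

definition frame_soliton :: "(real^2 \<Rightarrow> real) \<Rightarrow> real \<Rightarrow> 2 + 2 \<Rightarrow> 2 + 2 \<Rightarrow> real^(2 + 2) \<Rightarrow> real" where
  "frame_soliton H lam a b y = X a (X b (lift H)) y - (\<Sum>e\<in>UNIV. \<gamma> a b e y * X e (lift H) y) +
    frame_ric a b y - lam * \<eta> a b"

lemma frame_soliton_defect:
  assumes y: "y \<in> total" and H: "smooth_on H U"
  shows "(\<Sum>i\<in>UNIV. \<Sum>j\<in>UNIV. J a i y * J b j y * soliton_defect H lam y i j) =
    frame_soliton H lam a b y"
proof -
  have "(\<Sum>i\<in>UNIV. \<Sum>j\<in>UNIV. J a i y * J b j y * soliton_defect H lam y i j) =
      (\<Sum>i\<in>UNIV. \<Sum>j\<in>UNIV. J a i y * J b j y * hessian (levi_civita G) (lift H) y i j) +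
      (\<Sum>i\<in>UNIV. \<Sum>j\<in>UNIV. J a i y * J b j y * ricci (levi_civita G) y i j) -
      lam * (\<Sum>i\<in>UNIV. \<Sum>j\<in>UNIV. J a i y * J b j y * G y i j)"
    by (simp add: soliton_defect_def metric_ricci_def distrib_left right_diff_distrib sum.distrib
        sum_subtractf sum_distrib_left mult.left_commute)
  then show ?thesis
    unfolding frame_hessian[OF y smooth_lift[OF open_base H]] frame_ric_J[OF y, symmetric] frame_G[OF y]
      frame_soliton_def .
qed

lemma X_X_lift:
  assumes y: "y \<in> total" and H: "smooth_on H U"
  shows "X s (X (Inl i) (lift H)) y = X s (lift (base.X i H)) y" "X s (X (Inr i) (lift H)) y = 0"
proof -
  show "X s (X (Inl i) (lift H)) y = X s (lift (base.X i H)) y"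
    by (rule X_cong[OF X_lift(1)[OF _ H] y])
  have "X s (X (Inr i) (lift H)) y = X s (\<lambda>_. 0) y"
    by (rule X_cong[OF X_lift(2)[OF _ H] y])
  then show "X s (X (Inr i) (lift H)) y = 0" by (simp add: X_const)
qed

text \<open>\<open>u 2\<close> enters only through the connection coefficient
  \<open>cb 1 - u 2\<close>. On mixed indices neither the Hessian of a pulled back function nor the
  Ricci tensor has a component, which leaves \<open>lam\<close> alone.\<close>

lemma frame_soliton_table:
  assumes y: "y \<in> total" and H: "smooth_on H U"
  shows "frame_soliton H lam (Inl 1) (Inl 1) y = lift (base.X 1 (base.X 1 H)) y - lift (ca 1) y * lift (base.X 1 H) y -
      (lift (cb 1) y - u 2 y) * lift (base.X 2 H) y + lift (\<phi> 2 2) y - 2 * lift cB y"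
    "frame_soliton H lam (Inl 1) (Inl 2) y = lift (base.X 1 (base.X 2 H)) y - lift (ca 1) y * lift (base.X 2 H) y"
    "frame_soliton H lam (Inl 2) (Inl 1) y = lift (base.X 2 (base.X 1 H)) y - lift (ca 2) y * lift (base.X 1 H) y -
      lift (cb 2) y * lift (base.X 2 H) y"
    "frame_soliton H lam (Inl 2) (Inl 2) y = lift (base.X 2 (base.X 2 H)) y - lift (ca 2) y * lift (base.X 2 H) y"
    "frame_soliton H lam (Inl i) (Inr j) y = - (if i = j then lam else 0)"
    "frame_soliton H lam (Inr i) (Inl j) y = - (if i = j then lam else 0)"
    "frame_soliton H lam (Inr i) (Inr j) y = 0"
proof -
  note simps = frame_soliton_def X_X_lift[OF y H] X_lift[OF y H] X_lift[OF y base.smooth_X[OF H]]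
    \<gamma>_conn[OF y] frame_ric_table[OF y] sum_UNIV_Plus sum_2 conn_def \<epsilon>_def dual_simps two_neq_one \<eta>_def
  show "frame_soliton H lam (Inl 1) (Inl 1) y = lift (base.X 1 (base.X 1 H)) y - lift (ca 1) y * lift (base.X 1 H) y -
      (lift (cb 1) y - u 2 y) * lift (base.X 2 H) y + lift (\<phi> 2 2) y - 2 * lift cB y"
    "frame_soliton H lam (Inl 1) (Inl 2) y = lift (base.X 1 (base.X 2 H)) y - lift (ca 1) y * lift (base.X 2 H) y"
    "frame_soliton H lam (Inl 2) (Inl 1) y = lift (base.X 2 (base.X 1 H)) y - lift (ca 2) y * lift (base.X 1 H) y -
      lift (cb 2) y * lift (base.X 2 H) y"
    "frame_soliton H lam (Inl 2) (Inl 2) y = lift (base.X 2 (base.X 2 H)) y - lift (ca 2) y * lift (base.X 2 H) y"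
    "frame_soliton H lam (Inl i) (Inr j) y = - (if i = j then lam else 0)"
    "frame_soliton H lam (Inr i) (Inl j) y = - (if i = j then lam else 0)"
    "frame_soliton H lam (Inr i) (Inr j) y = 0"
    by (simp_all add: simps)
qed

text \<open>As \<open>E_2\<close> spans the kernel of \<open>T\<close>, the first equation is
  \<open>dh(ker T) = 0\<close>. Given it, the second is the \<open>(E_1, E_1)\<close> component of
  the equation for \<open>\<Phi>\<close>, where \<open>- 2 * cB\<close> is twice the symmetric Ricci
  tensor.\<close>

definition reduced_equations :: "(real^2 \<Rightarrow> real) \<Rightarrow> real^2 \<Rightarrow> bool" where
  "reduced_equations H x \<longleftrightarrow> base.X 2 H x = 0 \<and>
    base.X 1 (base.X 1 H) x - ca 1 x * base.X 1 H x + \<phi> 2 2 x - 2 * cB x = 0"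

text \<open>Differentiating \<open>dh(E_2) = 0\<close> and using the bracket of \<open>E_1\<close>
  and \<open>E_2\<close> makes every Hessian component except \<open>(E_1, E_1)\<close> vanish, both
  on the surface and on the bundle.\<close>

lemma base_hessian_reduced:
  assumes x: "x \<in> U" and H: "smooth_on H U" and ker: "\<And>z. z \<in> U \<Longrightarrow> base.X 2 H z = 0"
  shows "base.X i (base.X 2 H) x = 0" "base.X 2 (base.X 1 H) x = ca 2 x * base.X 1 H x"
proof -
  show *: "base.X i (base.X 2 H) x = 0" for i
  proof -
    have "base.X i (base.X 2 H) x = base.X i (\<lambda>_. 0) x" by (rule base.X_cong[OF ker x])
    then show ?thesis by (simp add: base.X_const)
  qed
  show "base.X 2 (base.X 1 H) x = ca 2 x * base.X 1 H x"
    using base.X_bracket[OF x H, of 2 1] * ker[OF x]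
    by (simp add: sum_2 base_bracket[OF x] base_\<gamma>[OF x])
qed

lemma soliton_imp_reduced:
  assumes H: "smooth_on H U" and x: "x \<in> U"
    and sol: "\<And>y i j. y \<in> total \<Longrightarrow> soliton_defect H lam y i j = 0"
  shows "lam = 0" "reduced_equations H x"
proof -
  have S: "frame_soliton H lam a b y = 0"
    if "y \<in> total" for a b y
    using frame_soliton_defect[OF that H, of a b lam] sol[OF that] by simp
  define y where "y \<xi> = bundle_point x \<xi>" for \<xi>
  have y: "y \<xi> \<in> total" for \<xi> using x by (simp add: y_def bundle_point)
  show "lam = 0"
    using S[OF y, of "Inl 1" "Inr 1"] unfolding frame_soliton_table(5)[OF y H] by simp
  define c where "c = base.X 1 (base.X 1 H) x - ca 1 x * base.X 1 H x - cb 1 x * base.X 2 H x + \<phi> 2 2 x - 2 * cB x"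
  have eq: "c + u 2 (y \<xi>) * base.X 2 H x = 0" for \<xi>
    using S[OF y, of "Inl 1" "Inl 1"] unfolding frame_soliton_table(1)[OF y H]
    by (simp add: c_def lift_def y_def bundle_point algebra_simps)
  have u: "u 2 (y \<xi>) = (\<Sum>c\<in>UNIV. \<xi> $ c * E 2 c x)" for \<xi>
    by (simp add: u_def y_def bundle_point lift_def)
  \<comment> \<open>An affine function on the fibre: the zero covector isolates its constant term.
    The second dual form, on which \<open>u 2\<close> is 1, then isolates the slope.\<close>
  have "c = 0" using eq[of 0] by (simp add: u)
  moreover have "u 2 (y (\<chi> c. \<theta> c 2 x)) = 1"
    using base.JK[OF x, of 2 2] by (simp add: u mult.commute)
  ultimately have "base.X 2 H x = 0" using eq[of "\<chi> c. \<theta> c 2 x"] by simp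
  with \<open>c = 0\<close> show "reduced_equations H x" by (simp add: reduced_equations_def c_def)
qed

lemma reduced_imp_soliton:
  assumes H: "smooth_on H U" and red: "\<And>x. x \<in> U \<Longrightarrow> reduced_equations H x" and y: "y \<in> total"
  shows "soliton_defect H 0 y i j = 0"
proof (rule coordinate_zeroI[OF y])
  have x: "base_part y \<in> U" using y by simp
  have ker: "base.X 2 H z = 0" if "z \<in> U" for z using red[OF that] by (simp add: reduced_equations_def)
  have "\<forall>a b. frame_soliton H 0 a b y = 0"
    unfolding forall_22 frame_soliton_table[OF y H]
    using red[OF x] ker[OF x] base_hessian_reduced[OF x H ker] by (simp add: lift_def reduced_equations_def)
  then show "(\<Sum>i\<in>UNIV. \<Sum>j\<in>UNIV. J a i y * J b j y * soliton_defect H 0 y i j) = 0" for a b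
    unfolding frame_soliton_defect[OF y H] by blast
qed

text \<open>\<open>E_2 = T E_1\<close> spans the kernel: \<open>T\<close> maps
  \<open>k_1 E_1 + k_2 E_2\<close> to \<open>k_1 E_2\<close>.\<close>

lemma ker_condition:
  assumes x: "x \<in> U"
  shows "(\<forall>w :: real^2. (\<forall>b. (\<Sum>a\<in>UNIV. w $ a * T x a b) = 0) \<longrightarrow> (\<Sum>a\<in>UNIV. w $ a * partial a H x) = 0)
    \<longleftrightarrow> base.X 2 H x = 0"
proof
  assume *: "\<forall>w :: real^2. (\<forall>b. (\<Sum>a\<in>UNIV. w $ a * T x a b) = 0) \<longrightarrow> (\<Sum>a\<in>UNIV. w $ a * partial a H x) = 0"
  then show "base.X 2 H x = 0"
    using spec[OF *, of "\<chi> c. E 2 c x"] T_E(2)[OF x] by (simp add: base.X_def)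
next
  assume 2: "base.X 2 H x = 0"
  show "\<forall>w :: real^2. (\<forall>b. (\<Sum>a\<in>UNIV. w $ a * T x a b) = 0) \<longrightarrow> (\<Sum>a\<in>UNIV. w $ a * partial a H x) = 0"
  proof (intro allI impI)
    fix w :: "real^2"
    assume w: "\<forall>b. (\<Sum>a\<in>UNIV. w $ a * T x a b) = 0"
    define k where "k i = (\<Sum>d\<in>UNIV. w $ d * \<theta> d i x)" for i
    have wk: "w $ d = k 1 * E 1 d x + k 2 * E 2 d x" for d
      using base.sum_KJ[OF x, of "\<lambda>d. w $ d" d] by (simp add: k_def sum_2)
    have "k 1 * E 2 b x = 0" for b
    proof -
      have "(\<Sum>a\<in>UNIV. w $ a * T x a b) =
          k 1 * (\<Sum>a\<in>UNIV. E 1 a x * T x a b) + k 2 * (\<Sum>a\<in>UNIV. E 2 a x * T x a b)"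
        by (simp add: wk sum_2 algebra_simps)
      then show ?thesis using w T_E[OF x] by simp
    qed
    moreover have "E 2 1 x \<noteq> 0 \<or> E 2 2 x \<noteq> 0"
      using frame_det[OF x] by (auto simp: frame_det_def)
    ultimately have "k 1 = 0" by auto
    then have "(\<Sum>a\<in>UNIV. w $ a * partial a H x) = k 2 * base.X 2 H x"
      by (simp add: wk base.X_def sum_2 algebra_simps)
    then show "(\<Sum>a\<in>UNIV. w $ a * partial a H x) = 0" using 2 by simp
  qed
qed

definition hat_defect :: "(real^2 \<Rightarrow> real) \<Rightarrow> real^2 \<Rightarrow> 2 \<Rightarrow> 2 \<Rightarrow> real" where
  "hat_defect H x i j = (\<Sum>c\<in>UNIV. \<Sum>d\<in>UNIV. T x i c * T x j d * \<Phi> x c d) +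
    hessian D H x i j + 2 * ricci_sym D x i j"

lemma frame_hat_defect:
  assumes x: "x \<in> U" and H: "smooth_on H U"
  shows "(\<Sum>i\<in>UNIV. \<Sum>j\<in>UNIV. E a i x * E b j x * hat_defect H x i j) =
    (if a = 1 \<and> b = 1 then \<phi> 2 2 x else 0) +
    (base.X a (base.X b H) x - (\<Sum>e\<in>UNIV. base.\<gamma> a b e x * base.X e H x)) +
    (base.frame_ric a b x + base.frame_ric b a x)"
proof -
  \<comment> \<open>\<open>\<tau> a\<close> is \<open>T E_a\<close>, so the hat of
    \<open>\<Phi>\<close> is \<open>\<phi> 2 2\<close> on \<open>(E_1, E_1)\<close> and 0 on the
    other pairs.\<close>
  define \<tau> where "\<tau> a c = (\<Sum>i\<in>UNIV. E a i x * T x i c)" for a c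
  have \<tau>: "\<tau> 1 c = E 2 c x" "\<tau> 2 c = 0" for c
    using T_E[OF x] by (simp_all add: \<tau>_def)
  have "(\<Sum>i\<in>UNIV. \<Sum>j\<in>UNIV. E a i x * E b j x * (\<Sum>c\<in>UNIV. \<Sum>d\<in>UNIV. T x i c * T x j d * \<Phi> x c d)) =
      (\<Sum>c\<in>UNIV. \<Sum>d\<in>UNIV. \<tau> a c * \<tau> b d * \<Phi> x c d)"
    by (simp add: sum_2 \<tau>_def algebra_simps)
  also have "\<dots> = (if a = 1 \<and> b = 1 then \<phi> 2 2 x else 0)"
    using exhaust_2[of a] exhaust_2[of b] by (auto simp: \<tau> \<phi>_def two_neq_one)
  finally have 1: "(\<Sum>i\<in>UNIV. \<Sum>j\<in>UNIV. E a i x * E b j x * (\<Sum>c\<in>UNIV. \<Sum>d\<in>UNIV. T x i c * T x j d * \<Phi> x c d)) = \<dots>" .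
  have 2: "(\<Sum>i\<in>UNIV. \<Sum>j\<in>UNIV. E a i x * E b j x * (2 * ricci_sym D x i j)) =
      base.frame_ric a b x + base.frame_ric b a x"
    by (simp add: base.frame_ric_J[OF x] ricci_sym_def sum_2 field_simps)
  show ?thesis
    by (simp only: hat_defect_def distrib_left sum.distrib 1 2 base.frame_hessian[OF x H])
qed

lemma reduced_iff:
  assumes H: "smooth_on H U"
  shows "(\<forall>x\<in>U. reduced_equations H x) \<longleftrightarrow>
    (\<forall>x\<in>U. base.X 2 H x = 0 \<and> (\<forall>i j. hat_defect H x i j = 0))"
proof (safe)
  fix x assume red: "\<forall>x\<in>U. reduced_equations H x" and x: "x \<in> U"
  show "base.X 2 H x = 0" using red x by (simp add: reduced_equations_def)
  have ker: "base.X 2 H z = 0" if "z \<in> U" for z using red that by (simp add: reduced_equations_def)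
  have "\<forall>a b. (\<Sum>i\<in>UNIV. \<Sum>j\<in>UNIV. E a i x * E b j x * hat_defect H x i j) = 0"
    unfolding frame_hat_defect[OF x H] forall_2
    using red[rule_format, OF x] base_hessian_reduced[OF x H ker]
    by (simp add: sum_2 base_\<gamma>[OF x] base_frame_ric[OF x] reduced_equations_def two_neq_one)
  then have "(\<Sum>i\<in>UNIV. \<Sum>j\<in>UNIV. E a i x * E b j x * hat_defect H x i j) = 0" for a b
    by blast
  then show "hat_defect H x i j = 0" for i j
    by (rule base.coordinate_zeroI[OF x])
next
  fix x assume *: "\<forall>x\<in>U. base.X 2 H x = 0 \<and> (\<forall>i j. hat_defect H x i j = 0)" and x: "x \<in> U"
  then have "(\<Sum>i\<in>UNIV. \<Sum>j\<in>UNIV. E 1 i x * E 1 j x * hat_defect H x i j) = 0" "base.X 2 H x = 0" by simp_all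
  then show "reduced_equations H x"
    unfolding frame_hat_defect[OF x H]
    by (simp add: sum_2 base_\<gamma>[OF x] base_frame_ric[OF x] reduced_equations_def)
qed

section \<open>Gradients of pulled back functions\<close>

lemma gradient_Inl:
  assumes y: "y \<in> total" and H: "smooth_on H U"
  shows "gradient G (lift H) y (Inl a) = 0"
proof -
  have "H differentiable (at (base_part y))"
    using smooth_on_differentiable[OF H] y by blast
  moreover have "metric_inv G y (Inl a) (Inl b) = 0" for b
    by (simp add: metric_inv_frame[OF y] sum_UNIV_Plus J_simps \<eta>_def)
  ultimately show ?thesis by (simp add: gradient_def sum_UNIV_Plus partial_lift)
qed

text \<open>The gradient is vertical, and the fibres are null for the metric.\<close>

lemma gradient_null:
  assumes "y \<in> total" and "smooth_on H U"
  shows "gradient_sqnorm G (lift H) y = 0"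
  by (simp add: gradient_sqnorm_def sum_UNIV_Plus gradient_Inl[OF assms] G_simps(4))

text \<open>Lowering the index of the gradient recovers the differential.\<close>

lemma gradient_zero_imp:
  assumes y: "y \<in> total" and H: "smooth_on H U" and zero: "\<And>a. gradient G (lift H) y a = 0"
  shows "partial c H (base_part y) = 0"
proof -
  have "(\<Sum>a\<in>UNIV. G y s a * gradient G (lift H) y a) = partial s (lift H) y" for s
  proof -
    have "(\<Sum>a\<in>UNIV. G y s a * gradient G (lift H) y a) =
        (\<Sum>b\<in>UNIV. (\<Sum>a\<in>UNIV. G y s a * metric_inv G y a b) * partial b (lift H) y)"
      unfolding gradient_def sum_distrib_left sum_distrib_right by (subst sum.swap) (simp add: mult.assoc)
    then show ?thesis by (simp add: G_metric_inv[OF y] if_distrib[of "\<lambda>x. x * _"] cong: if_cong)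
  qed
  from this[of "Inl c"] have "partial (Inl c) (lift H) y = 0" by (simp add: zero)
  moreover have "H differentiable (at (base_part y))"
    using smooth_on_differentiable[OF H] y by blast
  ultimately show ?thesis by (simp add: partial_lift lift_def)
qed

end

section \<open>Parallel endomorphism fields\<close>

text \<open>Along a ray from the centre a parallel field solves a linear differential equation. The
  sum of squares \<open>w\<close> of its components satisfies \<open>w' \<le> M * w\<close> and
  \<open>w 0 = 0\<close>, so Gronwall's argument with the factor \<open>exp (- (M * t))\<close>
  forces \<open>w\<close> to be 0.\<close>

lemma parallel_zero_on_ball:
  fixes D :: "'n::finite christoffel"
  assumes D: "\<And>a b c. smooth_on (\<lambda>x. D x a b c) (ball x0 r)"
    and T: "\<And>a b. smooth_on (\<lambda>x. T x a b) (ball x0 r)"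
    and par: "\<And>x a b c. x \<in> ball x0 r \<Longrightarrow> cov_deriv_11 D T x a b c = 0"
    and zero: "\<And>a b. T x0 a b = 0"
    and z: "z \<in> ball x0 r"
  shows "T z a b = 0"
proof -
  define v where "v = z - x0"
  have in_ball: "x0 + t *\<^sub>R v \<in> ball x0 r" if "t \<in> {0..1}" for t
  proof -
    have "norm (t *\<^sub>R v) \<le> norm v" using that mult_right_mono[of t 1 "norm v"] by simp
    then show ?thesis using z by (simp add: v_def dist_norm norm_minus_commute)
  qed
  define w where "w t = (\<Sum>a\<in>UNIV. \<Sum>b\<in>UNIV. (T (x0 + t *\<^sub>R v) a b)\<^sup>2)" for t
  define T' where "T' t a b = (\<Sum>e\<in>UNIV. v $ e * partial e (\<lambda>x. T x a b) (x0 + t *\<^sub>R v))" for t a b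
  have dT: "((\<lambda>t. T (x0 + t *\<^sub>R v) a b) has_real_derivative T' t a b) (at t)" if "t \<in> {0..1}" for t a b
    unfolding T'_def
    by (rule has_real_derivative_segment) (rule smooth_on_differentiable[OF T in_ball[OF that]])
  have dw: "(w has_real_derivative (\<Sum>a\<in>UNIV. \<Sum>b\<in>UNIV. 2 * T (x0 + t *\<^sub>R v) a b * T' t a b)) (at t)"
    if "t \<in> {0..1}" for t
    unfolding w_def[abs_def] using dT[OF that]
    by (auto intro!: derivative_eq_intros sum.cong simp: power2_eq_square)
  have cont: "continuous_on {0..1} (\<lambda>t. \<Sum>a\<in>UNIV. \<Sum>b\<in>UNIV. \<Sum>c\<in>UNIV. \<bar>D (x0 + t *\<^sub>R v) a b c\<bar>)"
    using in_ball
    by (intro continuous_intros continuous_on_compose2[OF smooth_on_continuous[OF D]]) auto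
  obtain C where C: "\<And>t. t \<in> {0..1} \<Longrightarrow> (\<Sum>a\<in>UNIV. \<Sum>b\<in>UNIV. \<Sum>c\<in>UNIV. \<bar>D (x0 + t *\<^sub>R v) a b c\<bar>) \<le> C"
    using continuous_attains_sup[OF compact_Icc _ cont] by force
  have DC: "\<bar>D (x0 + t *\<^sub>R v) a b c\<bar> \<le> C" if "t \<in> {0..1}" for t a b c
  proof -
    have "\<bar>D (x0 + t *\<^sub>R v) a b c\<bar> \<le> (\<Sum>c\<in>UNIV. \<bar>D (x0 + t *\<^sub>R v) a b c\<bar>)"
      by (rule member_le_sum) auto
    also have "\<dots> \<le> (\<Sum>b\<in>UNIV. \<Sum>c\<in>UNIV. \<bar>D (x0 + t *\<^sub>R v) a b c\<bar>)"
      by (rule member_le_sum[where f = "\<lambda>b. \<Sum>c\<in>UNIV. \<bar>D (x0 + t *\<^sub>R v) a b c\<bar>"]) (auto intro: sum_nonneg)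
    also have "\<dots> \<le> (\<Sum>a\<in>UNIV. \<Sum>b\<in>UNIV. \<Sum>c\<in>UNIV. \<bar>D (x0 + t *\<^sub>R v) a b c\<bar>)"
      by (rule member_le_sum[where f = "\<lambda>a. \<Sum>b\<in>UNIV. \<Sum>c\<in>UNIV. \<bar>D (x0 + t *\<^sub>R v) a b c\<bar>"])
        (auto intro: sum_nonneg)
    finally show ?thesis using C[OF that] by linarith
  qed
  have C0: "0 \<le> C" using DC[of 0 undefined undefined undefined] by auto
  have T2: "(T (x0 + t *\<^sub>R v) a b)\<^sup>2 \<le> w t" for t a b
  proof -
    have "(T (x0 + t *\<^sub>R v) a b)\<^sup>2 \<le> (\<Sum>b\<in>UNIV. (T (x0 + t *\<^sub>R v) a b)\<^sup>2)"
      by (rule member_le_sum) auto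
    also have "\<dots> \<le> w t"
      unfolding w_def
      by (rule member_le_sum[where f = "\<lambda>a. \<Sum>b\<in>UNIV. (T (x0 + t *\<^sub>R v) a b)\<^sup>2"]) (auto intro: sum_nonneg)
    finally show ?thesis .
  qed
  have TT: "\<bar>T (x0 + t *\<^sub>R v) a b\<bar> * \<bar>T (x0 + t *\<^sub>R v) c d\<bar> \<le> w t" for t a b c d
    using T2[of t a b] T2[of t c d]
      sum_squares_bound[of "\<bar>T (x0 + t *\<^sub>R v) a b\<bar>" "\<bar>T (x0 + t *\<^sub>R v) c d\<bar>"]
    by (simp add: power2_abs)
  define n where "n = real CARD('n)"
  \<comment> \<open>Counts the terms of the derivative of \<open>w\<close>: \<open>n * n\<close>
    pairs of indices, a factor 2 from the squares, and for each direction \<open>e\<close> a sum of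
    \<open>n\<close> terms, each bounded by \<open>2 * C * w t\<close>.\<close>
  define M where "M = n * (n * (2 * (\<Sum>e\<in>UNIV. \<bar>v $ e\<bar> * (n * (2 * C)))))"
  have bound: "(\<Sum>a\<in>UNIV. \<Sum>b\<in>UNIV. 2 * T (x0 + t *\<^sub>R v) a b * T' t a b) \<le> M * w t" if t: "t \<in> {0..1}" for t
  proof -
    let ?x = "x0 + t *\<^sub>R v"
    have par': "partial e (\<lambda>x. T x a b) ?x = (\<Sum>f\<in>UNIV. D ?x e a f * T ?x f b - D ?x e f b * T ?x a f)" for e a b
      using par[OF in_ball[OF t], of e a b] unfolding cov_deriv_11_def
      by (simp add: sum_subtractf algebra_simps)
    have 1: "\<bar>T ?x a b * (D ?x e a f * T ?x f b - D ?x e f b * T ?x a f)\<bar> \<le> 2 * C * w t" for a b e f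
    proof -
      have "\<bar>T ?x a b * (D ?x e a f * T ?x f b - D ?x e f b * T ?x a f)\<bar> \<le>
          \<bar>D ?x e a f\<bar> * (\<bar>T ?x a b\<bar> * \<bar>T ?x f b\<bar>) + \<bar>D ?x e f b\<bar> * (\<bar>T ?x a b\<bar> * \<bar>T ?x a f\<bar>)"
        unfolding right_diff_distrib by (rule order_trans[OF abs_triangle_ineq4]) (simp add: abs_mult mult_ac)
      also have "\<dots> \<le> C * w t + C * w t"
        by (intro add_mono mult_mono DC[OF t] TT C0) auto
      finally show ?thesis by simp
    qed
    have 2: "T ?x a b * T' t a b \<le> (\<Sum>e\<in>UNIV. \<bar>v $ e\<bar> * (n * (2 * C * w t)))" for a b
    proof -
      have "T ?x a b * T' t a b = (\<Sum>e\<in>UNIV. v $ e * (\<Sum>f\<in>UNIV. T ?x a b * (D ?x e a f * T ?x f b - D ?x e f b * T ?x a f)))"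
        unfolding T'_def par' by (simp add: sum_distrib_left mult.left_commute)
      also have "\<dots> \<le> (\<Sum>e\<in>UNIV. \<bar>v $ e\<bar> * (n * (2 * C * w t)))"
      proof (rule sum_mono)
        fix e
        have "\<bar>\<Sum>f\<in>UNIV. T ?x a b * (D ?x e a f * T ?x f b - D ?x e f b * T ?x a f)\<bar> \<le> (\<Sum>f\<in>(UNIV::'n set). 2 * C * w t)"
          by (rule order_trans[OF sum_abs]) (rule sum_mono, rule 1)
        then have abs: "\<bar>\<Sum>f\<in>UNIV. T ?x a b * (D ?x e a f * T ?x f b - D ?x e f b * T ?x a f)\<bar> \<le> n * (2 * C * w t)"
          by (simp add: n_def)
        have "k * s \<le> \<bar>k\<bar> * m" if "\<bar>s\<bar> \<le> m" for k s m :: real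
        proof -
          have "k * s \<le> \<bar>k\<bar> * \<bar>s\<bar>" by (metis abs_ge_self abs_mult)
          also have "\<dots> \<le> \<bar>k\<bar> * m" using that by (rule mult_left_mono) simp
          finally show ?thesis .
        qed
        from this[OF abs] show "v $ e * (\<Sum>f\<in>UNIV. T ?x a b * (D ?x e a f * T ?x f b - D ?x e f b * T ?x a f)) \<le> \<bar>v $ e\<bar> * (n * (2 * C * w t))"
          .
      qed
      finally show ?thesis .
    qed
    have "(\<Sum>a\<in>UNIV. \<Sum>b\<in>UNIV. 2 * T ?x a b * T' t a b) \<le>
        (\<Sum>a\<in>(UNIV::'n set). \<Sum>b\<in>(UNIV::'n set). 2 * (\<Sum>e\<in>UNIV. \<bar>v $ e\<bar> * (n * (2 * C * w t))))"
      using 2 by (intro sum_mono) (simp add: mult.assoc)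
    also have "\<dots> = M * w t"
      by (simp add: M_def n_def sum_distrib_left sum_distrib_right mult_ac)
    finally show ?thesis .
  qed
  have "exp (- (M * 1)) * w 1 \<le> exp (- (M * 0)) * w 0"
  proof (rule DERIV_nonpos_imp_nonincreasing[where f = "\<lambda>t. exp (- (M * t)) * w t"])
    fix t :: real assume "0 \<le> t" "t \<le> 1"
    then have t: "t \<in> {0..1}" by simp
    let ?w' = "\<Sum>a\<in>UNIV. \<Sum>b\<in>UNIV. 2 * T (x0 + t *\<^sub>R v) a b * T' t a b"
    have "((\<lambda>t. exp (- (M * t)) * w t) has_real_derivative exp (- (M * t)) * (?w' - M * w t)) (at t)"
      by (auto intro!: derivative_eq_intros dw[OF t] simp: algebra_simps)
    moreover have "exp (- (M * t)) * (?w' - M * w t) \<le> 0"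
      using bound[OF t] by (simp add: mult_nonneg_nonpos)
    ultimately show "\<exists>d. ((\<lambda>t. exp (- (M * t)) * w t) has_real_derivative d) (at t) \<and> d \<le> 0" by blast
  qed simp
  then have "w 1 \<le> 0" by (simp add: w_def zero mult_le_0_iff)
  then have "(T (x0 + 1 *\<^sub>R v) a b)\<^sup>2 \<le> 0" using T2[of 1 a b] by linarith
  then show ?thesis by (simp add: v_def)
qed

section \<open>Transition functions\<close>

context
  fixes M :: "('i, 'a, 'n::finite) atlas"
  assumes M: "smooth_manifold M"
begin

lemma chart_inj: "i \<in> charts M \<Longrightarrow> inj_on (cmap M i) (cdom M i)"
  and open_cran: "i \<in> charts M \<Longrightarrow> open (cran M i)"
  and open_overlap: "i \<in> charts M \<Longrightarrow> j \<in> charts M \<Longrightarrow> open (overlap M i j)"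
  and smooth_transition: "i \<in> charts M \<Longrightarrow> j \<in> charts M \<Longrightarrow> smooth_on (transition M i j) (overlap M i j)"
  using M by (auto simp: smooth_manifold_def)

lemma cinv_cmap: "i \<in> charts M \<Longrightarrow> p \<in> cdom M i \<Longrightarrow> cinv M i (cmap M i p) = p"
  by (simp add: cinv_def inv_into_f_f chart_inj)

lemma transition_cmap: "i \<in> charts M \<Longrightarrow> p \<in> cdom M i \<Longrightarrow> transition M i j (cmap M i p) = cmap M j p"
  by (simp add: transition_def cinv_cmap)

lemma jac_self:
  assumes "i \<in> charts M" "p \<in> cdom M i"
  shows "jac M i i (cmap M i p) a c = (if a = c then 1 else 0)"
proof -
  have "jac M i i (cmap M i p) a c = partial a (\<lambda>z. z $ c) (cmap M i p)"
    unfolding jac_def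
    by (rule partial_cong_open[OF open_cran[OF assms(1)]])
      (use assms transition_cmap in \<open>auto simp: cran_def\<close>)
  then show ?thesis by (simp add: partial_coordinate)
qed

text \<open>The chain rule. The direct and the composite transition are compared over the points
  common to all three charts, an open neighbourhood of the point in question.\<close>

lemma jac_cocycle:
  assumes ijk: "i \<in> charts M" "j \<in> charts M" "k \<in> charts M"
    and p: "p \<in> cdom M i" "p \<in> cdom M j" "p \<in> cdom M k"
  shows "jac M i k (cmap M i p) a d = (\<Sum>c\<in>UNIV. jac M i j (cmap M i p) a c * jac M j k (cmap M j p) c d)"
proof -
  let ?x = "cmap M i p" and ?y = "cmap M j p"
  let ?F = "\<lambda>w. transition M j k w $ d"
  have tx: "transition M i j ?x = ?y" by (rule transition_cmap[OF ijk(1) p(1)])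
  have "transition M i j differentiable (at ?x)"
    by (rule smooth_on_differentiable[OF smooth_transition[OF ijk(1,2)]]) (use p in \<open>auto simp: overlap_def\<close>)
  then obtain L where L: "(transition M i j has_derivative L) (at ?x)" by (auto simp: differentiable_def)
  have nth: "((\<lambda>w. g w $ c) has_derivative (\<lambda>h. L' h $ c)) (at z)"
    if "(g has_derivative L') (at z)" for g :: "real^'n \<Rightarrow> real^'n" and L' z c
    by (rule bounded_linear.has_derivative[OF bounded_linear_vec_nth that])
  have Lc: "L (axis a 1) $ c = jac M i j ?x a c" for c
    unfolding jac_def by (rule partial_eqI[OF nth[OF L], symmetric])
  have "transition M j k differentiable (at ?y)"
    by (rule smooth_on_differentiable[OF smooth_transition[OF ijk(2,3)]]) (use p in \<open>auto simp: overlap_def\<close>)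
  then have "?F differentiable (at ?y)"
    using nth unfolding differentiable_def by blast
  then have "(?F has_derivative (\<lambda>h. \<Sum>c\<in>UNIV. h $ c * partial c ?F (transition M i j ?x))) (at (transition M i j ?x))"
    unfolding tx by (rule has_derivative_partial)
  from has_derivative_compose[OF L this]
  have "partial a (\<lambda>z. ?F (transition M i j z)) ?x = (\<Sum>c\<in>UNIV. L (axis a 1) $ c * partial c ?F ?y)"
    by (subst partial_eqI) (auto simp: tx)
  moreover have "jac M i k ?x a d = partial a (\<lambda>z. ?F (transition M i j z)) ?x"
    unfolding jac_def
  proof (rule partial_cong_open)
    show "open (overlap M i j \<inter> overlap M i k)" using open_overlap ijk by auto
    show "?x \<in> overlap M i j \<inter> overlap M i k" using p by (auto simp: overlap_def)
    fix z assume "z \<in> overlap M i j \<inter> overlap M i k"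
    then obtain q where q: "q \<in> cdom M i" "q \<in> cdom M j" "z = cmap M i q" by (auto simp: overlap_def)
    then show "transition M i k z $ d = ?F (transition M i j z)"
      using transition_cmap[OF ijk(1) q(1)] transition_cmap[OF ijk(2) q(2)] by simp
  qed
  ultimately show ?thesis by (simp add: Lc jac_def)
qed

text \<open>The transformation law shows that \<open>T j\<close> times a Jacobian vanishes; by the
  cocycle rule that Jacobian is inverted by the one of the opposite transition.\<close>

lemma tensor_11_zero_invariant:
  assumes T: "tensor_field_11 M T" and ij: "i \<in> charts M" "j \<in> charts M"
    and p: "p \<in> cdom M i" "p \<in> cdom M j"
    and zero: "\<And>a b. T i (cmap M i p) a b = 0"
  shows "T j (cmap M j p) a b = 0"
proof -
  let ?x = "cmap M j p"
  have "?x \<in> overlap M j i" using p by (auto simp: overlap_def)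
  then have "(\<Sum>b\<in>UNIV. T j ?x a b * jac M j i ?x b d) =
      (\<Sum>c\<in>UNIV. jac M j i ?x a c * T i (transition M j i ?x) c d)" for d
    using T ij unfolding tensor_field_11_def by blast
  then have 0: "(\<Sum>b\<in>UNIV. T j ?x a b * jac M j i ?x b d) = 0" for d
    by (simp add: transition_cmap[OF ij(2) p(2)] zero)
  have "T j ?x a b = (\<Sum>c\<in>UNIV. T j ?x a c * jac M j j ?x c b)"
    by (simp add: jac_self[OF ij(2) p(2)] if_distrib[of "\<lambda>x. _ * x"] cong: if_cong)
  also have "\<dots> = (\<Sum>d\<in>UNIV. (\<Sum>c\<in>UNIV. T j ?x a c * jac M j i ?x c d) * jac M i j (cmap M i p) d b)"
    unfolding jac_cocycle[OF ij(2) ij(1) ij(2) p(2) p(1) p(2)] sum_distrib_left sum_distrib_right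
    by (subst sum.swap) (simp add: mult.assoc)
  finally show ?thesis by (simp add: 0)
qed

section \<open>The manifold topology and the zero set of a parallel field\<close>

lemma openin_chart: "i \<in> charts M \<Longrightarrow> open V \<Longrightarrow> openin (manifold_topology M) (cdom M i \<inter> cmap M i -` V)"
  unfolding manifold_topology_def by (rule topology_generated_by_Basis) blast

lemma topspace_manifold: "topspace (manifold_topology M) = points M"
proof -
  have "cdom M i = cdom M i \<inter> cmap M i -` UNIV" for i by simp
  then have "cdom M i \<subseteq> \<Union> {cdom M i \<inter> cmap M i -` V |i V. i \<in> charts M \<and> open V}" if "i \<in> charts M" for i
    using that open_UNIV by blast
  then show ?thesis
    unfolding manifold_topology_def topology_generated_by_topspace points_def by blast
qed

text \<open>The zero set of a parallel field is open and closed.\<close>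

lemma parallel_nowhere_zero:
  assumes D: "affine_connection M D" and T: "tensor_field_11 M T" and par: "parallel M D T"
    and nz: "nonzero_field M T" and i: "i \<in> charts M" and x: "x \<in> cran M i"
  shows "\<exists>a b. T i x a b \<noteq> 0"
proof (rule ccontr)
  define Z where "Z = {p. \<exists>i\<in>charts M. p \<in> cdom M i \<and> (\<forall>a b. T i (cmap M i p) a b = 0)}"
  define N where "N = {p. \<exists>i\<in>charts M. p \<in> cdom M i \<and> (\<exists>a b. T i (cmap M i p) a b \<noteq> 0)}"
  have smT: "smooth_on (\<lambda>x. T i x a b) (cran M i)" if "i \<in> charts M" for i a b
    using T that by (simp add: tensor_field_11_def)
  have smD: "smooth_on (\<lambda>x. D i x a b c) (cran M i)" if "i \<in> charts M" for i a b c
    using D that by (simp add: affine_connection_def)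
  have "openin (manifold_topology M) Z"
  proof (subst openin_subopen, intro ballI)
    fix p assume "p \<in> Z"
    then obtain i where i: "i \<in> charts M" "p \<in> cdom M i" "\<And>a b. T i (cmap M i p) a b = 0"
      by (auto simp: Z_def)
    then have "cmap M i p \<in> cran M i" by (simp add: cran_def)
    then obtain r where r: "r > 0" "ball (cmap M i p) r \<subseteq> cran M i"
      using open_cran[OF i(1)] openE by blast
    have "T i z a b = 0" if "z \<in> ball (cmap M i p) r" for z a b
      by (rule parallel_zero_on_ball[of "D i" "cmap M i p" r "T i"])
        (use that i r smooth_on_subset[OF smT r(2)] smooth_on_subset[OF smD r(2)] par in
          \<open>auto simp: parallel_def subset_iff\<close>)
    then have "cdom M i \<inter> cmap M i -` ball (cmap M i p) r \<subseteq> Z"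
      using i(1) by (auto simp: Z_def)
    then show "\<exists>W. openin (manifold_topology M) W \<and> p \<in> W \<and> W \<subseteq> Z"
      using openin_chart[OF i(1) open_ball, of "cmap M i p" r] i(2) r(1) by (intro exI conjI) auto
  qed
  moreover have "openin (manifold_topology M) N"
  proof (subst openin_subopen, intro ballI)
    fix p assume "p \<in> N"
    then obtain i a b where i: "i \<in> charts M" "p \<in> cdom M i" "T i (cmap M i p) a b \<noteq> 0"
      by (auto simp: N_def)
    define V where "V = {z \<in> cran M i. T i z a b \<noteq> 0}"
    have "V = cran M i \<inter> (\<lambda>z. T i z a b) -` (- {0})" by (auto simp: V_def)
    then have V: "open V"
      using continuous_open_preimage[OF smooth_on_continuous[OF smT[OF i(1)]] open_cran[OF i(1)], of "- {0}" a b]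
      by (simp add: open_Compl)
    have "cdom M i \<inter> cmap M i -` V \<subseteq> N" using i(1) by (auto simp: N_def V_def)
    then show "\<exists>W. openin (manifold_topology M) W \<and> p \<in> W \<and> W \<subseteq> N"
      using openin_chart[OF i(1) V] i(2,3) by (intro exI conjI) (auto simp: V_def cran_def)
  qed
  moreover have disj: "Z \<inter> N = {}"
  proof (rule equals0I)
    fix p assume "p \<in> Z \<inter> N"
    then obtain i j a b where "i \<in> charts M" "p \<in> cdom M i" "\<And>a b. T i (cmap M i p) a b = 0"
      and "j \<in> charts M" "p \<in> cdom M j" and nz: "T j (cmap M j p) a b \<noteq> 0"
      unfolding Z_def N_def by blast
    then have "T j (cmap M j p) a b = 0" by (intro tensor_11_zero_invariant[OF T, of i j p])
    with nz show False by contradiction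
  qed
  moreover have cover: "points M \<subseteq> Z \<union> N" by (auto simp: points_def Z_def N_def)
  moreover assume "\<nexists>a b. T i x a b \<noteq> 0"
  then obtain p where p: "p \<in> cdom M i" "p \<in> Z" using i x by (auto simp: Z_def cran_def)
  then have "p \<in> \<Union> (connected_components_of (manifold_topology M))"
    using i by (auto simp: Union_connected_components_of topspace_manifold points_def)
  then obtain C where C: "C \<in> connected_components_of (manifold_topology M)" "p \<in> C" by blast
  then have conn: "connectedin (manifold_topology M) C"
    by (simp add: connectedin_connected_components_of)
  have "C \<inter> N \<noteq> {}" using bspec[OF nz[unfolded nonzero_field_def] C(1)] unfolding N_def by blast
  moreover have "C \<subseteq> points M" using conn connectedin_subset_topspace topspace_manifold by blast
  ultimately show False
    using conn p(2) C(2) unfolding connectedin by blast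
qed

section \<open>Charts of the cotangent bundle\<close>

lemma cran_cotangent:
  assumes i: "i \<in> charts M"
  shows "cran (cotangent_bundle M) i = base_part -` cran M i"
proof (intro set_eqI iffI)
  fix y assume "y \<in> cran (cotangent_bundle M) i"
  then obtain p \<omega> where p: "p \<in> cdom M i" "y = cmap (cotangent_bundle M) i (p, \<omega>)"
    by (auto simp: cran_def cotangent_bundle_def)
  then have "base_part y = cmap M i p"
    by (simp add: cotangent_bundle_def base_part_def vec_eq_iff)
  then show "y \<in> base_part -` cran M i" using p by (simp add: cran_def)
next
  fix y assume "y \<in> base_part -` cran M i"
  then obtain p where p: "p \<in> cdom M i" "base_part y = cmap M i p" by (auto simp: cran_def)
  \<comment> \<open>Components prescribed in chart \<open>i\<close> are carried by Jacobians to
    every chart around \<open>p\<close>; the cocycle rule makes this family a covector.\<close>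
  define \<omega> where "\<omega> k = (if k \<in> charts M \<and> p \<in> cdom M k
    then (\<chi> a. \<Sum>c\<in>UNIV. jac M k i (cmap M k p) a c * fibre_part y $ c) else 0)" for k
  have "\<omega> \<in> covectors M p"
    unfolding covectors_def
  proof (intro CollectI conjI ballI allI impI; (elim conjE)?)
    fix k l a assume kl: "k \<in> charts M" "l \<in> charts M" "p \<in> cdom M k" "p \<in> cdom M l"
    have "\<omega> k $ a = (\<Sum>c\<in>UNIV. (\<Sum>d\<in>UNIV. jac M k l (cmap M k p) a d * jac M l i (cmap M l p) d c) * fibre_part y $ c)"
      using kl by (simp add: \<omega>_def jac_cocycle[OF kl(1,2) i kl(3,4) p(1)])
    also have "\<dots> = (\<Sum>d\<in>UNIV. jac M k l (cmap M k p) a d * \<omega> l $ d)"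
      using kl unfolding \<omega>_def sum_distrib_right by (subst sum.swap) (simp add: sum_distrib_left mult.assoc)
    finally show "\<omega> k $ a = (\<Sum>c\<in>UNIV. jac M k l (cmap M k p) a c * \<omega> l $ c)" .
  qed (auto simp: \<omega>_def)
  moreover have "\<omega> i = fibre_part y"
    using i p(1) by (simp add: \<omega>_def vec_eq_iff jac_self if_distrib[of "\<lambda>x. x * _"] cong: if_cong)
  then have "y = cmap (cotangent_bundle M) i (p, \<omega>)"
    using p(2) by (auto simp: cotangent_bundle_def vec_eq_iff base_part_def fibre_part_def split: sum.split)
  ultimately show "y \<in> cran (cotangent_bundle M) i"
    unfolding cran_def using p(1) by (auto simp: cotangent_bundle_def)
qed

lemma local_rep_cotangent:
  assumes i: "i \<in> charts M" and y: "y \<in> cran (cotangent_bundle M) i"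
  shows "local_rep (cotangent_bundle M) (h \<circ> fst) i y = lift (local_rep M h i) y"
proof -
  let ?q = "cinv (cotangent_bundle M) i y"
  have "?q \<in> cdom (cotangent_bundle M) i" "cmap (cotangent_bundle M) i ?q = y"
    using y by (auto simp: cinv_def cran_def intro: inv_into_into f_inv_into_f)
  moreover have "base_part (cmap (cotangent_bundle M) i q) = cmap M i (fst q)" for q
    by (cases q) (simp add: cotangent_bundle_def base_part_def vec_eq_iff)
  ultimately have "fst ?q \<in> cdom M i" "base_part y = cmap M i (fst ?q)"
    by (auto simp: cotangent_bundle_def)
  then show ?thesis by (simp add: local_rep_def lift_def cinv_cmap[OF i])
qed

lemma zero_covector: "(\<lambda>_. 0) \<in> covectors M p"
  by (simp add: covectors_def)

end

section \<open>The main theorem\<close>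

lemma hessian_cong:
  assumes "open U" "y \<in> U" "\<And>z. z \<in> U \<Longrightarrow> F z = F' z"
  shows "hessian \<Gamma> F y a b = hessian \<Gamma> F' y a b"
proof -
  have p: "partial c F z = partial c F' z" if "z \<in> U" for c z
    by (rule partial_cong_open[OF assms(1) that assms(3)])
  have "partial a (\<lambda>z. differential F z [b]) y = partial a (\<lambda>z. differential F' z [b]) y"
    by (rule partial_cong_open[OF assms(1,2)]) (simp add: differential_def p)
  then show ?thesis
    by (simp add: hessian_def cov_deriv_Cons conn_term_Cons conn_term_Nil)
      (simp add: differential_def p[OF assms(2)])
qed

text \<open>The diagonal of \<open>T^2 = 0\<close> says that the square of a diagonal entry is minus
  the product of the two off-diagonal ones. A nonzero row therefore has a nonzero off-diagonal
  entry, which is up to sign the determinant of \<open>v\<close> and \<open>T v\<close> for the axis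
  \<open>v\<close>.\<close>

lemma nilpotent_row:
  fixes T :: "2 \<Rightarrow> 2 \<Rightarrow> real"
  assumes nil: "\<And>a c. (\<Sum>b\<in>UNIV. T a b * T b c) = 0" and nz: "T a b \<noteq> 0"
  shows "(axis a 1 :: real^2) $ 1 * (\<Sum>b\<in>UNIV. (axis a 1 :: real^2) $ b * T b 2) -
    (axis a 1 :: real^2) $ 2 * (\<Sum>b\<in>UNIV. (axis a 1 :: real^2) $ b * T b 1) \<noteq> 0"
proof -
  have 1: "T 1 1 * T 1 1 + T 1 2 * T 2 1 = 0" and 2: "T 2 1 * T 1 2 + T 2 2 * T 2 2 = 0"
    using nil[of 1 1] nil[of 2 2] by (simp_all add: sum_2)
  show ?thesis
  proof (cases "a = 1")
    case True
    then have "T 1 1 \<noteq> 0 \<or> T 1 2 \<noteq> 0" using nz exhaust_2[of b] by auto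
    then have "T 1 2 \<noteq> 0" using 1 by auto
    then show ?thesis using True by (simp add: axis_def sum_2 two_neq_one)
  next
    case False
    then have a: "a = 2" using exhaust_2[of a] by auto
    then have "T 2 1 \<noteq> 0 \<or> T 2 2 \<noteq> 0" using nz exhaust_2[of b] by auto
    then have "T 2 1 \<noteq> 0" using 2 by auto
    then show ?thesis using a by (simp add: axis_def sum_2 two_neq_one)
  qed
qed

section \<open>From local frames to the whole manifold\<close>

locale surface_data =
  fixes \<Sigma> :: "('i, 'a, 2) atlas" and D :: "'i \<Rightarrow> 2 christoffel" and T \<Phi> :: "('i, 2) field2"
    and h :: "'a \<Rightarrow> real"
  assumes surface: "affine_surface \<Sigma> D"
    and T11: "tensor_field_11 \<Sigma> T" and T_par: "parallel \<Sigma> D T" and T_nil: "nilpotent \<Sigma> T"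
    and T_nz: "nonzero_field \<Sigma> T"
    and \<Phi>02: "tensor_field_02 \<Sigma> \<Phi>" and \<Phi>_symmetric: "symmetric_field \<Sigma> \<Phi>"
    and h_smooth: "smooth_function \<Sigma> h"
begin

lemma manifold: "smooth_manifold \<Sigma>" and connection: "affine_connection \<Sigma> D"
  using surface by (simp_all add: affine_surface_def)

lemma local_structure:
  assumes i: "i \<in> charts \<Sigma>" and x: "x \<in> cran \<Sigma> i"
  obtains U v where "x \<in> U" "U \<subseteq> cran \<Sigma> i" "nilpotent_structure U (D i) (T i) (\<Phi> i) v"
proof -
  obtain a b where ab: "T i x a b \<noteq> 0"
    using parallel_nowhere_zero[OF manifold connection T11 T_par T_nz i x] by blast
  define v :: "real^2" where "v = axis a 1"
  define d where "d z = v $ 1 * (\<Sum>b\<in>UNIV. v $ b * T i z b 2) - v $ 2 * (\<Sum>b\<in>UNIV. v $ b * T i z b 1)" for z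
  \<comment> \<open>The determinant condition is open, so one constant \<open>v\<close> serves a
    neighbourhood of \<open>x\<close>.\<close>
  define U where "U = cran \<Sigma> i \<inter> d -` (- {0})"
  have op: "open (cran \<Sigma> i)" by (rule open_cran[OF manifold i])
  have smT: "smooth_on (\<lambda>x. T i x a b) (cran \<Sigma> i)" for a b
    using T11 i by (simp add: tensor_field_11_def)
  have "smooth_on d (cran \<Sigma> i)"
    unfolding d_def[abs_def]
    by (intro smooth_on_diff[OF op] smooth_on_mult[OF op] smooth_on_sum[OF op] smooth_on_const smT)
  then have U: "open U"
    unfolding U_def by (intro continuous_open_preimage smooth_on_continuous op) (auto simp: open_Compl)
  have sub: "U \<subseteq> cran \<Sigma> i" by (auto simp: U_def)
  have nil: "(\<Sum>b\<in>UNIV. T i z a b * T i z b c) = 0" if "z \<in> cran \<Sigma> i" for z a c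
    using T_nil i that unfolding nilpotent_def by blast
  have "x \<in> U"
    using nilpotent_row[of "T i x", OF nil[OF x] ab] x by (simp add: U_def d_def v_def)
  moreover have "nilpotent_structure U (D i) (T i) (\<Phi> i) v"
  proof
    show "smooth_on (\<lambda>x. D i x a b c) U" for a b c
      by (rule smooth_on_subset[OF _ sub]) (use connection i in \<open>simp add: affine_connection_def\<close>)
    show "smooth_on (\<lambda>x. T i x a b) U" for a b
      using smT sub by (rule smooth_on_subset)
    show "smooth_on (\<lambda>x. \<Phi> i x a b) U" for a b
      by (rule smooth_on_subset[OF _ sub]) (use \<Phi>02 i in \<open>simp add: tensor_field_02_def\<close>)
    show "D i x a b c = D i x b a c" if "x \<in> U" for x a b c
      using surface i sub that unfolding affine_surface_def torsion_free_def by blast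
    show "\<Phi> i x a b = \<Phi> i x b a" if "x \<in> U" for x a b
      using \<Phi>_symmetric i sub that unfolding symmetric_field_def by blast
    show "cov_deriv_11 (D i) (T i) x a b c = 0" if "x \<in> U" for x a b c
      using T_par i sub that unfolding parallel_def by blast
    show "(\<Sum>b\<in>UNIV. T i x a b * T i x b c) = 0" if "x \<in> U" for x a c
      using nil sub that by blast
    show "v $ 1 * (\<Sum>b\<in>UNIV. v $ b * T i x b 2) - v $ 2 * (\<Sum>b\<in>UNIV. v $ b * T i x b 1) \<noteq> 0" if "x \<in> U" for x
      using that by (simp add: U_def d_def)
  qed (rule U)
  ultimately show ?thesis using that sub by blast
qed

abbreviation M where "M \<equiv> cotangent_bundle \<Sigma>"
abbreviation g where "g \<equiv> cotangent_metric D \<Phi> T"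
abbreviation f :: "'a \<times> ('i \<Rightarrow> real^2) \<Rightarrow> real" where "f \<equiv> h \<circ> fst"

lemma charts_M: "charts M = charts \<Sigma>"
  by (simp add: cotangent_bundle_def)

lemma smooth_rep: "i \<in> charts \<Sigma> \<Longrightarrow> smooth_on (local_rep \<Sigma> h i) (cran \<Sigma> i)"
  using h_smooth by (simp add: smooth_function_def)

lemma cotangent_metric_chart:
  "nilpotent_structure U (D i) (T i) (\<Phi> i) v \<Longrightarrow> g i = nilpotent_structure.G (D i) (T i) (\<Phi> i)"
  by (simp add: nilpotent_structure.G_def fun_eq_iff cotangent_metric_def)

text \<open>Pointwise, because the adapted frame exists only on a neighbourhood inside the chart,
  while \<open>lam\<close> is the same everywhere.\<close>

definition soliton_at :: "real \<Rightarrow> 'i \<Rightarrow> real^(2 + 2) \<Rightarrow> bool" where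
  "soliton_at lam i y \<longleftrightarrow> (\<forall>a b.
    hessian (levi_civita (g i)) (local_rep M f i) y a b + metric_ricci (g i) y a b = lam * g i y a b)"

definition conditions_at :: "'i \<Rightarrow> real^2 \<Rightarrow> bool" where
  "conditions_at i x \<longleftrightarrow>
    (\<forall>v :: real^2. (\<forall>b. (\<Sum>a\<in>UNIV. v $ a * T i x a b) = 0) \<longrightarrow>
      (\<Sum>a\<in>UNIV. v $ a * partial a (local_rep \<Sigma> h i) x) = 0) \<and>
    (\<forall>a b. hat T \<Phi> i x a b = - hessian (D i) (local_rep \<Sigma> h i) x a b - 2 * ricci_sym (D i) x a b)"

context
  fixes i U v
  assumes i: "i \<in> charts \<Sigma>" and sub: "U \<subseteq> cran \<Sigma> i"
    and str: "nilpotent_structure U (D i) (T i) (\<Phi> i) v"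
begin

interpretation nilpotent_structure U "D i" "T i" "\<Phi> i" v by (rule str)

lemma smooth_rep_U: "smooth_on (local_rep \<Sigma> h i) U"
  by (rule smooth_on_subset[OF smooth_rep[OF i] sub])

lemma rep_lift: "y \<in> total \<Longrightarrow> local_rep M f i y = lift (local_rep \<Sigma> h i) y"
  using local_rep_cotangent[OF manifold i, of y h] cran_cotangent[OF manifold i] sub by auto

lemma soliton_at_iff: "y \<in> total \<Longrightarrow>
  soliton_at lam i y \<longleftrightarrow> (\<forall>a b. soliton_defect (local_rep \<Sigma> h i) lam y a b = 0)"
  unfolding soliton_at_def soliton_defect_def cotangent_metric_chart[OF str]
  using hessian_cong[OF open_total _ rep_lift] by simp

lemma conditions_at_iff: "x \<in> U \<Longrightarrow> conditions_at i x \<longleftrightarrow>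
  base.X 2 (local_rep \<Sigma> h i) x = 0 \<and> (\<forall>a b. hat_defect (local_rep \<Sigma> h i) x a b = 0)"
proof -
  have "p = - q - r \<longleftrightarrow> p + q + r = 0" for p q r :: real by linarith
  then show "x \<in> U \<Longrightarrow> ?thesis"
    by (simp only: conditions_at_def ker_condition hat_defect_def hat_def)
qed

lemma chart_soliton_imp:
  assumes "\<And>y. y \<in> total \<Longrightarrow> soliton_at lam i y" and x: "x \<in> U"
  shows "lam = 0" "conditions_at i x"
proof -
  have *: "soliton_defect (local_rep \<Sigma> h i) lam y a b = 0" if "y \<in> total" for y a b
    using assms(1)[OF that] soliton_at_iff[OF that] by blast
  show "lam = 0" by (rule soliton_imp_reduced(1)[OF smooth_rep_U x *])
  have "\<forall>x\<in>U. reduced_equations (local_rep \<Sigma> h i) x"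
    using soliton_imp_reduced(2)[OF smooth_rep_U _ *] by blast
  then show "conditions_at i x"
    using reduced_iff[OF smooth_rep_U] conditions_at_iff[OF x] x by blast
qed

lemma chart_conditions_imp:
  assumes "\<And>x. x \<in> U \<Longrightarrow> conditions_at i x" and y: "y \<in> total"
  shows "soliton_at 0 i y"
proof -
  have "\<forall>x\<in>U. reduced_equations (local_rep \<Sigma> h i) x"
    unfolding reduced_iff[OF smooth_rep_U] using assms(1) conditions_at_iff by blast
  then show ?thesis
    unfolding soliton_at_iff[OF y] using reduced_imp_soliton[OF smooth_rep_U _ y] by blast
qed

lemma chart_bach: "y \<in> total \<Longrightarrow> bach (g i) y a b = 0"
  unfolding cotangent_metric_chart[OF str] by (rule bach_zero)

lemma gradient_rep: "y \<in> total \<Longrightarrow> gradient (g i) (local_rep M f i) y = gradient G (lift (local_rep \<Sigma> h i)) y"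
  unfolding cotangent_metric_chart[OF str] gradient_def fun_eq_iff
  using partial_cong_open[OF open_total _ rep_lift] by simp

lemma chart_null: "y \<in> total \<Longrightarrow> gradient_sqnorm (g i) (local_rep M f i) y = 0"
  using gradient_null[OF _ smooth_rep_U, of y] gradient_rep[of y]
  unfolding gradient_sqnorm_def by (simp add: cotangent_metric_chart[OF str])

lemma chart_gradient_zero:
  "y \<in> total \<Longrightarrow> (\<And>a. gradient (g i) (local_rep M f i) y a = 0) \<Longrightarrow>
    partial c (local_rep \<Sigma> h i) (base_part y) = 0"
  by (rule gradient_zero_imp[OF _ smooth_rep_U]) (simp_all add: gradient_rep)

end

lemma soliton_eq_iff: "ricci_soliton_eq M g f lam \<longleftrightarrow>
  (\<forall>i\<in>charts \<Sigma>. \<forall>y\<in>base_part -` cran \<Sigma> i. soliton_at lam i y)"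
  unfolding ricci_soliton_eq_def soliton_at_def charts_M
  using cran_cotangent[OF manifold] by simp

lemma bach_flat_cotangent: "bach_flat M g"
  unfolding bach_flat_def charts_M
proof (intro ballI allI)
  fix i y a b assume i: "i \<in> charts \<Sigma>" and "y \<in> cran M i"
  then have "base_part y \<in> cran \<Sigma> i" using cran_cotangent[OF manifold i] by simp
  then obtain U v where U: "base_part y \<in> U" "U \<subseteq> cran \<Sigma> i" "nilpotent_structure U (D i) (T i) (\<Phi> i) v"
    by (rule local_structure[OF i])
  show "bach (g i) y a b = 0" by (rule chart_bach[OF i U(2,3)]) (simp add: U(1))
qed

lemma soliton_imp:
  assumes sol: "ricci_soliton_eq M g f lam"
  shows "lam = 0" "\<forall>i\<in>charts \<Sigma>. \<forall>x\<in>cran \<Sigma> i. conditions_at i x"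
proof -
  have *: "lam = 0 \<and> conditions_at i x" if i: "i \<in> charts \<Sigma>" and x: "x \<in> cran \<Sigma> i" for i x
  proof -
    obtain U v where U: "x \<in> U" "U \<subseteq> cran \<Sigma> i" "nilpotent_structure U (D i) (T i) (\<Phi> i) v"
      by (rule local_structure[OF i x])
    have "soliton_at lam i y" if "y \<in> base_part -` U" for y
      using sol that U(2) i unfolding soliton_eq_iff by blast
    from chart_soliton_imp[OF i U(2,3) this U(1)] show ?thesis by blast
  qed
  then show "\<forall>i\<in>charts \<Sigma>. \<forall>x\<in>cran \<Sigma> i. conditions_at i x" by blast
  \<comment> \<open>One point is enough to fix \<open>lam\<close>; over an empty manifold every
    value would solve the equation.\<close>
  obtain p i where "i \<in> charts \<Sigma>" "p \<in> cdom \<Sigma> i"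
    using manifold by (auto simp: smooth_manifold_def points_def)
  then show "lam = 0" using *[of i "cmap \<Sigma> i p"] by (simp add: cran_def)
qed

lemma conditions_imp:
  assumes "\<forall>i\<in>charts \<Sigma>. \<forall>x\<in>cran \<Sigma> i. conditions_at i x"
  shows "ricci_soliton_eq M g f 0"
  unfolding soliton_eq_iff
proof (intro ballI)
  fix i and y :: "real^(2 + 2)"
  assume i: "i \<in> charts \<Sigma>" and "y \<in> base_part -` cran \<Sigma> i"
  then have "base_part y \<in> cran \<Sigma> i" by simp
  then obtain U v where U: "base_part y \<in> U" "U \<subseteq> cran \<Sigma> i" "nilpotent_structure U (D i) (T i) (\<Phi> i) v"
    by (rule local_structure[OF i])
  show "soliton_at 0 i y"
    by (rule chart_conditions_imp[OF i U(2,3)]) (use assms i U in auto)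
qed

lemma conditions_iff: "(\<forall>i\<in>charts \<Sigma>. \<forall>x\<in>cran \<Sigma> i. conditions_at i x) \<longleftrightarrow>
  dh_ker_zero \<Sigma> T h \<and> (\<forall>i\<in>charts \<Sigma>. \<forall>x\<in>cran \<Sigma> i. \<forall>a b.
    hat T \<Phi> i x a b = - hessian (D i) (local_rep \<Sigma> h i) x a b - 2 * ricci_sym (D i) x a b)"
  unfolding conditions_at_def dh_ker_zero_def by blast

lemma null_gradient_cotangent: "null_gradient M g f"
  unfolding null_gradient_def charts_M
proof (intro ballI)
  fix i y assume i: "i \<in> charts \<Sigma>" and "y \<in> cran M i"
  then have "base_part y \<in> cran \<Sigma> i" using cran_cotangent[OF manifold i] by simp
  then obtain U v where U: "base_part y \<in> U" "U \<subseteq> cran \<Sigma> i" "nilpotent_structure U (D i) (T i) (\<Phi> i) v"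
    by (rule local_structure[OF i])
  show "gradient_sqnorm (g i) (local_rep M f i) y = 0"
    by (rule chart_null[OF i U(2,3)]) (simp add: U(1))
qed

lemma gradient_nonzero:
  assumes q: "q \<in> points M" and crit: "\<not> critical_point \<Sigma> h (fst q)"
  shows "\<not> gradient_zero_at M g f q"
proof
  assume zero: "gradient_zero_at M g f q"
  obtain i c where i: "i \<in> charts \<Sigma>" "fst q \<in> cdom \<Sigma> i"
    and c: "partial c (local_rep \<Sigma> h i) (cmap \<Sigma> i (fst q)) \<noteq> 0"
    using crit unfolding critical_point_def by blast
  have "snd q \<in> covectors \<Sigma> (fst q)"
    using q by (auto simp: points_def cotangent_bundle_def)
  then have dom: "q \<in> cdom M i"
    using i(2) by (simp add: cotangent_bundle_def case_prod_beta)
  have base: "base_part (cmap M i q) = cmap \<Sigma> i (fst q)"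
    by (simp add: cotangent_bundle_def base_part_def vec_eq_iff case_prod_beta)
  have "cmap \<Sigma> i (fst q) \<in> cran \<Sigma> i" using i(2) by (simp add: cran_def)
  then obtain U v where U: "cmap \<Sigma> i (fst q) \<in> U" "U \<subseteq> cran \<Sigma> i" "nilpotent_structure U (D i) (T i) (\<Phi> i) v"
    by (rule local_structure[OF i(1)])
  have "gradient (g i) (local_rep M f i) (cmap M i q) a = 0" for a
    using zero dom i(1) unfolding gradient_zero_at_def charts_M by blast
  then have "partial c (local_rep \<Sigma> h i) (base_part (cmap M i q)) = 0"
    by (intro chart_gradient_zero[OF i(1) U(2,3)]) (simp_all add: base U(1))
  then show False using c by (simp add: base)
qed

lemma isotropic_cotangent:
  assumes p: "p \<in> points \<Sigma>" and crit: "\<not> critical_point \<Sigma> h p"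
  shows "isotropic M g f"
proof -
  \<comment> \<open>Every covector over \<open>p\<close> would do as a witness; the zero covector is
    always available.\<close>
  have "(p, \<lambda>_. 0) \<in> points M"
    using p zero_covector[OF manifold] by (auto simp: points_def cotangent_bundle_def)
  then show ?thesis
    unfolding isotropic_def using null_gradient_cotangent gradient_nonzero crit by fastforce
qed

end

theorem theorem4p3:
  fixes \<Sigma> :: "('i, 'a, 2) atlas"
    and D :: "'i \<Rightarrow> 2 christoffel"
    and T \<Phi> :: "('i, 2) field2"
    and h :: "'a \<Rightarrow> real"
  assumes "affine_surface \<Sigma> D"
    and "tensor_field_11 \<Sigma> T" and "parallel \<Sigma> D T" and "nilpotent \<Sigma> T" and "nonzero_field \<Sigma> T"
    and "tensor_field_02 \<Sigma> \<Phi>" and "symmetric_field \<Sigma> \<Phi>"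
    and "smooth_function \<Sigma> h"
  defines "M \<equiv> cotangent_bundle \<Sigma>"
    and "g \<equiv> cotangent_metric D \<Phi> T"
    and "f \<equiv> h \<circ> fst"
  shows
    "(bach_flat M g \<and> gradient_ricci_soliton M g f \<longleftrightarrow>
        dh_ker_zero \<Sigma> T h \<and>
        (\<forall>i\<in>charts \<Sigma>. \<forall>x\<in>cran \<Sigma> i. \<forall>a b.
           hat T \<Phi> i x a b =
             - hessian (D i) (local_rep \<Sigma> h i) x a b - 2 * ricci_sym (D i) x a b)) \<and>
     (bach_flat M g \<and> gradient_ricci_soliton M g f \<longrightarrow>
        steady M g f \<and>
        null_gradient M g f \<and>
        (\<forall>q\<in>points M. \<not> critical_point \<Sigma> h (fst q) \<longrightarrow> \<not> gradient_zero_at M g f q) \<and>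
        ((\<exists>p\<in>points \<Sigma>. \<not> critical_point \<Sigma> h p) \<longrightarrow> isotropic M g f))"
proof -
  interpret S: surface_data \<Sigma> D T \<Phi> h
    by unfold_locales (fact assms)+
  have sol: "gradient_ricci_soliton M g f \<longleftrightarrow> (\<forall>i\<in>charts \<Sigma>. \<forall>x\<in>cran \<Sigma> i. S.conditions_at i x)"
    unfolding gradient_ricci_soliton_def M_def g_def f_def
    using S.soliton_imp(2) S.conditions_imp by blast
  have "steady M g f" if "gradient_ricci_soliton M g f"
    unfolding steady_def using that S.soliton_imp(1) by (auto simp: M_def g_def f_def)
  then show ?thesis
    unfolding sol S.conditions_iff[symmetric]
    using S.bach_flat_cotangent S.null_gradient_cotangent S.gradient_nonzero S.isotropic_cotangent
    unfolding M_def g_def f_def by blast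
qed

end
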